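(* Let $k\ge1$ and let $P_k\in\mathrm{Syl}_3(\mathfrak S_{3^k})$. There exists a canonical bijection $$\Phi_{3^k}:\mathrm{Irr}_{3'}(\mathfrak S_{3^k})\to\mathrm{Irr}_{3'}(\mathbf N_{\mathfrak S_{3^k}}(P_k))$$ such that $\Phi_{3^k}(\chi)$ is an irreducible constituent of the restriction $\chi\downarrow_{\mathbf N_{\mathfrak S_{3^k}}(P_k)}$ for every $\chi\in\mathrm{Irr}_{3'}(\mathfrak S_{3^k})$.
   Context: $\mathrm{Irr}_{3'}(G)$ is the set of complex irreducible characters of the finite group $G$ of degree coprime to $3$. "Canonical" is informal: the bijection is given by an explicit choice-free rule. The formal content is the existence of a bijection with the stated compatibility with restriction. *)

theory Defs
  imports
    "HOL-Algebra.Algebra"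
    "HOL-Algebra.Sym_Groups"
    "HOL-Library.Multiset"
    "Jordan_Normal_Form.VS_Connect"
begin

definition sylow_subgroups :: "nat \<Rightarrow> ('a, 'b) monoid_scheme \<Rightarrow> 'a set set"
  where "sylow_subgroups p G =
    {P. subgroup P G \<and> card P = p ^ multiplicity p (Coset.order G)}"

abbreviation GL :: "nat \<Rightarrow> complex mat monoid"
  where "GL n \<equiv> units_of (ring_mat TYPE(complex) n ())"

definition matrix_rep :: "('a, 'b) monoid_scheme \<Rightarrow> nat \<Rightarrow> ('a \<Rightarrow> complex mat) \<Rightarrow> bool"
  where "matrix_rep G n \<rho> \<longleftrightarrow> \<rho> \<in> hom G (GL n)"

definition irreducible_rep :: "('a, 'b) monoid_scheme \<Rightarrow> nat \<Rightarrow> ('a \<Rightarrow> complex mat) \<Rightarrow> bool"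
  where "irreducible_rep G n \<rho> \<longleftrightarrow>
    matrix_rep G n \<rho> \<and> n > 0 \<and>
    (\<forall>W. VectorSpace.subspace class_ring W (module_vec TYPE(complex) n) \<and>
         (\<forall>g \<in> carrier G. \<forall>w \<in> W. \<rho> g *\<^sub>v w \<in> W) \<longrightarrow>
         W = {0\<^sub>v n} \<or> W = carrier_vec n)"

text \<open>Class functions are compared for equality below, so characters are extensional: they take
  the value \<open>undefined\<close> outside the group.\<close>

definition rep_character :: "('a, 'b) monoid_scheme \<Rightarrow> ('a \<Rightarrow> complex mat) \<Rightarrow> 'a \<Rightarrow> complex"
  where "rep_character G \<rho> = (\<lambda>g \<in> carrier G. sum_list (diag_mat (\<rho> g)))"

definition Irr :: "('a, 'b) monoid_scheme \<Rightarrow> ('a \<Rightarrow> complex) set"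
  where "Irr G = {rep_character G \<rho> | n \<rho>. irreducible_rep G n \<rho>}"

text \<open>The degree of a character is its value at the identity, a natural number.\<close>

definition Irr_p' :: "nat \<Rightarrow> ('a, 'b) monoid_scheme \<Rightarrow> ('a \<Rightarrow> complex) set"
  where "Irr_p' p G = {\<chi> \<in> Irr G. \<exists>d::nat. \<chi> \<one>\<^bsub>G\<^esub> = of_nat d \<and> coprime d p}"

text \<open>The multiset \<open>M\<close> lists the irreducible summands of \<open>\<psi>\<close> with their multiplicities.\<close>

definition irreducible_constituent ::
    "('a, 'b) monoid_scheme \<Rightarrow> ('a \<Rightarrow> complex) \<Rightarrow> ('a \<Rightarrow> complex) \<Rightarrow> bool"
  where "irreducible_constituent G \<theta> \<psi> \<longleftrightarrow>
    (\<exists>M. set_mset M \<subseteq> Irr G \<and> \<theta> \<in># M \<and> (\<forall>g \<in> carrier G. \<psi> g = (\<Sum>\<phi>\<in>#M. \<phi> g)))"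

abbreviation normalizer_group :: "('a, 'b) monoid_scheme \<Rightarrow> 'a set \<Rightarrow> ('a, 'b) monoid_scheme"
  where "normalizer_group G P \<equiv> G\<lparr>carrier := normalizer G P\<rparr>"

end

theory Submission
  imports
    Defs
    "Jordan_Normal_Form.Spectral_Radius"
    "HOL-Number_Theory.Cong"
begin

text \<open>
  Let \<open>\<sigma>\<close> be a cycle of length \<open>3\<^sup>k\<close>. It is conjugate to its powers prime to 3, already in the
  normalizer of a Sylow 3-subgroup, so characters take integer values at \<open>\<sigma>\<close> that are congruent to
  the degree modulo 3. The characters of degree prime to 3 therefore contribute at least 1 each to
  \<open>\<Sum>\<bar>\<chi>(\<sigma>)\<bar>\<^sup>2\<close>, which is at most the order \<open>3\<^sup>k\<close> of the centralizer. In both groups it is thus enough to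
  exhibit \<open>3\<^sup>k\<close> characters of degree prime to 3, and they are all of them.

  For the symmetric group these are the hook characters \<open>\<Lambda>\<^sup>j V\<close>, where \<open>V \<oplus> 1\<close> is the permutation
  module. In coordinates where points are strings of \<open>k\<close> ternary digits, the normalizer acts on the
  permutation module by monomial matrices with respect to a basis of waves: a wave of level \<open>i\<close> is
  supported on one block of level \<open>i\<close>, where it is a nontrivial character of the digit \<open>i\<close>. Hence
  \<open>\<Lambda>\<^sup>j V\<close> restricts to a monomial representation on the \<open>j\<close>-element sets of nonconstant waves. The
  ternary expansion of \<open>j\<close> singles out one orbit of such sets: at level \<open>i\<close> take no wave, all waves
  with one of the two possible characters, or all waves. This orbit spans an irreducible summand of
  degree \<open>2\<^sup>d\<close>, where \<open>d\<close> is the number of digits 1 of \<open>j\<close>, and these summands are pairwise distinct.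
\<close>

section \<open>Matrices and traces\<close>

text \<open>Irreducibility is certified throughout by norm 1 for an integral combination of
  irreducible characters. For the hooks this comes from the tridiagonal Gram matrix of the exterior
  powers of the permutation module; for the normalizer the norm is a sum over common stabilizers of
  sets of waves.

  Passing from points to waves inside an exterior power is done by traces alone: the trace of
  \<Lambda>^j A is the coefficient of t^j in det (1 + t A), which conjugation does not change.

  The delicate point is telling the summands apart. Rotating a digit detects the sum of the selected
  leading coefficients modulo 3, and this sum is 0 both for a level without waves and for a level
  with all waves, since 1 + 2 = 3. Inverting that digit separates the two cases: it exchanges 3^i
  pairs of waves, an odd number, so it has sign -1 where all waves are present.

  The bijection sends \<open>hook j\<close> to \<open>theta j\<close> for j < 3^k. An arbitrary
  Sylow subgroup is carried to the coordinate one by an isomorphism, along which all characters are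
  pulled back.\<close>

definition mtr :: "complex mat \<Rightarrow> complex"
  where "mtr A = sum_list (diag_mat A)"

lemma mtr_sum: "A \<in> carrier_mat n n \<Longrightarrow> mtr A = (\<Sum>i<n. A $$ (i, i))"
  by (simp add: mtr_def diag_mat_def sum_list_sum_nth atLeast0LessThan)

lemma mult_mat_entry:
  assumes "A \<in> carrier_mat n m" "B \<in> carrier_mat m l" "i < n" "j < l"
  shows "(A * B) $$ (i, j) = (\<Sum>x<m. A $$ (i, x) * B $$ (x, j))"
  using assms by (auto simp: scalar_prod_def atLeast0LessThan)

lemma mult_mat_vec_entry:
  assumes "A \<in> carrier_mat n m" "v \<in> carrier_vec m" "i < n"
  shows "(A *\<^sub>v v) $ i = (\<Sum>x<m. A $$ (i, x) * v $ x)"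
  using assms by (auto simp: scalar_prod_def atLeast0LessThan)

lemma mult_mat_zero_vec: "(A :: complex mat) \<in> carrier_mat m n \<Longrightarrow> A *\<^sub>v 0\<^sub>v n = 0\<^sub>v m"
  by (intro eq_vecI) (auto simp: scalar_prod_def)

lemma mtr_comm:
  assumes "A \<in> carrier_mat n m" "B \<in> carrier_mat m n"
  shows "mtr (A * B) = mtr (B * A)"
proof -
  have "mtr (A * B) = (\<Sum>i<n. \<Sum>j<m. A $$ (i, j) * B $$ (j, i))"
    using assms by (subst mtr_sum[of _ n]) (auto simp del: index_mult_mat intro!: sum.cong mult_mat_entry[OF assms])
  also have "\<dots> = (\<Sum>j<m. \<Sum>i<n. B $$ (j, i) * A $$ (i, j))"
    by (subst sum.swap) (simp add: mult.commute)
  also have "\<dots> = mtr (B * A)"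
    using assms by (subst mtr_sum[of _ m])
      (auto simp del: index_mult_mat intro!: sum.cong mult_mat_entry[OF assms(2,1), symmetric])
  finally show ?thesis .
qed

lemma mtr_conj:
  assumes "A \<in> carrier_mat n n" "S \<in> carrier_mat n n" "T \<in> carrier_mat n n" "S * T = 1\<^sub>m n"
  shows "mtr (T * A * S) = mtr A"
proof -
  have "mtr (T * A * S) = mtr (T * (A * S))"
    using assms by (simp add: assoc_mult_mat[of _ n n _ n _ n])
  also have "\<dots> = mtr (A * S * T)"
    using assms by (intro mtr_comm) auto
  also have "A * S * T = A"
    using assms by (simp add: assoc_mult_mat[of _ n n _ n _ n])
  finally show ?thesis .
qed

section \<open>Matrix representations\<close>

lemma matrix_repI:
  assumes "group G"
    and "\<And>g. g \<in> carrier G \<Longrightarrow> \<rho> g \<in> carrier_mat n n"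
    and "\<And>g h. g \<in> carrier G \<Longrightarrow> h \<in> carrier G \<Longrightarrow> \<rho> (g \<otimes>\<^bsub>G\<^esub> h) = \<rho> g * \<rho> h"
    and "\<rho> \<one>\<^bsub>G\<^esub> = 1\<^sub>m n"
  shows "matrix_rep G n \<rho>"
proof -
  interpret group G by fact
  have "\<rho> g \<in> carrier (GL n)" if "g \<in> carrier G" for g
    using that assms(2)[of g] assms(2)[of "inv\<^bsub>G\<^esub> g"] assms(3)[of g "inv\<^bsub>G\<^esub> g"]
      assms(3)[of "inv\<^bsub>G\<^esub> g" g] assms(4)
    by (auto simp: units_of_def Units_def ring_mat_def intro!: bexI[of _ "\<rho> (inv\<^bsub>G\<^esub> g)"])
  then show ?thesis
    using assms(3) by (auto simp: matrix_rep_def hom_def units_of_def ring_mat_def)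
qed

text \<open>The value at the identity needs an argument because \<open>hom\<close> does not mention
  it: it is an idempotent with an inverse.\<close>

lemma matrix_repD:
  assumes "matrix_rep G n \<rho>" "group G"
  shows "\<And>g. g \<in> carrier G \<Longrightarrow> \<rho> g \<in> carrier_mat n n"
    and "\<And>g h. g \<in> carrier G \<Longrightarrow> h \<in> carrier G \<Longrightarrow> \<rho> (g \<otimes>\<^bsub>G\<^esub> h) = \<rho> g * \<rho> h"
    and "\<rho> \<one>\<^bsub>G\<^esub> = 1\<^sub>m n"
proof -
  interpret group G by fact
  show c: "\<And>g. g \<in> carrier G \<Longrightarrow> \<rho> g \<in> carrier_mat n n"
    and m: "\<And>g h. g \<in> carrier G \<Longrightarrow> h \<in> carrier G \<Longrightarrow> \<rho> (g \<otimes>\<^bsub>G\<^esub> h) = \<rho> g * \<rho> h"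
    using assms by (auto simp: matrix_rep_def hom_def units_of_def Units_def ring_mat_def Pi_def)
  have "\<rho> \<one>\<^bsub>G\<^esub> \<in> carrier (GL n)"
    using assms(1) by (auto simp: matrix_rep_def hom_def)
  then obtain B where B: "B \<in> carrier_mat n n" "B * \<rho> \<one>\<^bsub>G\<^esub> = 1\<^sub>m n"
    by (auto simp: units_of_def Units_def ring_mat_def)
  have c1: "\<rho> \<one>\<^bsub>G\<^esub> \<in> carrier_mat n n" and m1: "\<rho> \<one>\<^bsub>G\<^esub> * \<rho> \<one>\<^bsub>G\<^esub> = \<rho> \<one>\<^bsub>G\<^esub>"
    using c[of "\<one>\<^bsub>G\<^esub>"] m[of "\<one>\<^bsub>G\<^esub>" "\<one>\<^bsub>G\<^esub>"] by simp_all
  have "\<rho> \<one>\<^bsub>G\<^esub> = (B * \<rho> \<one>\<^bsub>G\<^esub>) * \<rho> \<one>\<^bsub>G\<^esub>"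
    using B c1 by simp
  also have "\<dots> = B * (\<rho> \<one>\<^bsub>G\<^esub> * \<rho> \<one>\<^bsub>G\<^esub>)"
    using B(1) c1 by (simp only: assoc_mult_mat[of _ n n _ n _ n])
  finally show "\<rho> \<one>\<^bsub>G\<^esub> = 1\<^sub>m n"
    using B m1 by simp
qed

lemma rep_character_mtr: "g \<in> carrier G \<Longrightarrow> rep_character G \<rho> g = mtr (\<rho> g)"
  by (simp add: rep_character_def mtr_def)

text \<open>Subrepresentations and exterior powers come indexed by sets of coordinates or by sets of
  subsets. An enumeration \<open>e\<close> turns such an index set into \<open>{..<card Y}\<close>,
  and the trace does not depend on it.\<close>

lemma rep_of_indexed:
  fixes R :: "'g \<Rightarrow> 'x \<Rightarrow> 'x \<Rightarrow> complex"
  assumes "group G" "finite Y"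
    and one: "\<And>x y. x \<in> Y \<Longrightarrow> y \<in> Y \<Longrightarrow> R \<one>\<^bsub>G\<^esub> x y = (if x = y then 1 else 0)"
    and mult: "\<And>g h x y. g \<in> carrier G \<Longrightarrow> h \<in> carrier G \<Longrightarrow> x \<in> Y \<Longrightarrow> y \<in> Y \<Longrightarrow>
      R (g \<otimes>\<^bsub>G\<^esub> h) x y = (\<Sum>z\<in>Y. R g x z * R h z y)"
  obtains \<rho> where "matrix_rep G (card Y) \<rho>" "\<And>g. g \<in> carrier G \<Longrightarrow> mtr (\<rho> g) = (\<Sum>x\<in>Y. R g x x)"
proof -
  obtain e where e: "bij_betw e {..<card Y} Y"
    using ex_bij_betw_nat_finite[OF assms(2)] by (auto simp: atLeast0LessThan)
  have eX: "e i \<in> Y" if "i < card Y" for i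
    using e that by (auto simp: bij_betw_def)
  have einj: "e i = e j \<longleftrightarrow> i = j" if "i < card Y" "j < card Y" for i j
    using e that by (auto simp: bij_betw_def inj_on_def)
  define \<rho> where "\<rho> g = mat (card Y) (card Y) (\<lambda>(i, j). R g (e i) (e j))" for g
  have reidx: "(\<Sum>i<card Y. f (e i)) = (\<Sum>x\<in>Y. f x)" for f :: "'x \<Rightarrow> complex"
    by (rule sum.reindex_bij_betw[OF e])
  have "matrix_rep G (card Y) \<rho>"
  proof (rule matrix_repI[OF assms(1)])
    fix g h assume gh: "g \<in> carrier G" "h \<in> carrier G"
    show "\<rho> (g \<otimes>\<^bsub>G\<^esub> h) = \<rho> g * \<rho> h"
    proof (rule eq_matI)
      fix i j assume "i < dim_row (\<rho> g * \<rho> h)" "j < dim_col (\<rho> g * \<rho> h)"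
      then have ij: "i < card Y" "j < card Y" by (auto simp: \<rho>_def)
      have "(\<rho> g * \<rho> h) $$ (i, j) = (\<Sum>x<card Y. \<rho> g $$ (i, x) * \<rho> h $$ (x, j))"
        using ij by (intro mult_mat_entry[of _ "card Y" "card Y" _ "card Y"]) (auto simp: \<rho>_def)
      also have "\<dots> = (\<Sum>x<card Y. R g (e i) (e x) * R h (e x) (e j))"
        using ij by (auto simp: \<rho>_def intro!: sum.cong)
      also have "\<dots> = (\<Sum>z\<in>Y. R g (e i) z * R h z (e j))"
        by (rule reidx)
      also have "\<dots> = R (g \<otimes>\<^bsub>G\<^esub> h) (e i) (e j)"
        using mult[OF gh eX eX] ij by simp
      finally show "\<rho> (g \<otimes>\<^bsub>G\<^esub> h) $$ (i, j) = (\<rho> g * \<rho> h) $$ (i, j)"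
        using ij by (simp add: \<rho>_def)
    qed (auto simp: \<rho>_def)
  next
    show "\<rho> \<one>\<^bsub>G\<^esub> = 1\<^sub>m (card Y)"
      using eX one einj by (intro eq_matI) (auto simp: \<rho>_def)
  qed (auto simp: \<rho>_def)
  moreover have "mtr (\<rho> g) = (\<Sum>x\<in>Y. R g x x)" for g
    using reidx[of "\<lambda>x. R g x x"] by (subst mtr_sum[of _ "card Y"]) (auto simp: \<rho>_def)
  ultimately show thesis by (rule that)
qed

section \<open>Complete reducibility at the level of characters\<close>

lemma subspace_iff:
  "VectorSpace.subspace class_ring W (module_vec TYPE(complex) n) \<longleftrightarrow>
    W \<subseteq> carrier_vec n \<and> 0\<^sub>v n \<in> W \<and> (\<forall>v\<in>W. \<forall>w\<in>W. v + w \<in> W) \<and> (\<forall>c. \<forall>v\<in>W. c \<cdot>\<^sub>v v \<in> W)"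
  (is "?L \<longleftrightarrow> ?R")
proof
  assume ?L
  then have "submodule class_ring W (module_vec TYPE(complex) n)"
    by (simp add: VectorSpace.subspace_def)
  then show ?R
    unfolding submodule_def by (auto simp: module_vec_def)
next
  assume R: ?R
  have "submodule class_ring W (module_vec TYPE(complex) n)"
    unfolding submodule_def using R vec_module[where 'a = complex]
    by (auto simp: module_vec_def)
  then show ?L
    using vec_vs by (simp add: VectorSpace.subspace_def)
qed

text \<open>A basis of \<open>W\<close> is completed to a basis of the whole space, the columns of \<open>S\<close>;
  the columns with index in \<open>I\<close> are those in \<open>W\<close>.\<close>

lemma adapted_basis:
  fixes W :: "complex vec set"
  assumes "VectorSpace.subspace class_ring W (module_vec TYPE(complex) n)"
  obtains S T :: "complex mat" and I where
    "S \<in> carrier_mat n n" "T \<in> carrier_mat n n" "S * T = 1\<^sub>m n" "T * S = 1\<^sub>m n" "I \<subseteq> {..<n}"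
    "\<And>v. v \<in> carrier_vec n \<Longrightarrow> S *\<^sub>v v \<in> W \<longleftrightarrow> (\<forall>i\<in>{..<n} - I. v $ i = 0)"
proof -
  have W: "W \<subseteq> carrier_vec n" "0\<^sub>v n \<in> W" "\<And>v w. v \<in> W \<Longrightarrow> w \<in> W \<Longrightarrow> v + w \<in> W"
    "\<And>c v. v \<in> W \<Longrightarrow> c \<cdot>\<^sub>v v \<in> W"
    using assms by (auto simp: subspace_iff)
  \<comment> \<open>Only one inclusion is demanded, namely that the columns in \<open>I\<close> span
    a subspace of \<open>W\<close>; the converse follows because \<open>I\<close> is taken of
    maximal size.\<close>
  define Q where "Q I S \<longleftrightarrow> I \<subseteq> {..<n} \<and> S \<in> carrier_mat n n \<and> det S \<noteq> 0 \<and>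
    (\<forall>v\<in>carrier_vec n. (\<forall>i\<in>{..<n} - I. v $ i = 0) \<longrightarrow> S *\<^sub>v v \<in> W)"
    for I and S :: "complex mat"
  have Q0: "Q {} (1\<^sub>m n)"
  proof -
    have "v = 0\<^sub>v n" if "v \<in> carrier_vec n" "\<forall>i\<in>{..<n} - {}. v $ i = 0" for v :: "complex vec"
      using that by auto
    then show ?thesis
      using W(2) by (auto simp: Q_def)
  qed
  define m where "m = (GREATEST m. \<exists>I S. Q I S \<and> card I = m)"
  have bound: "card I \<le> n" if "Q I S" for I S
    using that card_mono[of "{..<n}" I] by (auto simp: Q_def)
  have ex: "\<exists>I S. Q I S \<and> card I = m"
    unfolding m_def by (rule GreatestI_nat[of _ 0 n]) (use Q0 bound in auto)
  then obtain I S where IS: "Q I S" "card I = m" by auto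
  have max: "card J \<le> m" if "Q J S'" for J S'
    unfolding m_def by (rule Greatest_le_nat[of _ _ n]) (use that bound in auto)
  have S: "S \<in> carrier_mat n n" and dS: "det S \<noteq> 0" and I: "I \<subseteq> {..<n}"
    using IS by (auto simp: Q_def)
  have finI: "finite I"
    using I finite_subset by blast
  obtain T where T: "T \<in> carrier_mat n n" "S * T = 1\<^sub>m n" "T * S = 1\<^sub>m n"
    using det_non_zero_imp_unit[OF S dS, of "()"] by (auto simp: Units_def ring_mat_def)
  have "\<forall>i\<in>{..<n} - I. u $ i = 0" if u: "u \<in> carrier_vec n" "S *\<^sub>v u \<in> W" for u
  proof (rule ccontr)
    assume "\<not> ?thesis"
    then obtain i where i: "i < n" "i \<notin> I" "u $ i \<noteq> 0" by auto
    \<comment> \<open>\<open>E\<close> is the identity with column \<open>i\<close> replaced by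
      \<open>u\<close>, so \<open>S * E\<close> has the vector \<open>S *\<^sub>v u\<close> of
      \<open>W\<close> as its new column \<open>i\<close>. It is invertible since
      \<open>u $ i\<close> is nonzero, and \<open>I\<close> could be enlarged by
      \<open>i\<close>.\<close>
    define E where "E = mat n n (\<lambda>(l, j). if j = i then u $ l else if l = j then 1 else 0 :: complex)"
    have E: "E \<in> carrier_mat n n" by (simp add: E_def)
    have Ev: "E *\<^sub>v v = v $ i \<cdot>\<^sub>v u + vec n (\<lambda>l. if l = i then 0 else v $ l)" if "v \<in> carrier_vec n" for v
    proof (rule eq_vecI)
      fix l assume "l < dim_vec (v $ i \<cdot>\<^sub>v u + vec n (\<lambda>l. if l = i then 0 else v $ l))"
      then have l: "l < n" by simp
      have "(E *\<^sub>v v) $ l = (\<Sum>j<n. (if j = i then u $ l else if l = j then 1 else 0) * v $ j)"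
        using l that by (subst mult_mat_vec_entry[OF E that l]) (auto simp: E_def intro!: sum.cong)
      also have "\<dots> = u $ l * v $ i + (\<Sum>j\<in>{..<n} - {i}. (if l = j then 1 else 0) * v $ j)"
        using i by (subst sum.remove[of _ i]) (auto intro!: sum.cong)
      also have "(\<Sum>j\<in>{..<n} - {i}. (if l = j then 1 else 0) * v $ j) = (if l = i then 0 else v $ l)"
        using l by (auto simp: if_distrib[of "\<lambda>x. x * _"] cong: if_cong)
      finally show "(E *\<^sub>v v) $ l = (v $ i \<cdot>\<^sub>v u + vec n (\<lambda>l. if l = i then 0 else v $ l)) $ l"
        using l u that by (simp add: mult.commute)
    qed (simp add: E_def)
    have "det E \<noteq> 0"
    proof
      assume "det E = 0"
      then obtain v where v: "v \<in> carrier_vec n" "v \<noteq> 0\<^sub>v n" "E *\<^sub>v v = 0\<^sub>v n"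
        using det_0_iff_vec_prod_zero_field[OF E] by auto
      have ent: "v $ i * u $ l + (if l = i then 0 else v $ l) = 0" if "l < n" for l
      proof -
        have "(E *\<^sub>v v) $ l = 0" using v(3) that by simp
        then show ?thesis unfolding Ev[OF v(1)] using that u by simp
      qed
      from ent[OF i(1)] have "v $ i = 0" using i by simp
      then have "v $ l = 0" if "l < n" for l
        using ent[OF that] that by (auto split: if_splits)
      then have "v = 0\<^sub>v n" using v(1) by (intro eq_vecI) auto
      with v show False by simp
    qed
    moreover have "(S * E) *\<^sub>v v \<in> W"
      if v: "v \<in> carrier_vec n" "\<forall>j\<in>{..<n} - insert i I. v $ j = 0" for v
    proof -
      have "(S * E) *\<^sub>v v = S *\<^sub>v (v $ i \<cdot>\<^sub>v u + vec n (\<lambda>l. if l = i then 0 else v $ l))"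
        using S E v by (simp add: Ev assoc_mult_mat_vec[of _ n n _ n])
      also have "\<dots> = v $ i \<cdot>\<^sub>v (S *\<^sub>v u) + S *\<^sub>v vec n (\<lambda>l. if l = i then 0 else v $ l)"
        using S u by (subst mult_add_distrib_mat_vec[of _ n n]) (auto simp: mult_mat_vec[of _ n n])
      also have "\<dots> \<in> W"
        using IS u v by (intro W) (auto simp: Q_def)
      finally show ?thesis .
    qed
    ultimately have "Q (insert i I) (S * E)"
      using I i S E dS by (auto simp: Q_def det_mult[of _ n])
    from max[OF this] show False
      using i IS(2) finI by simp
  qed
  moreover have "S *\<^sub>v u \<in> W" if "u \<in> carrier_vec n" "\<forall>i\<in>{..<n} - I. u $ i = 0" for u
    using IS that by (auto simp: Q_def)
  ultimately show thesis
    using that[OF S T I] by blast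
qed

text \<open>In the basis \<open>S\<close> every matrix is block triangular, so each diagonal block
  is multiplicative by itself: \<open>\<alpha>\<close> is the action on \<open>W\<close> and
  \<open>\<beta>\<close> the action on the quotient. The trace sees just these two blocks.\<close>

lemma matrix_rep_split:
  fixes G (structure)
  assumes G: "group G" and rep: "matrix_rep G n \<rho>"
    and W: "VectorSpace.subspace class_ring W (module_vec TYPE(complex) n)"
    and inv: "\<And>g w. g \<in> carrier G \<Longrightarrow> w \<in> W \<Longrightarrow> \<rho> g *\<^sub>v w \<in> W"
    and nt: "W \<noteq> {0\<^sub>v n}" "W \<noteq> carrier_vec n"
  obtains a b \<alpha> \<beta> where "a < n" "b < n" "matrix_rep G a \<alpha>" "matrix_rep G b \<beta>"
    "\<And>g. g \<in> carrier G \<Longrightarrow> mtr (\<rho> g) = mtr (\<alpha> g) + mtr (\<beta> g)"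
proof -
  note D = matrix_repD[OF rep G]
  interpret group G by fact
  obtain S T I where S: "S \<in> carrier_mat n n" and T: "T \<in> carrier_mat n n"
    and ST: "S * T = 1\<^sub>m n" "T * S = 1\<^sub>m n" and I: "I \<subseteq> {..<n}"
    and SW: "\<And>v. v \<in> carrier_vec n \<Longrightarrow> S *\<^sub>v v \<in> W \<longleftrightarrow> (\<forall>i\<in>{..<n} - I. v $ i = 0)"
    using adapted_basis[OF W] by metis
  have Wsub: "W \<subseteq> carrier_vec n" and W0: "0\<^sub>v n \<in> W" using W by (auto simp: subspace_iff)
  have finI: "finite I" using I finite_subset by blast
  have STv: "S *\<^sub>v (T *\<^sub>v v) = v" if "v \<in> carrier_vec n" for v
    using that S T ST by (metis assoc_mult_mat_vec one_mult_mat_vec)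
  have TSv: "T *\<^sub>v (S *\<^sub>v v) = v" if "v \<in> carrier_vec n" for v
    using that S T ST by (metis assoc_mult_mat_vec one_mult_mat_vec)
  have "I \<noteq> {}"
  proof
    assume "I = {}"
    have "w = 0\<^sub>v n" if "w \<in> W" for w
    proof -
      have "T *\<^sub>v w = 0\<^sub>v n"
        using SW[of "T *\<^sub>v w"] STv[of w] that Wsub T \<open>I = {}\<close> by (intro eq_vecI) auto
      then show ?thesis
        using STv[of w] that Wsub mult_mat_zero_vec[OF S] by auto
    qed
    then have "W = {0\<^sub>v n}" using W0 by blast
    with nt show False by simp
  qed
  have "I \<noteq> {..<n}"
  proof
    assume "I = {..<n}"
    then have "v \<in> W" if "v \<in> carrier_vec n" for v
      using SW[of "T *\<^sub>v v"] STv[of v] that T by auto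
    then have "W = carrier_vec n" using Wsub by blast
    with nt show False by simp
  qed
  define R where "R g i j = (T * \<rho> g * S) $$ (i, j)" for g i j
  have TrS: "T * \<rho> g * S \<in> carrier_mat n n" if "g \<in> carrier G" for g
    using D(1)[OF that] S T by simp
  have R0: "R g i j = 0" if "g \<in> carrier G" "j \<in> I" "i \<in> {..<n} - I" for g i j
  proof -
    have j: "j < n" using that I by auto
    have "\<forall>i\<in>{..<n} - I. (unit_vec n j :: complex vec) $ i = 0"
      using that j by auto
    then have "S *\<^sub>v unit_vec n j \<in> W"
      using SW[of "unit_vec n j"] by simp
    then have "\<rho> g *\<^sub>v (S *\<^sub>v unit_vec n j) \<in> W"
      using inv that by simp
    moreover have "\<rho> g *\<^sub>v (S *\<^sub>v unit_vec n j) = S *\<^sub>v ((T * \<rho> g * S) *\<^sub>v unit_vec n j)"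
    proof -
      have "(T * \<rho> g * S) *\<^sub>v unit_vec n j = T *\<^sub>v (\<rho> g *\<^sub>v (S *\<^sub>v unit_vec n j))"
        using D(1)[OF that(1)] S T by (simp add: assoc_mult_mat_vec[of _ n n _ n])
      then show ?thesis
        using D(1)[OF that(1)] S by (simp add: STv)
    qed
    ultimately have "((T * \<rho> g * S) *\<^sub>v unit_vec n j) $ i = 0"
      using SW[of "(T * \<rho> g * S) *\<^sub>v unit_vec n j"] TrS[OF that(1)] that by auto
    moreover have "((T * \<rho> g * S) *\<^sub>v unit_vec n j) $ i = R g i j"
    proof -
      have "((T * \<rho> g * S) *\<^sub>v unit_vec n j) $ i = (\<Sum>x<n. (T * \<rho> g * S) $$ (i, x) * unit_vec n j $ x)"
        using that by (intro mult_mat_vec_entry[OF TrS]) auto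
      also have "\<dots> = (\<Sum>x<n. if x = j then R g i x else 0)"
        using j by (intro sum.cong) (auto simp: R_def unit_vec_def)
      finally show ?thesis using j by simp
    qed
    ultimately show ?thesis by simp
  qed
  have Rmult: "R (g \<otimes> h) i j = (\<Sum>z<n. R g i z * R h z j)"
    if "g \<in> carrier G" "h \<in> carrier G" "i < n" "j < n" for g h i j
  proof -
    have "T * \<rho> (g \<otimes> h) * S = T * (\<rho> g * ((S * T) * (\<rho> h * S)))"
      using D(1)[OF that(1)] D(1)[OF that(2)] S T D(2)[OF that(1,2)] ST
      by (simp add: assoc_mult_mat[of _ n n _ n _ n])
    also have "\<dots> = (T * \<rho> g * S) * (T * \<rho> h * S)"
      using D(1)[OF that(1)] D(1)[OF that(2)] S T
      by (simp add: assoc_mult_mat[of _ n n _ n _ n])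
    finally show ?thesis
      unfolding R_def using that by (simp only: mult_mat_entry[OF TrS[OF that(1)] TrS[OF that(2)]])
  qed
  have R1: "R \<one> i j = (if i = j then 1 else 0)" if "i < n" "j < n" for i j
    using that S T ST by (simp add: R_def D(3))
  have sumsplit: "(\<Sum>z<n. f z) = (\<Sum>z\<in>I. f z) + (\<Sum>z\<in>{..<n} - I. f z)" for f :: "nat \<Rightarrow> complex"
    using sum.subset_diff[OF I, of f] by (simp add: add.commute)
  obtain \<alpha> where \<alpha>: "matrix_rep G (card I) \<alpha>" "\<And>g. g \<in> carrier G \<Longrightarrow> mtr (\<alpha> g) = (\<Sum>x\<in>I. R g x x)"
  proof (rule rep_of_indexed[OF G finI, of R])
    fix g h x y assume gh: "g \<in> carrier G" "h \<in> carrier G" "x \<in> I" "y \<in> I"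
    have "(\<Sum>z\<in>{..<n} - I. R g x z * R h z y) = 0"
      using gh by (intro sum.neutral) (auto simp: R0)
    then show "R (g \<otimes> h) x y = (\<Sum>z\<in>I. R g x z * R h z y)"
      using gh I by (subst Rmult) (auto simp: sumsplit)
  qed (use I R1 finI in \<open>auto simp: subset_iff\<close>)
  obtain \<beta> where \<beta>: "matrix_rep G (card ({..<n} - I)) \<beta>"
    "\<And>g. g \<in> carrier G \<Longrightarrow> mtr (\<beta> g) = (\<Sum>x\<in>{..<n} - I. R g x x)"
  proof (rule rep_of_indexed[OF G, of "{..<n} - I" R])
    fix g h x y assume gh: "g \<in> carrier G" "h \<in> carrier G" "x \<in> {..<n} - I" "y \<in> {..<n} - I"
    have "(\<Sum>z\<in>I. R g x z * R h z y) = 0"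
      using gh by (intro sum.neutral) (auto simp: R0)
    then show "R (g \<otimes> h) x y = (\<Sum>z\<in>{..<n} - I. R g x z * R h z y)"
      using gh I by (subst Rmult) (auto simp: sumsplit)
  qed (use R1 in auto)
  have "mtr (\<rho> g) = mtr (\<alpha> g) + mtr (\<beta> g)" if "g \<in> carrier G" for g
  proof -
    have "mtr (\<rho> g) = mtr (T * \<rho> g * S)"
      using mtr_conj[OF D(1)[OF that] S T ST(1)] by simp
    also have "\<dots> = (\<Sum>i<n. R g i i)"
      using mtr_sum[OF TrS[OF that]] by (simp add: R_def)
    finally show ?thesis
      using \<alpha>(2)[OF that] \<beta>(2)[OF that] by (simp add: sumsplit)
  qed
  moreover have "card I < n" using I \<open>I \<noteq> {..<n}\<close> psubset_card_mono[of "{..<n}" I] by auto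
  moreover have "card ({..<n} - I) < n"
    using psubset_card_mono[of "{..<n}" "{..<n} - I"] I \<open>I \<noteq> {}\<close> by auto
  ultimately show thesis using that \<alpha>(1) \<beta>(1) by blast
qed

text \<open>Splitting repeatedly along invariant subspaces ends at composition factors, whose traces
  add up to the given one.\<close>

theorem rep_decompose:
  assumes G: "group G" and rep: "matrix_rep G n \<rho>"
  shows "\<exists>M. set_mset M \<subseteq> Irr G \<and> (\<forall>g\<in>carrier G. mtr (\<rho> g) = (\<Sum>\<phi>\<in>#M. \<phi> g))"
  using rep
proof (induction n arbitrary: \<rho> rule: less_induct)
  case (less n)
  show ?case
  proof (cases "n = 0")
    case True
    then have "mtr (\<rho> g) = 0" if "g \<in> carrier G" for g
      using matrix_repD(1)[OF less.prems G that] mtr_sum by fastforce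
    then show ?thesis by (intro exI[of _ "{#}"]) auto
  next
    case n: False
    show ?thesis
    proof (cases "irreducible_rep G n \<rho>")
      case True
      then show ?thesis
        by (intro exI[of _ "{#rep_character G \<rho>#}"]) (auto simp: Irr_def rep_character_mtr)
    next
      case False
      then obtain W where W: "VectorSpace.subspace class_ring W (module_vec TYPE(complex) n)"
        "\<And>g w. g \<in> carrier G \<Longrightarrow> w \<in> W \<Longrightarrow> \<rho> g *\<^sub>v w \<in> W" "W \<noteq> {0\<^sub>v n}" "W \<noteq> carrier_vec n"
        using n less.prems by (auto simp: irreducible_rep_def)
      obtain a b \<alpha> \<beta> where ab: "a < n" "b < n" "matrix_rep G a \<alpha>" "matrix_rep G b \<beta>"
        "\<And>g. g \<in> carrier G \<Longrightarrow> mtr (\<rho> g) = mtr (\<alpha> g) + mtr (\<beta> g)"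
        using matrix_rep_split[OF G less.prems W] by blast
      obtain M N where "set_mset M \<subseteq> Irr G" "\<forall>g\<in>carrier G. mtr (\<alpha> g) = (\<Sum>\<phi>\<in>#M. \<phi> g)"
        "set_mset N \<subseteq> Irr G" "\<forall>g\<in>carrier G. mtr (\<beta> g) = (\<Sum>\<phi>\<in>#N. \<phi> g)"
        using less.IH[OF ab(1,3)] less.IH[OF ab(2,4)] by blast
      then show ?thesis
        using ab(5) by (intro exI[of _ "M + N"]) auto
    qed
  qed
qed

section \<open>Schur orthogonality\<close>

definition cinner :: "('a, 'b) monoid_scheme \<Rightarrow> ('a \<Rightarrow> complex) \<Rightarrow> ('a \<Rightarrow> complex) \<Rightarrow> complex"
  where "cinner G f h = (\<Sum>g\<in>carrier G. f g * cnj (h g)) / of_nat (card (carrier G))"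

text \<open>Kernel and image of an intertwiner are invariant subspaces, so for a nonzero one
  irreducibility makes the kernel zero and the image everything.\<close>

lemma schur_iso:
  fixes T :: "complex mat"
  assumes G: "group G" and \<rho>: "irreducible_rep G n \<rho>" and \<sigma>: "irreducible_rep G m \<sigma>"
    and T: "T \<in> carrier_mat m n" and eq: "\<And>g. g \<in> carrier G \<Longrightarrow> T * \<rho> g = \<sigma> g * T"
    and nz: "T \<noteq> 0\<^sub>m m n"
  obtains R where "R \<in> carrier_mat n m" "T * R = 1\<^sub>m m" "R * T = 1\<^sub>m n"
proof -
  have r: "matrix_rep G n \<rho>" and s: "matrix_rep G m \<sigma>"
    using \<rho> \<sigma> by (auto simp: irreducible_rep_def)
  note D = matrix_repD[OF r G] and E = matrix_repD[OF s G]
  have Teq: "T *\<^sub>v (\<rho> g *\<^sub>v v) = \<sigma> g *\<^sub>v (T *\<^sub>v v)" if "g \<in> carrier G" "v \<in> carrier_vec n" for g v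
    using eq[OF that(1)] D(1)[OF that(1)] E(1)[OF that(1)] T that(2)
    by (metis assoc_mult_mat_vec)
  obtain i j where ij: "i < m" "j < n" "T $$ (i, j) \<noteq> 0"
    using nz T by (metis carrier_matD eq_matI index_zero_mat)
  have col: "(T *\<^sub>v unit_vec n j) $ i = T $$ (i, j)"
    using ij T by (subst mult_mat_vec_entry[OF T]) (auto simp: unit_vec_def if_distrib cong: if_cong)
  then have Tj: "T *\<^sub>v unit_vec n j \<noteq> 0\<^sub>v m"
    using ij by auto
  define K where "K = {v \<in> carrier_vec n. T *\<^sub>v v = 0\<^sub>v m}"
  have "VectorSpace.subspace class_ring K (module_vec TYPE(complex) n)"
    using T mult_mat_zero_vec[OF T] by (auto simp: subspace_iff K_def mult_add_distrib_mat_vec[of _ m n] mult_mat_vec[of _ m n])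
  moreover have "\<rho> g *\<^sub>v w \<in> K" if g: "g \<in> carrier G" and w: "w \<in> K" for g w
  proof -
    have w: "w \<in> carrier_vec n" "T *\<^sub>v w = 0\<^sub>v m" using w by (auto simp: K_def)
    then have "T *\<^sub>v (\<rho> g *\<^sub>v w) = 0\<^sub>v m"
      using Teq[OF g w(1)] mult_mat_zero_vec[OF E(1)[OF g]] by simp
    then show ?thesis
      using mult_mat_vec_carrier[OF D(1)[OF g] w(1)] by (simp add: K_def)
  qed
  ultimately have "K = {0\<^sub>v n} \<or> K = carrier_vec n"
    using \<rho> by (auto simp: irreducible_rep_def)
  moreover have "K \<noteq> carrier_vec n"
  proof
    assume "K = carrier_vec n"
    moreover have "unit_vec n j \<in> carrier_vec n" by simp
    ultimately have "unit_vec n j \<in> K" by blast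
    with Tj show False by (simp add: K_def)
  qed
  ultimately have K: "K = {0\<^sub>v n}" by simp
  define W where "W = (\<lambda>v. T *\<^sub>v v) ` carrier_vec n"
  have "VectorSpace.subspace class_ring W (module_vec TYPE(complex) m)"
    unfolding subspace_iff
  proof (intro conjI ballI allI)
    show "W \<subseteq> carrier_vec m" using T by (auto simp: W_def)
    show "0\<^sub>v m \<in> W" using mult_mat_zero_vec[OF T] by (auto simp: W_def intro!: image_eqI[of _ _ "0\<^sub>v n"])
    show "v + w \<in> W" if "v \<in> W" "w \<in> W" for v w
      using that T by (auto simp: W_def mult_add_distrib_mat_vec[of _ m n, symmetric])
    show "c \<cdot>\<^sub>v v \<in> W" if "v \<in> W" for c v
      using that T by (auto simp: W_def mult_mat_vec[of _ m n, symmetric])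
  qed
  moreover have "\<sigma> g *\<^sub>v w \<in> W" if "g \<in> carrier G" "w \<in> W" for g w
    using that D(1)[OF that(1)] by (auto simp: W_def Teq[symmetric])
  ultimately have "W = {0\<^sub>v m} \<or> W = carrier_vec m"
    using \<sigma> by (auto simp: irreducible_rep_def)
  moreover have "W \<noteq> {0\<^sub>v m}"
  proof
    assume "W = {0\<^sub>v m}"
    moreover have "T *\<^sub>v unit_vec n j \<in> W" unfolding W_def by (intro imageI) simp
    ultimately have "T *\<^sub>v unit_vec n j = 0\<^sub>v m" by blast
    with Tj show False by simp
  qed
  ultimately have W: "W = carrier_vec m" by simp
  have "\<forall>i<m. \<exists>v. v \<in> carrier_vec n \<and> T *\<^sub>v v = unit_vec m i"
  proof (intro allI impI)
    fix i assume "i < m"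
    have "unit_vec m i \<in> W" using W by simp
    then show "\<exists>v. v \<in> carrier_vec n \<and> T *\<^sub>v v = unit_vec m i" by (auto simp: W_def)
  qed
  then obtain f where f: "\<And>i. i < m \<Longrightarrow> f i \<in> carrier_vec n" "\<And>i. i < m \<Longrightarrow> T *\<^sub>v f i = unit_vec m i"
    by metis
  define R where "R = mat n m (\<lambda>(l, i). f i $ l)"
  have R: "R \<in> carrier_mat n m" by (simp add: R_def)
  have TR: "T * R = 1\<^sub>m m"
  proof (rule eq_matI)
    fix l i assume "l < dim_row (1\<^sub>m m)" "i < dim_col (1\<^sub>m m)"
    then have li: "l < m" "i < m" by auto
    have "(T * R) $$ (l, i) = (\<Sum>x<n. T $$ (l, x) * R $$ (x, i))"
      by (rule mult_mat_entry[OF T R li])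
    also have "\<dots> = (\<Sum>x<n. T $$ (l, x) * f i $ x)"
      using li by (auto simp: R_def intro!: sum.cong)
    also have "\<dots> = (T *\<^sub>v f i) $ l"
      using mult_mat_vec_entry[OF T f(1)[OF li(2)] li(1)] by simp
    finally show "(T * R) $$ (l, i) = 1\<^sub>m m $$ (l, i)"
      using li by (simp add: f(2))
  qed (use T R in auto)
  have "R * T = 1\<^sub>m n"
  proof (rule eq_matI)
    fix l i assume "l < dim_row (1\<^sub>m n)" "i < dim_col (1\<^sub>m n)"
    then have li: "l < n" "i < n" by auto
    define u :: "complex vec" where "u = unit_vec n i"
    have u: "u \<in> carrier_vec n" by (simp add: u_def)
    \<comment> \<open>A right inverse of an injective matrix is also a left inverse:
      \<open>T\<close> kills this difference, and its kernel \<open>K\<close> is zero.\<close>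
    have "T *\<^sub>v ((R * T) *\<^sub>v u - u) = T *\<^sub>v ((R * T) *\<^sub>v u) - T *\<^sub>v u"
      using T R u by (intro mult_minus_distrib_mat_vec[of _ m n]) auto
    also have "T *\<^sub>v ((R * T) *\<^sub>v u) = (T * R) *\<^sub>v (T *\<^sub>v u)"
      using T R u by (metis assoc_mult_mat_vec mult_mat_vec_carrier)
    also have "\<dots> = T *\<^sub>v u" using T u by (simp add: TR)
    also have "T *\<^sub>v u - T *\<^sub>v u = 0\<^sub>v m" using T u by simp
    finally have "(R * T) *\<^sub>v u - u \<in> K"
      using T R u by (auto simp: K_def)
    then have "(R * T) *\<^sub>v u - u = 0\<^sub>v n" using K by simp
    then have "((R * T) *\<^sub>v u - u) $ l = 0" using li by simp
    then have "((R * T) *\<^sub>v u) $ l = u $ l" using li u T R by simp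
    moreover have "((R * T) *\<^sub>v u) $ l = (R * T) $$ (l, i)"
      unfolding u_def using li T R
      by (subst mult_mat_vec_entry[of _ n n]) (auto simp: unit_vec_def if_distrib simp del: index_mult_mat(1) cong: if_cong)
    ultimately show "(R * T) $$ (l, i) = 1\<^sub>m n $$ (l, i)"
      using li by (simp add: u_def del: index_mult_mat(1))
  qed (use T R in auto)
  with R TR show thesis by (rule that)
qed

text \<open>Subtracting an eigenvalue leaves an intertwiner with nonzero kernel, which
  \<open>schur_iso\<close> forces to vanish.\<close>

lemma schur_scalar:
  fixes T :: "complex mat"
  assumes G: "group G" and \<rho>: "irreducible_rep G n \<rho>"
    and T: "T \<in> carrier_mat n n" and eq: "\<And>g. g \<in> carrier G \<Longrightarrow> T * \<rho> g = \<rho> g * T"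
  obtains c where "T = c \<cdot>\<^sub>m 1\<^sub>m n"
proof -
  have r: "matrix_rep G n \<rho>" and n: "n > 0" using \<rho> by (auto simp: irreducible_rep_def)
  note D = matrix_repD[OF r G]
  obtain c where "eigenvalue T c"
    using spectrum_non_empty[OF T n] by (auto simp: spectrum_def)
  then obtain v where v: "v \<in> carrier_vec n" "v \<noteq> 0\<^sub>v n" "T *\<^sub>v v = c \<cdot>\<^sub>v v"
    using T by (auto simp: eigenvalue_def eigenvector_def)
  define U where "U = T - c \<cdot>\<^sub>m 1\<^sub>m n"
  have U: "U \<in> carrier_mat n n" using T unfolding U_def by (intro minus_carrier_mat) auto
  have comm: "U * \<rho> g = \<rho> g * U" if "g \<in> carrier G" for g
    unfolding U_def using T D(1)[OF that] eq[OF that]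
    by (subst minus_mult_distrib_mat[of _ n n], simp, simp, simp)
       (subst mult_minus_distrib_mat[of _ n n], auto simp: mult_smult_distrib[of _ n n] mult_smult_assoc_mat[of _ n n])
  have "U = 0\<^sub>m n n"
  proof (rule ccontr)
    assume "U \<noteq> 0\<^sub>m n n"
    then obtain R where R: "R \<in> carrier_mat n n" "R * U = 1\<^sub>m n"
      using schur_iso[OF G \<rho> \<rho> U comm] by metis
    have "U *\<^sub>v v = T *\<^sub>v v - (c \<cdot>\<^sub>m 1\<^sub>m n) *\<^sub>v v"
      unfolding U_def using T v by (intro minus_mult_distrib_mat_vec[of _ n n]) auto
    also have "(c \<cdot>\<^sub>m 1\<^sub>m n) *\<^sub>v v = c \<cdot>\<^sub>v v"
      using v by (intro eq_vecI) (auto simp: mult_mat_vec_entry[of _ n n] if_distrib[of "\<lambda>x. x * _"] cong: if_cong)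
    finally have "U *\<^sub>v v = 0\<^sub>v n" using v by simp
    then have "R *\<^sub>v (U *\<^sub>v v) = 0\<^sub>v n" using mult_mat_zero_vec[OF R(1)] by simp
    moreover have "R *\<^sub>v (U *\<^sub>v v) = v"
      using R U v by (metis assoc_mult_mat_vec one_mult_mat_vec)
    ultimately show False using v by simp
  qed
  then have "T $$ (i, j) - (c \<cdot>\<^sub>m 1\<^sub>m n) $$ (i, j) = 0" if "i < n" "j < n" for i j
    using that T by (metis U_def index_minus_mat(1) index_one_mat(2,3) index_smult_mat(2,3) index_zero_mat(1))
  then have "T = c \<cdot>\<^sub>m 1\<^sub>m n"
    using T by (intro eq_matI) auto
  then show thesis by (rule that)
qed

lemma (in group) sum_translate:
  assumes "h \<in> carrier G"
  shows "(\<Sum>g\<in>carrier G. f (h \<otimes> g)) = (\<Sum>g\<in>carrier G. f g)"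
proof (rule sum.reindex_bij_witness[of _ "\<lambda>g. inv h \<otimes> g" "\<lambda>g. h \<otimes> g"])
qed (use assms in \<open>auto simp: m_assoc[symmetric]\<close>)

text \<open>\<open>T\<close> is the sum over \<open>g\<close> of \<sigma>(g) E \<rho>(g)^-1, where E
  is the matrix unit at position (b, c), written out in entries. Substituting
  \<open>h \<otimes> g\<close> for \<open>g\<close> gives the intertwining relation.\<close>

lemma average_intertwines:
  fixes G (structure) and T :: "complex mat"
  assumes G: "group G" and fin: "finite (carrier G)"
    and \<rho>: "matrix_rep G n \<rho>" and \<sigma>: "matrix_rep G m \<sigma>"
    and b: "b < m" and c: "c < n"
    and T: "T = mat m n (\<lambda>(a, d). \<Sum>g\<in>carrier G. \<sigma> g $$ (a, b) * \<rho> (inv\<^bsub>G\<^esub> g) $$ (c, d))"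
    and h: "h \<in> carrier G"
  shows "T * \<rho> h = \<sigma> h * T"
proof -
  interpret group G by fact
  note D = matrix_repD[OF \<rho> G] and E = matrix_repD[OF \<sigma> G]
  have Tc: "T \<in> carrier_mat m n" by (simp add: T)
  have rmul: "\<rho> (g \<otimes> h) $$ (i, j) = (\<Sum>x<n. \<rho> g $$ (i, x) * \<rho> h $$ (x, j))"
    if "g \<in> carrier G" "h \<in> carrier G" "i < n" "j < n" for g h i j
    using that by (simp add: D(2) mult_mat_entry[OF D(1) D(1)] del: index_mult_mat(1))
  have smul: "\<sigma> (g \<otimes> h) $$ (i, j) = (\<Sum>x<m. \<sigma> g $$ (i, x) * \<sigma> h $$ (x, j))"
    if "g \<in> carrier G" "h \<in> carrier G" "i < m" "j < m" for g h i j
    using that by (simp add: E(2) mult_mat_entry[OF E(1) E(1)] del: index_mult_mat(1))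
  show ?thesis
  proof (rule eq_matI)
    fix a e assume "a < dim_row (\<sigma> h * T)" "e < dim_col (\<sigma> h * T)"
    then have ae: "a < m" "e < n" using E(1)[OF h] Tc by auto
    have "(T * \<rho> h) $$ (a, e) = (\<Sum>x<n. T $$ (a, x) * \<rho> h $$ (x, e))"
      by (rule mult_mat_entry[OF Tc D(1)[OF h] ae])
    also have "\<dots> = (\<Sum>x<n. \<Sum>g\<in>carrier G. \<sigma> g $$ (a, b) * \<rho> (inv g) $$ (c, x) * \<rho> h $$ (x, e))"
      using ae by (auto simp: T sum_distrib_right intro!: sum.cong)
    also have "\<dots> = (\<Sum>g\<in>carrier G. \<sigma> g $$ (a, b) * \<rho> (inv g \<otimes> h) $$ (c, e))"
      using ae c h by (subst sum.swap) (auto simp: rmul sum_distrib_left mult.assoc intro!: sum.cong)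
    also have "\<dots> = (\<Sum>g\<in>carrier G. \<sigma> (h \<otimes> g) $$ (a, b) * \<rho> (inv (h \<otimes> g) \<otimes> h) $$ (c, e))"
      by (rule sum_translate[OF h, symmetric])
    also have "\<dots> = (\<Sum>g\<in>carrier G. \<sigma> (h \<otimes> g) $$ (a, b) * \<rho> (inv g) $$ (c, e))"
      using h by (intro sum.cong) (auto simp: inv_mult_group m_assoc)
    also have "\<dots> = (\<Sum>x<m. \<Sum>g\<in>carrier G. \<sigma> h $$ (a, x) * (\<sigma> g $$ (x, b) * \<rho> (inv g) $$ (c, e)))"
      using ae b h by (subst sum.swap) (auto simp: smul sum_distrib_right mult.assoc intro!: sum.cong)
    also have "\<dots> = (\<Sum>x<m. \<sigma> h $$ (a, x) * T $$ (x, e))"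
      using ae by (auto simp: T sum_distrib_left intro!: sum.cong)
    also have "\<dots> = (\<sigma> h * T) $$ (a, e)"
      by (rule mult_mat_entry[OF E(1)[OF h] Tc ae, symmetric])
    finally show "(T * \<rho> h) $$ (a, e) = (\<sigma> h * T) $$ (a, e)" .
  qed (use Tc D(1)[OF h] E(1)[OF h] in auto)
qed

text \<open>An invertible intertwiner would make the characters equal, so every averaged matrix unit
  vanishes. Its entry at (b, c) is one term of the expanded product of traces.\<close>

lemma orthogonality_distinct:
  fixes G (structure)
  assumes G: "group G" and fin: "finite (carrier G)"
    and \<rho>: "irreducible_rep G n \<rho>" and \<sigma>: "irreducible_rep G m \<sigma>"
    and ne: "rep_character G \<rho> \<noteq> rep_character G \<sigma>"
  shows "(\<Sum>g\<in>carrier G. mtr (\<sigma> g) * mtr (\<rho> (inv\<^bsub>G\<^esub> g))) = 0"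
proof -
  interpret group G by fact
  have r: "matrix_rep G n \<rho>" and s: "matrix_rep G m \<sigma>"
    using \<rho> \<sigma> by (auto simp: irreducible_rep_def)
  note D = matrix_repD[OF r G] and E = matrix_repD[OF s G]
  have zero: "(\<Sum>g\<in>carrier G. \<sigma> g $$ (b, b) * \<rho> (inv g) $$ (c, c)) = 0" if bc: "b < m" "c < n" for b c
  proof -
    define T where "T = mat m n (\<lambda>(a, d). \<Sum>g\<in>carrier G. \<sigma> g $$ (a, b) * \<rho> (inv\<^bsub>G\<^esub> g) $$ (c, d))"
    have T: "T \<in> carrier_mat m n" by (simp add: T_def)
    have eq: "T * \<rho> g = \<sigma> g * T" if "g \<in> carrier G" for g
      by (rule average_intertwines[OF G fin r s bc T_def that])
    have "T = 0\<^sub>m m n"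
    proof (rule ccontr)
      assume nz: "T \<noteq> 0\<^sub>m m n"
      obtain R where R: "R \<in> carrier_mat n m" "T * R = 1\<^sub>m m" "R * T = 1\<^sub>m n"
        using schur_iso[OF G \<rho> \<sigma> T eq nz] by metis
      have "mtr (\<rho> g) = mtr (\<sigma> g)" if g: "g \<in> carrier G" for g
      proof -
        have "mtr (\<rho> g) = mtr ((R * T) * \<rho> g)" using D(1)[OF g] R by simp
        also have "(R * T) * \<rho> g = R * (\<sigma> g * T)"
          using assoc_mult_mat[OF R(1) T D(1)[OF g]] eq[OF g] by simp
        also have "mtr (R * (\<sigma> g * T)) = mtr (\<sigma> g * T * R)"
          using R T E(1)[OF g] by (intro mtr_comm) auto
        also have "\<sigma> g * T * R = \<sigma> g"
          using R T E(1)[OF g] by (simp add: assoc_mult_mat[of _ m m _ n _ m])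
        finally show ?thesis .
      qed
      then have "rep_character G \<rho> = rep_character G \<sigma>"
        by (auto simp: rep_character_def mtr_def intro!: restrict_ext)
      with ne show False by simp
    qed
    then have "T $$ (b, c) = 0" using bc by simp
    then show ?thesis using bc by (simp add: T_def)
  qed
  have "(\<Sum>g\<in>carrier G. mtr (\<sigma> g) * mtr (\<rho> (inv g))) =
      (\<Sum>g\<in>carrier G. \<Sum>b<m. \<Sum>c<n. \<sigma> g $$ (b, b) * \<rho> (inv g) $$ (c, c))"
    by (intro sum.cong refl) (simp add: mtr_sum[OF E(1)] mtr_sum[OF D(1)] sum_product)
  also have "\<dots> = (\<Sum>b<m. \<Sum>c<n. \<Sum>g\<in>carrier G. \<sigma> g $$ (b, b) * \<rho> (inv g) $$ (c, c))"
    by (subst sum.swap, subst (2) sum.swap) (rule refl)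
  also have "\<dots> = 0" by (simp add: zero)
  finally show ?thesis .
qed

lemma orthogonality_same:
  fixes G (structure)
  assumes G: "group G" and fin: "finite (carrier G)" and \<rho>: "irreducible_rep G n \<rho>"
  shows "(\<Sum>g\<in>carrier G. mtr (\<rho> g) * mtr (\<rho> (inv\<^bsub>G\<^esub> g))) = of_nat (card (carrier G))"
proof -
  interpret group G by fact
  have r: "matrix_rep G n \<rho>" and n: "n > 0" using \<rho> by (auto simp: irreducible_rep_def)
  note D = matrix_repD[OF r G]
  have val: "(\<Sum>g\<in>carrier G. \<rho> g $$ (b, b) * \<rho> (inv g) $$ (c, c)) =
      (if b = c then of_nat (card (carrier G)) / of_nat n else 0)" if bc: "b < n" "c < n" for b c
  proof -
    define T where "T = mat n n (\<lambda>(a, d). \<Sum>g\<in>carrier G. \<rho> g $$ (a, b) * \<rho> (inv\<^bsub>G\<^esub> g) $$ (c, d))"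
    have T: "T \<in> carrier_mat n n" by (simp add: T_def)
    obtain k where k: "T = k \<cdot>\<^sub>m 1\<^sub>m n"
      using schur_scalar[OF G \<rho> T average_intertwines[OF G fin r r bc T_def]] by metis
    \<comment> \<open>The trace identifies the scalar \<open>k\<close>, because \<rho>(g^-1)
      \<rho>(g) is the identity in every summand.\<close>
    have "of_nat n * k = (\<Sum>a<n. T $$ (a, a))"
      by (simp add: k)
    also have "\<dots> = (\<Sum>a<n. \<Sum>g\<in>carrier G. \<rho> (inv g) $$ (c, a) * \<rho> g $$ (a, b))"
      by (auto simp: T_def mult.commute intro!: sum.cong)
    also have "\<dots> = (\<Sum>g\<in>carrier G. (\<rho> (inv g) * \<rho> g) $$ (c, b))"
      using bc by (subst sum.swap) (auto simp: mult_mat_entry[OF D(1) D(1)] simp del: index_mult_mat(1) intro!: sum.cong)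
    also have "\<dots> = (\<Sum>g\<in>carrier G. if b = c then 1 else 0)"
      using bc by (intro sum.cong) (auto simp: D(2)[symmetric] D(3))
    also have "\<dots> = (if b = c then of_nat (card (carrier G)) else 0)" by simp
    finally have "k = (if b = c then of_nat (card (carrier G)) / of_nat n else 0)"
      using n by (auto simp: field_simps split: if_splits)
    moreover have "T $$ (b, c) = (if b = c then k else 0)"
      using bc by (simp add: k)
    ultimately show ?thesis using bc by (simp add: T_def)
  qed
  have "(\<Sum>g\<in>carrier G. mtr (\<rho> g) * mtr (\<rho> (inv g))) =
      (\<Sum>g\<in>carrier G. \<Sum>b<n. \<Sum>c<n. \<rho> g $$ (b, b) * \<rho> (inv g) $$ (c, c))"
    by (intro sum.cong refl) (simp add: mtr_sum[OF D(1)] sum_product)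
  also have "\<dots> = (\<Sum>b<n. \<Sum>c<n. \<Sum>g\<in>carrier G. \<rho> g $$ (b, b) * \<rho> (inv g) $$ (c, c))"
    by (subst sum.swap, subst (2) sum.swap) (rule refl)
  also have "\<dots> = (\<Sum>b<n. \<Sum>c<n. if b = c then of_nat (card (carrier G)) / of_nat n else 0)"
    by (simp add: val)
  also have "\<dots> = of_nat (card (carrier G))"
    using n by simp
  finally show ?thesis .
qed

section \<open>Eigenvalues\<close>

lemma upper_triangular_mult_diag:
  fixes A B :: "complex mat"
  assumes A: "A \<in> carrier_mat n n" "upper_triangular A" and B: "B \<in> carrier_mat n n" "upper_triangular B"
  shows "upper_triangular (A * B)" "i < n \<Longrightarrow> (A * B) $$ (i, i) = A $$ (i, i) * B $$ (i, i)"
proof -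
  have ent: "(A * B) $$ (i, j) = (\<Sum>x\<in>{i..j}. A $$ (i, x) * B $$ (x, j))" if "i < n" "j < n" for i j
  proof -
    have "(A * B) $$ (i, j) = (\<Sum>x<n. A $$ (i, x) * B $$ (x, j))"
      by (rule mult_mat_entry[OF A(1) B(1) that])
    also have "\<dots> = (\<Sum>x\<in>{i..j}. A $$ (i, x) * B $$ (x, j))"
      using that A B by (intro sum.mono_neutral_right) (auto simp: not_le upper_triangular_def)
    finally show ?thesis .
  qed
  show "upper_triangular (A * B)"
  proof
    fix i j assume "j < i" "i < dim_row (A * B)"
    then show "(A * B) $$ (i, j) = 0" using A by (subst ent) auto
  qed
  show "i < n \<Longrightarrow> (A * B) $$ (i, i) = A $$ (i, i) * B $$ (i, i)"
    by (simp add: ent del: index_mult_mat(1))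
qed

text \<open>One Schur triangularization serves all powers: its diagonal is the list of eigenvalues,
  and the powers of a triangular matrix have the powers of these on the diagonal.\<close>

lemma trace_powers:
  fixes A :: "complex mat"
  assumes A: "A \<in> carrier_mat n n"
  obtains es where "length es = n" "\<And>m. mtr (A ^\<^sub>m m) = (\<Sum>e\<leftarrow>es. e ^ m)"
    "\<And>N. A ^\<^sub>m N = 1\<^sub>m n \<Longrightarrow> \<forall>e\<in>set es. e ^ N = 1"
proof -
  obtain es where es: "char_poly A = (\<Prod>a\<leftarrow>es. [:- a, 1:])" "length es = n"
    using char_poly_factorized[OF A] by auto
  obtain B P Q where BPQ: "schur_decomposition A es = (B, P, Q)"
    by (cases "schur_decomposition A es") auto
  from schur_decomposition[OF A es(1) BPQ]
  have sim: "similar_mat_wit A B P Q" and ut: "upper_triangular B" and diag: "diag_mat B = es" by auto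
  from similar_mat_witD2[OF A sim]
  have PQ: "P * Q = 1\<^sub>m n" "Q * P = 1\<^sub>m n" "A = P * B * Q"
    and B: "B \<in> carrier_mat n n" and P: "P \<in> carrier_mat n n" and Q: "Q \<in> carrier_mat n n" by auto
  have Bm: "upper_triangular (B ^\<^sub>m m) \<and> (\<forall>i<n. (B ^\<^sub>m m) $$ (i, i) = B $$ (i, i) ^ m)" for m
  proof (induction m)
    case 0
    then show ?case using B by auto
  next
    case (Suc m)
    then show ?case
      using upper_triangular_mult_diag[of "B ^\<^sub>m m" n B] B ut by (auto simp: mult.commute)
  qed
  have sm: "similar_mat_wit (A ^\<^sub>m m) (B ^\<^sub>m m) P Q" for m
    by (rule similar_mat_wit_pow[OF sim])
  have tr: "mtr (A ^\<^sub>m m) = (\<Sum>e\<leftarrow>es. e ^ m)" for m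
  proof -
    have Bmc: "B ^\<^sub>m m \<in> carrier_mat n n" using B by simp
    have "A ^\<^sub>m m = P * B ^\<^sub>m m * Q"
      using sm[of m] by (auto simp: similar_mat_wit_def Let_def)
    then have "mtr (A ^\<^sub>m m) = mtr (B ^\<^sub>m m)"
      using mtr_conj[OF Bmc Q P PQ(2)] by simp
    also have "\<dots> = (\<Sum>i<n. B $$ (i, i) ^ m)"
      using Bm[of m] by (simp add: mtr_sum[OF Bmc])
    also have "\<dots> = (\<Sum>e\<leftarrow>es. e ^ m)"
      using B by (simp add: diag[symmetric] diag_mat_def comp_def interv_sum_list_conv_sum_set_nat atLeast0LessThan)
    finally show ?thesis .
  qed
  have "e ^ N = 1" if N: "A ^\<^sub>m N = 1\<^sub>m n" and e: "e \<in> set es" for N e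
  proof -
    have "similar_mat_wit (B ^\<^sub>m N) (A ^\<^sub>m N) Q P"
      by (rule similar_mat_wit_sym[OF sm])
    then have "B ^\<^sub>m N = Q * A ^\<^sub>m N * P"
      by (auto simp: similar_mat_wit_def Let_def)
    then have "B ^\<^sub>m N = 1\<^sub>m n" using N PQ P Q by simp
    moreover obtain i where "i < n" "e = B $$ (i, i)"
      using e B by (auto simp: diag[symmetric] diag_mat_def)
    ultimately show ?thesis using Bm[of N] by (metis index_one_mat(1))
  qed
  then show thesis using that[of es] es(2) tr by blast
qed

lemma matrix_rep_pow:
  assumes "matrix_rep G n \<rho>" "group G" "g \<in> carrier G"
  shows "\<rho> (g [^]\<^bsub>G\<^esub> (m::nat)) = \<rho> g ^\<^sub>m m"
proof -
  interpret group G by fact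
  note D = matrix_repD[OF assms(1,2)]
  show ?thesis
  proof (induction m)
    case 0
    then show ?case using D(1)[OF assms(3)] D(3) by auto
  next
    case (Suc m)
    then show ?case using assms(3) by (simp add: D(2))
  qed
qed

lemma rep_eigenvalues:
  assumes "matrix_rep G n \<rho>" "group G" "finite (carrier G)" "g \<in> carrier G"
  obtains es where "length es = n" "\<And>m::nat. mtr (\<rho> (g [^]\<^bsub>G\<^esub> m)) = (\<Sum>e\<leftarrow>es. e ^ m)"
    "\<And>N::nat. g [^]\<^bsub>G\<^esub> N = \<one>\<^bsub>G\<^esub> \<Longrightarrow> \<forall>e\<in>set es. e ^ N = 1"
proof -
  note D = matrix_repD[OF assms(1,2)]
  obtain es where es: "length es = n" "\<And>m. mtr (\<rho> g ^\<^sub>m m) = (\<Sum>e\<leftarrow>es. e ^ m)"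
    "\<And>N. \<rho> g ^\<^sub>m N = 1\<^sub>m n \<Longrightarrow> \<forall>e\<in>set es. e ^ N = 1"
    using trace_powers[OF D(1)[OF assms(4)]] by blast
  show thesis
  proof (rule that[of es])
    show "mtr (\<rho> (g [^]\<^bsub>G\<^esub> m)) = (\<Sum>e\<leftarrow>es. e ^ m)" for m :: nat
      using es(2) matrix_rep_pow[OF assms(1,2,4)] by simp
    show "\<forall>e\<in>set es. e ^ N = 1" if "g [^]\<^bsub>G\<^esub> N = \<one>\<^bsub>G\<^esub>" for N :: nat
    proof (rule es(3))
      show "\<rho> g ^\<^sub>m N = 1\<^sub>m n"
        using that D(3) matrix_rep_pow[OF assms(1,2,4), of N] by simp
    qed
  qed (rule es(1))
qed

text \<open>The eigenvalues are roots of unity, for which inverse and conjugate agree. The inverse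
  of \<open>g\<close> is written as the power \<open>N - 1\<close> since
  \<open>rep_eigenvalues\<close> covers natural exponents.\<close>

lemma mtr_inv:
  fixes G (structure)
  assumes "matrix_rep G n \<rho>" "group G" "finite (carrier G)" "g \<in> carrier G"
  shows "mtr (\<rho> (inv\<^bsub>G\<^esub> g)) = cnj (mtr (\<rho> g))"
proof -
  interpret group G by fact
  obtain es where es: "\<And>m::nat. mtr (\<rho> (g [^] m)) = (\<Sum>e\<leftarrow>es. e ^ m)"
    "\<And>N::nat. g [^] N = \<one> \<Longrightarrow> \<forall>e\<in>set es. e ^ N = 1"
    by (rule rep_eigenvalues[OF assms]) (rule that)
  define N where "N = Coset.order G"
  have N: "N > 0" using assms(3) by (simp add: N_def order_gt_0_iff_finite)
  have gN: "g [^] N = \<one>" using assms(4) by (simp add: N_def pow_order_eq_1)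
  have "inv g = g [^] (N - 1)"
  proof (rule inv_equality)
    have "g [^] (N - 1) \<otimes> g = g [^] (Suc (N - 1))" by simp
    then show "g [^] (N - 1) \<otimes> g = \<one>" using gN N by simp
  qed (use assms(4) in auto)
  then have "mtr (\<rho> (inv g)) = (\<Sum>e\<leftarrow>es. e ^ (N - 1))" by (simp add: es(1))
  also have "\<dots> = (\<Sum>e\<leftarrow>es. cnj e)"
  proof (intro arg_cong[where f = sum_list] map_cong refl)
    fix e assume "e \<in> set es"
    then have eN: "e ^ N = 1" using es(2) gN by blast
    then have "norm e ^ N = 1" by (simp flip: norm_power)
    then have "norm e = 1" using N power_eq_1_iff[of "norm e" N] by simp
    then have 1: "e * cnj e = 1" by (simp flip: complex_norm_square)
    have "e ^ (N - 1) * e = e ^ Suc (N - 1)" by simp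
    then have 2: "e ^ (N - 1) * e = 1" using eN N by simp
    have "e ^ (N - 1) = e ^ (N - 1) * (e * cnj e)" unfolding 1 by simp
    also have "\<dots> = (e ^ (N - 1) * e) * cnj e" by (simp only: mult.assoc)
    finally show "e ^ (N - 1) = cnj e" unfolding 2 by simp
  qed
  also have "\<dots> = cnj (\<Sum>e\<leftarrow>es. e ^ 1)"
    by (induction es) auto
  also have "\<dots> = cnj (mtr (\<rho> g))"
    using es(1)[of 1] assms(4) by simp
  finally show ?thesis .
qed

theorem Irr_orthonormal:
  fixes G (structure)
  assumes G: "group G" and fin: "finite (carrier G)" and "\<chi> \<in> Irr G" "\<psi> \<in> Irr G"
  shows "cinner G \<chi> \<psi> = (if \<chi> = \<psi> then 1 else 0)"
proof -
  interpret group G by fact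
  have cpos: "card (carrier G) > 0" using fin by (auto simp: card_gt_0_iff)
  obtain n m \<rho> \<sigma> where 1: "irreducible_rep G n \<rho>" "\<chi> = rep_character G \<rho>"
    "irreducible_rep G m \<sigma>" "\<psi> = rep_character G \<sigma>"
    using assms by (auto simp: Irr_def)
  have eq: "cinner G \<chi> \<psi> = (\<Sum>g\<in>carrier G. mtr (\<rho> g) * mtr (\<sigma> (inv g))) / of_nat (card (carrier G))"
    using 1 mtr_inv[OF _ G fin, of m \<sigma>]
    by (auto simp: cinner_def rep_character_mtr irreducible_rep_def intro!: sum.cong arg_cong2[where f = "(/)"])
  show ?thesis
  proof (cases "\<chi> = \<psi>")
    case True
    have "cinner G \<chi> \<chi> = (\<Sum>g\<in>carrier G. mtr (\<rho> g) * mtr (\<rho> (inv g))) / of_nat (card (carrier G))"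
      using 1 mtr_inv[OF _ G fin, of n \<rho>]
      by (auto simp: cinner_def rep_character_mtr irreducible_rep_def intro!: sum.cong arg_cong2[where f = "(/)"])
    then show ?thesis
      using True cpos by (simp add: orthogonality_same[OF G fin 1(1)])
  next
    case False
    then show ?thesis
      unfolding eq using orthogonality_distinct[OF G fin 1(3,1)] 1 by simp
  qed
qed

section \<open>Sesquilinearity of the inner product\<close>

lemma cinner_sum_left:
  "cinner G (\<lambda>g. \<Sum>i\<in>I. c i * f i g) h = (\<Sum>i\<in>I. c i * cinner G (f i) h)"
proof -
  have "(\<Sum>g\<in>carrier G. (\<Sum>i\<in>I. c i * f i g) * cnj (h g)) = (\<Sum>i\<in>I. c i * (\<Sum>g\<in>carrier G. f i g * cnj (h g)))"
    by (simp add: sum_distrib_right sum_distrib_left mult.assoc) (rule sum.swap)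
  then have "cinner G (\<lambda>g. \<Sum>i\<in>I. c i * f i g) h =
      (\<Sum>i\<in>I. c i * (\<Sum>g\<in>carrier G. f i g * cnj (h g))) / of_nat (card (carrier G))"
    by (simp add: cinner_def)
  also have "\<dots> = (\<Sum>i\<in>I. c i * cinner G (f i) h)"
    by (subst sum_divide_distrib) (simp add: cinner_def)
  finally show ?thesis .
qed

lemma cinner_commute: "cinner G f h = cnj (cinner G h f)"
  by (simp add: cinner_def mult.commute)

lemma cinner_sum_right:
  "cinner G h (\<lambda>g. \<Sum>i\<in>I. c i * f i g) = (\<Sum>i\<in>I. cnj (c i) * cinner G h (f i))"
  by (subst cinner_commute, subst cinner_sum_left) (simp add: cinner_commute[of G h])

lemma cinner_diff_left: "cinner G (\<lambda>g. f g - f' g) h = cinner G f h - cinner G f' h"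
  by (simp add: cinner_def left_diff_distrib sum_subtractf diff_divide_distrib)

lemma cinner_diff_right: "cinner G h (\<lambda>g. f g - f' g) = cinner G h f - cinner G h f'"
  by (subst (1 2 3) cinner_commute) (simp add: cinner_diff_left)

lemma cinner_cong:
  "(\<And>g. g \<in> carrier G \<Longrightarrow> f g = f' g) \<Longrightarrow> (\<And>g. g \<in> carrier G \<Longrightarrow> h g = h' g) \<Longrightarrow> cinner G f h = cinner G f' h'"
  by (simp add: cinner_def)

lemma cinner_self: "cinner G f f = of_real ((\<Sum>g\<in>carrier G. (norm (f g))\<^sup>2) / card (carrier G))"
  by (simp add: cinner_def complex_norm_square del: of_real_power)

lemma cinner_expansion:
  assumes G: "group G" "finite (carrier G)" and S: "finite S" "S \<subseteq> Irr G"
  shows "cinner G (\<lambda>g. \<Sum>\<phi>\<in>S. c \<phi> * \<phi> g) (\<lambda>g. \<Sum>\<phi>\<in>S. d \<phi> * \<phi> g) = (\<Sum>\<phi>\<in>S. c \<phi> * cnj (d \<phi>))"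
proof -
  have orth: "cinner G \<phi> \<psi> = (if \<phi> = \<psi> then 1 else 0)" if "\<phi> \<in> S" "\<psi> \<in> S" for \<phi> \<psi>
    using that S by (intro Irr_orthonormal[OF G]) auto
  have "cinner G (\<lambda>g. \<Sum>\<phi>\<in>S. c \<phi> * \<phi> g) (\<lambda>g. \<Sum>\<phi>\<in>S. d \<phi> * \<phi> g)
      = (\<Sum>\<phi>\<in>S. c \<phi> * (\<Sum>\<psi>\<in>S. cnj (d \<psi>) * cinner G \<phi> \<psi>))"
    by (simp add: cinner_sum_left cinner_sum_right)
  also have "\<dots> = (\<Sum>\<phi>\<in>S. c \<phi> * (\<Sum>\<psi>\<in>S. if \<phi> = \<psi> then cnj (d \<psi>) else 0))"
    by (intro sum.cong refl arg_cong2[where f = "(*)"]) (simp add: orth)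
  also have "\<dots> = (\<Sum>\<phi>\<in>S. c \<phi> * cnj (d \<phi>))"
    using S by simp
  finally show ?thesis .
qed

lemma sum_mset_count:
  assumes "finite S" "set_mset M \<subseteq> S"
  shows "(\<Sum>\<phi>\<in>#M. F \<phi>) = (\<Sum>\<phi>\<in>S. of_nat (count M \<phi>) * (F \<phi> :: complex))"
  using assms(2)
proof (induction M)
  case (add x M)
  have "(\<Sum>\<phi>\<in>S. of_nat (count (add_mset x M) \<phi>) * F \<phi>)
      = (\<Sum>\<phi>\<in>S. of_nat (count M \<phi>) * F \<phi> + (if x = \<phi> then F \<phi> else 0))"
    by (intro sum.cong) (auto simp: distrib_right)
  also have "\<dots> = (\<Sum>\<phi>\<in>S. of_nat (count M \<phi>) * F \<phi>) + F x"
    using add.prems assms(1) by (simp add: sum.distrib)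
  finally show ?case
    using add by (simp add: add.commute)
qed simp

section \<open>Irreducible characters as class functions, virtual characters and Bessel's
  inequality\<close>

lemma Irr_degree_pos:
  assumes "group G" "\<phi> \<in> Irr G"
  shows "\<exists>n::nat. n > 0 \<and> \<phi> \<one>\<^bsub>G\<^esub> = of_nat n"
proof -
  interpret group G by fact
  obtain n \<rho> where r: "irreducible_rep G n \<rho>" "\<phi> = rep_character G \<rho>"
    using assms by (auto simp: Irr_def)
  then have rep: "matrix_rep G n \<rho>" "n > 0" by (auto simp: irreducible_rep_def)
  have "\<phi> \<one>\<^bsub>G\<^esub> = mtr (1\<^sub>m n)"
    using r rep matrix_repD(3)[OF rep(1) assms(1)] by (simp add: rep_character_mtr)
  also have "\<dots> = of_nat n" by (subst mtr_sum[of _ n]) auto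
  finally show ?thesis using rep by blast
qed

lemma Irr_conj:
  fixes G (structure)
  assumes G: "group G" and \<phi>: "\<phi> \<in> Irr G" and gh: "g \<in> carrier G" "h \<in> carrier G"
  shows "\<phi> (h \<otimes> g \<otimes> inv h) = \<phi> g"
proof -
  interpret group G by fact
  obtain n \<rho> where r: "irreducible_rep G n \<rho>" "\<phi> = rep_character G \<rho>"
    using assms by (auto simp: Irr_def)
  then have rep: "matrix_rep G n \<rho>" by (auto simp: irreducible_rep_def)
  note D = matrix_repD[OF rep G]
  have "mtr (\<rho> (h \<otimes> g \<otimes> inv h)) = mtr (\<rho> h * \<rho> g * \<rho> (inv h))"
    using gh by (simp add: D(2))
  also have "\<dots> = mtr (\<rho> g)"
    using gh by (intro mtr_conj[OF D(1) D(1) D(1)]) (auto simp: D(2)[symmetric] D(3))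
  finally show ?thesis
    using gh r by (simp add: rep_character_mtr)
qed

lemma Irr_undefined: "\<phi> \<in> Irr G \<Longrightarrow> g \<notin> carrier G \<Longrightarrow> \<phi> g = undefined"
  by (auto simp: Irr_def rep_character_def)

text \<open>By orthonormality the norm is a sum of squares of integers, so a single coefficient is 1
  or -1 and the others are 0; the value at the identity decides the sign. The condition
  \<open>ext\<close> turns agreement on the group into equality of functions.\<close>

theorem virtual_character_irreducible:
  assumes G: "group G" "finite (carrier G)"
    and M: "set_mset M \<subseteq> Irr G" "set_mset M' \<subseteq> Irr G"
    and f: "\<And>g. g \<in> carrier G \<Longrightarrow> f g = (\<Sum>\<phi>\<in>#M. \<phi> g) - (\<Sum>\<phi>\<in>#M'. \<phi> g)"
    and norm: "cinner G f f = 1" and pos: "Re (f \<one>\<^bsub>G\<^esub>) > 0"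
    and ext: "\<And>g. g \<notin> carrier G \<Longrightarrow> f g = undefined"
  shows "f \<in> Irr G"
proof -
  interpret group G by fact
  define S where "S = set_mset M \<union> set_mset M'"
  have S: "finite S" "S \<subseteq> Irr G" using M by (auto simp: S_def)
  define c :: "('a \<Rightarrow> complex) \<Rightarrow> int" where "c \<phi> = int (count M \<phi>) - int (count M' \<phi>)" for \<phi>
  have fc: "f g = (\<Sum>\<phi>\<in>S. of_int (c \<phi>) * \<phi> g)" if "g \<in> carrier G" for g
  proof -
    have "f g = (\<Sum>\<phi>\<in>S. of_nat (count M \<phi>) * \<phi> g) - (\<Sum>\<phi>\<in>S. of_nat (count M' \<phi>) * \<phi> g)"
      using f[OF that] by (simp add: sum_mset_count[of S] S S_def)
    then show ?thesis
      by (simp add: c_def left_diff_distrib sum_subtractf)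
  qed
  have "cinner G f f = cinner G (\<lambda>g. \<Sum>\<phi>\<in>S. of_int (c \<phi>) * \<phi> g) (\<lambda>g. \<Sum>\<phi>\<in>S. of_int (c \<phi>) * \<phi> g)"
    by (rule cinner_cong) (simp_all add: fc)
  also have "\<dots> = of_int (\<Sum>\<phi>\<in>S. (c \<phi>)\<^sup>2)"
    by (subst cinner_expansion[OF G S, of "\<lambda>\<phi>. of_int (c \<phi>)" "\<lambda>\<phi>. of_int (c \<phi>)"])
       (simp add: power2_eq_square)
  finally have "of_int (\<Sum>\<phi>\<in>S. (c \<phi>)\<^sup>2) = (1 :: complex)"
    unfolding norm by (rule sym)
  then have 1: "(\<Sum>\<phi>\<in>S. (c \<phi>)\<^sup>2) = 1"
    by (simp only: of_int_eq_1_iff)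
  then obtain \<phi> where \<phi>: "\<phi> \<in> S" "c \<phi> \<noteq> 0"
    using sum.neutral[of S "\<lambda>\<phi>. (c \<phi>)\<^sup>2"] by fastforce
  have "(\<Sum>\<psi>\<in>S. (c \<psi>)\<^sup>2) = (c \<phi>)\<^sup>2 + (\<Sum>\<psi>\<in>S - {\<phi>}. (c \<psi>)\<^sup>2)"
    using S \<phi> by (simp add: sum.remove)
  moreover have "(\<Sum>\<psi>\<in>S - {\<phi>}. (c \<psi>)\<^sup>2) \<ge> 0" by (intro sum_nonneg) auto
  moreover have "(c \<phi>)\<^sup>2 \<ge> 1" using \<phi>(2) by (metis int_one_le_iff_zero_less zero_less_power2)
  ultimately have c\<phi>: "(c \<phi>)\<^sup>2 = 1" and 0: "(\<Sum>\<psi>\<in>S - {\<phi>}. (c \<psi>)\<^sup>2) = 0"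
    using 1 by linarith+
  from 0 have c0: "c \<psi> = 0" if "\<psi> \<in> S - {\<phi>}" for \<psi>
    using that S by (subst (asm) sum_nonneg_eq_0_iff) auto
  have f\<phi>: "f g = of_int (c \<phi>) * \<phi> g" if "g \<in> carrier G" for g
    using fc[OF that] S \<phi> by (simp add: sum.remove[of S \<phi>] c0)
  obtain n :: nat where n: "n > 0" "\<phi> \<one>\<^bsub>G\<^esub> = of_nat n"
    using Irr_degree_pos[OF G(1)] \<phi> S by blast
  have "c \<phi> = 1"
    using c\<phi> f\<phi>[of "\<one>\<^bsub>G\<^esub>"] n pos by (auto simp: power2_eq_1_iff)
  then have "f = \<phi>"
  proof (intro HOL.ext)
    fix g
    show "f g = \<phi> g"
    proof (cases "g \<in> carrier G")
      case True
      then show ?thesis using f\<phi> \<open>c \<phi> = 1\<close> by simp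
    next
      case False
      then show ?thesis using ext Irr_undefined[of \<phi> G g] \<phi> S by auto
    qed
  qed
  then show ?thesis using \<phi> S by auto
qed

text \<open>The difference between \<open>f\<close> and its projection \<open>p\<close> to the span
  of \<open>S\<close> has nonnegative norm.\<close>

lemma bessel:
  assumes G: "group G" "finite (carrier G)" and S: "finite S" "S \<subseteq> Irr G"
  shows "(\<Sum>\<phi>\<in>S. (norm (cinner G f \<phi>))\<^sup>2) \<le> Re (cinner G f f)"
proof -
  define a where "a \<phi> = cinner G f \<phi>" for \<phi>
  define p where "p g = (\<Sum>\<phi>\<in>S. a \<phi> * \<phi> g)" for g
  have "cinner G f p = (\<Sum>\<phi>\<in>S. cnj (a \<phi>) * cinner G f \<phi>)"
    by (simp only: p_def[abs_def] cinner_sum_right)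
  also have "\<dots> = (\<Sum>\<phi>\<in>S. of_real ((norm (a \<phi>))\<^sup>2))"
    by (simp only: a_def complex_norm_square mult.commute)
  finally have fp: "cinner G f p = (\<Sum>\<phi>\<in>S. of_real ((norm (a \<phi>))\<^sup>2))" .
  have pp: "cinner G p p = (\<Sum>\<phi>\<in>S. of_real ((norm (a \<phi>))\<^sup>2))"
    by (simp only: p_def[abs_def] cinner_expansion[OF G S] complex_norm_square)
  have "cinner G (\<lambda>g. f g - p g) (\<lambda>g. f g - p g) = cinner G f f - cinner G f p - cinner G p f + cinner G p p"
    by (simp add: cinner_diff_left cinner_diff_right)
  also have "cinner G p f = (\<Sum>\<phi>\<in>S. of_real ((norm (a \<phi>))\<^sup>2))"
    by (subst cinner_commute) (simp add: fp)
  finally have "cinner G (\<lambda>g. f g - p g) (\<lambda>g. f g - p g) = cinner G f f - of_real (\<Sum>\<phi>\<in>S. (norm (a \<phi>))\<^sup>2)"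
    by (simp add: fp pp)
  moreover have "Re (cinner G (\<lambda>g. f g - p g) (\<lambda>g. f g - p g)) \<ge> 0"
    unfolding cinner_self by (auto intro!: divide_nonneg_nonneg sum_nonneg)
  ultimately show ?thesis by (simp add: a_def)
qed

text \<open>Bessel's inequality for the function counting the \<open>h\<close> with \<open>h \<sigma> h\<inverse> = g\<close>.\<close>

lemma sum_squares_le_centralizer:
  fixes G (structure)
  assumes G: "group G" "finite (carrier G)" and S: "finite S" "S \<subseteq> Irr G" and \<sigma>: "\<sigma> \<in> carrier G"
  shows "(\<Sum>\<phi>\<in>S. (norm (\<phi> \<sigma>))\<^sup>2) \<le> card {g \<in> carrier G. g \<otimes> \<sigma> = \<sigma> \<otimes> g}"
proof -
  interpret group G by fact
  let ?n = "card (carrier G)" and ?C = "{g \<in> carrier G. g \<otimes> \<sigma> = \<sigma> \<otimes> g}"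
  have cpos: "?n > 0" using G(2) by (auto simp: card_gt_0_iff)
  define f :: "'a \<Rightarrow> complex" where "f g = (\<Sum>h\<in>carrier G. if h \<otimes> \<sigma> \<otimes> inv h = g then 1 else 0)" for g
  have pair: "(\<Sum>g\<in>carrier G. f g * F g) = (\<Sum>h\<in>carrier G. F (h \<otimes> \<sigma> \<otimes> inv h))" for F
  proof -
    have "(\<Sum>g\<in>carrier G. f g * F g) = (\<Sum>g\<in>carrier G. \<Sum>h\<in>carrier G. if h \<otimes> \<sigma> \<otimes> inv h = g then F g else 0)"
      by (auto simp: f_def sum_distrib_right intro!: sum.cong)
    also have "\<dots> = (\<Sum>h\<in>carrier G. \<Sum>g\<in>carrier G. if h \<otimes> \<sigma> \<otimes> inv h = g then F g else 0)"
      by (rule sum.swap)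
    also have "\<dots> = (\<Sum>h\<in>carrier G. F (h \<otimes> \<sigma> \<otimes> inv h))"
      using \<sigma> G(2) by (intro sum.cong) auto
    finally show ?thesis .
  qed
  have f\<phi>: "cinner G f \<phi> = cnj (\<phi> \<sigma>)" if "\<phi> \<in> Irr G" for \<phi>
    using that \<sigma> cpos by (simp add: cinner_def pair Irr_conj[OF G(1)])
  \<comment> \<open>Translating the summation variable by \<open>h\<close> reduces the count at a
    conjugate of \<sigma> to the count at \<sigma>, which is the size of the centralizer.\<close>
  have fC: "f (h \<otimes> \<sigma> \<otimes> inv h) = of_nat (card ?C)" if h: "h \<in> carrier G" for h
  proof -
    have "f (h \<otimes> \<sigma> \<otimes> inv h) = (\<Sum>x\<in>carrier G. if (h \<otimes> x) \<otimes> \<sigma> \<otimes> inv (h \<otimes> x) = h \<otimes> \<sigma> \<otimes> inv h then 1 else 0)"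
      unfolding f_def by (rule sum_translate[OF h, symmetric])
    also have "\<dots> = (\<Sum>x\<in>carrier G. if x \<otimes> \<sigma> = \<sigma> \<otimes> x then 1 else 0)"
    proof (intro sum.cong refl if_cong)
      fix x assume x: "x \<in> carrier G"
      have "(h \<otimes> x) \<otimes> \<sigma> \<otimes> inv (h \<otimes> x) = h \<otimes> (x \<otimes> \<sigma> \<otimes> inv x) \<otimes> inv h"
        using h x \<sigma> by (simp add: inv_mult_group m_assoc)
      then have "(h \<otimes> x) \<otimes> \<sigma> \<otimes> inv (h \<otimes> x) = h \<otimes> \<sigma> \<otimes> inv h \<longleftrightarrow> x \<otimes> \<sigma> \<otimes> inv x = \<sigma>"
        using h x \<sigma> by simp
      also have "\<dots> \<longleftrightarrow> x \<otimes> \<sigma> = \<sigma> \<otimes> x"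
        using x \<sigma> by (metis inv_closed inv_solve_right m_closed)
      finally show "(h \<otimes> x) \<otimes> \<sigma> \<otimes> inv (h \<otimes> x) = h \<otimes> \<sigma> \<otimes> inv h \<longleftrightarrow> x \<otimes> \<sigma> = \<sigma> \<otimes> x" .
    qed
    also have "\<dots> = of_nat (card ?C)"
      using G(2) by (simp add: sum.If_cases Collect_conj_eq)
    finally show ?thesis .
  qed
  have "cinner G f f = of_nat (card ?C)"
    using cpos by (simp add: cinner_def pair fC)
  then show ?thesis
    using bessel[OF G S, of f] S by (simp add: f\<phi> subset_iff)
qed

section \<open>Values at rational elements of order a power of 3\<close>

lemma coprime_3_iff: "coprime a (3::nat) \<longleftrightarrow> a mod 3 \<noteq> 0"
proof -
  have "Factorial_Ring.prime (3::nat)" by simp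
  then show ?thesis
    using Factorial_Ring.prime_imp_coprime[of 3 a] coprime_common_divisor[of a 3 3]
    by (auto simp: dvd_eq_mod_eq_0[symmetric] coprime_commute)
qed

text \<open>Fourier inversion on the \<open>N\<close>-th roots of unity: the multiplicity of
  \<open>z\<close> is the average over m < N of the \<open>m\<close>-th power sum times
  z^-m.\<close>

lemma power_sums_determine:
  fixes es fs :: "complex list"
  assumes N: "N > 0" and es: "\<And>e. e \<in> set es \<Longrightarrow> e ^ N = 1" and fs: "\<And>e. e \<in> set fs \<Longrightarrow> e ^ N = 1"
    and eq: "\<And>m. (\<Sum>e\<leftarrow>es. e ^ m) = (\<Sum>e\<leftarrow>fs. e ^ m)"
  shows "mset es = mset fs"
proof (rule multiset_eqI)
  fix z :: complex
  have key: "of_nat N * of_nat (count (mset xs) z) = (\<Sum>m<N. (\<Sum>e\<leftarrow>xs. e ^ m) * (1 / z) ^ m)"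
    if xs: "\<And>e. e \<in> set xs \<Longrightarrow> e ^ N = 1" and z: "z ^ N = 1" for xs
  proof -
    have z0: "z \<noteq> 0" using z N by (auto simp: power_0_left)
    have "(\<Sum>m<N. (\<Sum>e\<leftarrow>xs. e ^ m) * (1 / z) ^ m) = (\<Sum>e\<leftarrow>xs. \<Sum>m<N. e ^ m * (1 / z) ^ m)"
      by (induction xs) (auto simp: sum.distrib distrib_right)
    also have "\<dots> = (\<Sum>e\<leftarrow>xs. \<Sum>m<N. (e / z) ^ m)"
      by (intro arg_cong[where f = sum_list] map_cong sum.cong refl)
         (simp add: power_divide)
    also have "\<dots> = (\<Sum>e\<leftarrow>xs. if e = z then of_nat N else 0)"
    proof (intro arg_cong[where f = sum_list] map_cong refl)
      fix e assume e: "e \<in> set xs"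
      show "(\<Sum>m<N. (e / z) ^ m) = (if e = z then of_nat N else 0)"
      proof (cases "e = z")
        case True
        then show ?thesis using z0 by simp
      next
        case False
        then have "e / z \<noteq> 1" using z0 by simp
        moreover have "(e / z) ^ N = 1" using xs[OF e] z by (simp add: power_divide)
        ultimately show ?thesis using False geometric_sum[of "e / z" N] by simp
      qed
    qed
    also have "\<dots> = of_nat N * of_nat (count (mset xs) z)"
      by (induction xs) (auto simp: distrib_left)
    finally show ?thesis by simp
  qed
  show "count (mset es) z = count (mset fs) z"
  proof (cases "z ^ N = 1")
    case True
    have "of_nat N * (of_nat (count (mset es) z) :: complex) = of_nat N * of_nat (count (mset fs) z)"
      using key[OF es True] key[OF fs True] eq by simp
    then show ?thesis using N by simp
  next
    case False
    then have "z \<notin># mset es" "z \<notin># mset fs" using es fs by auto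
    then have "count (mset es) z = 0" "count (mset fs) z = 0" by (simp_all only: not_in_iff)
    then show ?thesis by (simp only:)
  qed
qed

lemma cube_root_factor:
  fixes t u :: complex
  assumes "u ^ 3 = 1" "u \<noteq> 1"
  shows "1 + u + u\<^sup>2 = 0" "t ^ 3 = 1 \<longleftrightarrow> t = 1 \<or> t = u \<or> t = u\<^sup>2"
proof -
  have "(u - 1) * (1 + u + u\<^sup>2) = u ^ 3 - 1"
    by (simp add: algebra_simps power2_eq_square power3_eq_cube)
  then show 0: "1 + u + u\<^sup>2 = 0" using assms by simp
  have "(t - 1) * ((t - u) * (t - u\<^sup>2)) = t ^ 3 - t\<^sup>2 * (1 + u + u\<^sup>2) + t * (u + u\<^sup>2 + u ^ 3) - u ^ 3"
    by (simp add: algebra_simps power2_eq_square power3_eq_cube)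
  also have "u + u\<^sup>2 + u ^ 3 = 1 + u + u\<^sup>2" using assms(1) by simp
  finally have "(t - 1) * ((t - u) * (t - u\<^sup>2)) = t ^ 3 - 1"
    using 0 assms(1) by simp
  then have "t ^ 3 = 1 \<longleftrightarrow> (t - 1) * ((t - u) * (t - u\<^sup>2)) = 0" by auto
  then show "t ^ 3 = 1 \<longleftrightarrow> t = 1 \<or> t = u \<or> t = u\<^sup>2" by simp
qed

text \<open>The sum is grouped along the fibres of \<open>z \<mapsto> z\<^sup>3\<close>. A fibre \<open>{z, zu, zu\<^sup>2}\<close> over a point
  other than 1 consists of powers of \<open>z\<close> with exponents prime to 3, so it contributes 0 to the sum
  and a multiple of 3 to the number of terms.\<close>

lemma rational_power_sum:
  fixes es :: "complex list"
  assumes es: "\<And>e. e \<in> set es \<Longrightarrow> e ^ (3 ^ k) = 1"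
    and inv: "\<And>a. coprime a 3 \<Longrightarrow> mset (map (\<lambda>e. e ^ a) es) = mset es"
  shows "\<exists>c::int. (\<Sum>e\<leftarrow>es. e) = of_int c \<and> c mod 3 = int (length es) mod 3"
proof -
  define U where "U = {z :: complex. z ^ (3 ^ k) = 1}"
  have finU: "finite U" unfolding U_def by (rule finite_roots_unity) simp
  define n where "n z = count (mset es) z" for z
  have ninv: "n z \<le> n (z ^ a)" if "coprime a 3" for z a
  proof -
    have "n (z ^ a) = count (mset (map (\<lambda>e. e ^ a) es)) (z ^ a)"
      using inv[OF that] by (simp add: n_def)
    also have "\<dots> \<ge> n z"
    proof -
      have "count (mset xs) z \<le> count (mset (map (\<lambda>e. e ^ a) xs)) (z ^ a)" for xs
        by (induction xs) auto
      then show ?thesis by (simp only: n_def)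
    qed
    finally show ?thesis .
  qed
  \<comment> \<open>The estimate \<open>ninv\<close> becomes an equality when it is applied again
    with an exponent \<open>b\<close> inverse to \<open>a\<close> modulo 3^k. That \<open>b\<close>
    is prime to 3 is automatic for k > 0 and arranged by \<open>b = 1\<close> for k = 0.\<close>
  have bez: "\<exists>b. coprime b 3 \<and> [a * b = 1] (mod 3 ^ k)" if a: "coprime a 3" for a :: nat
  proof (cases "k = 0")
    case False
    have "coprime a (3 ^ k)" using a by simp
    then obtain b where b: "[a * b = 1] (mod 3 ^ k)"
      using cong_solve_coprime_nat[of a "3 ^ k"] by auto
    then have "coprime (a * b) (3 ^ k)"
      by (metis cong_imp_coprime cong_sym coprime_1_left)
    then show ?thesis using b False by auto
  qed (auto intro!: exI[of _ 1])
  have neq: "n (z ^ a) = n z" if a: "coprime a 3" and z: "z \<in> U" for z a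
  proof -
    obtain b where b: "coprime b 3" "[a * b = 1] (mod 3 ^ k)"
      using bez[OF a] by blast
    have "(z ^ a) ^ b = z ^ (a * b mod 3 ^ k + 3 ^ k * (a * b div 3 ^ k))"
      by (simp add: power_mult)
    also have "\<dots> = z ^ (1 mod 3 ^ k)"
      using z b(2) by (simp only: power_add power_mult cong_def) (simp add: U_def)
    also have "\<dots> = z" using z by (cases "k = 0") (auto simp: U_def)
    finally have "n (z ^ a) \<le> n z" using ninv[OF b(1), of "z ^ a"] by simp
    then show ?thesis using ninv[OF a, of z] by simp
  qed
  have sum_es: "(\<Sum>e\<leftarrow>es. F e) = (\<Sum>z\<in>U. of_nat (n z) * F z)" for F :: "complex \<Rightarrow> complex"
    using sum_mset_count[OF finU, of "mset es" F] es
    by (auto simp: n_def U_def sum_mset_sum_list simp flip: mset_map)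
  define cube where "cube z = z ^ 3" for z :: complex
  define fib where "fib w = {z \<in> U. cube z = w}" for w
  have len: "length es = (\<Sum>z\<in>U. n z)"
  proof -
    have "(of_nat (length es) :: complex) = of_nat (\<Sum>z\<in>U. n z)"
      using sum_es[of "\<lambda>_. 1"] by (simp add: sum_list_triv)
    then show ?thesis by (simp only: of_nat_eq_iff)
  qed
  have generic: "(\<Sum>z\<in>fib w. of_nat (n z) * z) = 0 \<and> (\<Sum>z\<in>fib w. n z) mod 3 = 0"
    if w: "w \<in> cube ` U" "w \<noteq> 1" for w
  proof -
    obtain z where z: "z \<in> U" "w = z ^ 3" using w by (auto simp: cube_def)
    define j where "j = (LEAST j. z ^ (3 ^ j) = 1)"
    have zj: "z ^ (3 ^ j) = 1"
      unfolding j_def by (rule LeastI[of _ k]) (use z in \<open>simp add: U_def\<close>)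
    have "j \<noteq> 0"
    proof
      assume "j = 0"
      then have "z = 1" using zj by simp
      then show False using z w by simp
    qed
    moreover have "j \<noteq> 1"
    proof
      assume "j = 1"
      then have "z ^ 3 = 1" using zj by simp
      then show False using z w by simp
    qed
    ultimately obtain i where i: "j = Suc (Suc i)" by (metis One_nat_def not0_implies_Suc)
    \<comment> \<open>\<open>z\<close> has order 3^(i + 2), the exponent being at least 2 because
      the cube of \<open>z\<close> is not 1. Hence \<open>u\<close> is a primitive cube root of
      unity, and the exponents 1 + 3^(i + 1) and 1 + 2 * 3^(i + 1) producing the other points of the
      fibre are prime to 3.\<close>
    define u where "u = z ^ (3 ^ Suc i)"
    have u1: "u \<noteq> 1" unfolding u_def using not_less_Least[of "Suc i" "\<lambda>j. z ^ (3 ^ j) = 1"] i by (simp add: j_def)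
    have u3: "u ^ 3 = 1" using zj i by (simp add: u_def mult.commute flip: power_mult)
    note cr = cube_root_factor[OF u3 u1]
    have z0: "z \<noteq> 0" using z by (auto simp: U_def power_0_left)
    have zu: "z * u = z ^ (1 + 3 ^ Suc i)" "z * u\<^sup>2 = z ^ (1 + 2 * 3 ^ Suc i)"
      by (simp_all add: u_def power_add mult.commute flip: power_mult)
    have cop: "coprime (1 + 3 ^ Suc i) (3::nat)" "coprime (1 + 2 * 3 ^ Suc i) (3::nat)"
    proof -
      have "(1 + 3 * q) mod 3 \<noteq> 0" "(1 + 2 * (3 * q)) mod 3 \<noteq> 0" for q :: nat
        by presburger+
      from this[of "3 ^ i"] show "coprime (1 + 3 ^ Suc i) (3::nat)" "coprime (1 + 2 * 3 ^ Suc i) (3::nat)"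
        unfolding coprime_3_iff by simp_all
    qed
    have uU: "u \<in> U"
      using z by (simp add: u_def U_def) (metis power_commutes power_mult power_one mult.commute)
    have inU: "z * u \<in> U" "z * u\<^sup>2 \<in> U"
      using z uU by (auto simp: U_def power_mult_distrib) (metis power_mult mult.commute power_one)
    have fib: "fib w = {z, z * u, z * u\<^sup>2}"
    proof -
      have "y \<in> fib w \<longleftrightarrow> y \<in> {z, z * u, z * u\<^sup>2}" for y
      proof -
        have "y ^ 3 = z ^ 3 \<longleftrightarrow> (y / z) ^ 3 = 1" using z0 by (simp add: power_divide)
        also have "\<dots> \<longleftrightarrow> y / z = 1 \<or> y / z = u \<or> y / z = u\<^sup>2" by (rule cr(2))
        also have "\<dots> \<longleftrightarrow> y \<in> {z, z * u, z * u\<^sup>2}" using z0 by (auto simp: field_simps)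
        finally show ?thesis using inU z by (auto simp: fib_def cube_def)
      qed
      then show ?thesis by blast
    qed
    have u0: "u \<noteq> 0" using u3 by auto
    have dist: "z \<noteq> z * u" "z \<noteq> z * u\<^sup>2" "z * u \<noteq> z * u\<^sup>2"
    proof -
      show "z \<noteq> z * u" using z0 u1 by simp
      show "z * u \<noteq> z * u\<^sup>2" using z0 u1 u0 by (simp add: power2_eq_square)
      show "z \<noteq> z * u\<^sup>2"
      proof
        assume "z = z * u\<^sup>2"
        then have "u\<^sup>2 = 1" using z0 by simp
        then have "u ^ 3 = u" by (simp add: power3_eq_cube power2_eq_square)
        with u3 u1 show False by simp
      qed
    qed
    have nn: "n (z * u) = n z" "n (z * u\<^sup>2) = n z"
      unfolding zu by (rule neq[OF cop(1) z(1)], rule neq[OF cop(2) z(1)])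
    have "(\<Sum>z\<in>fib w. of_nat (n z) * z) = of_nat (n z) * z + (of_nat (n z) * (z * u) + of_nat (n z) * (z * u\<^sup>2))"
      using dist by (simp add: fib nn)
    also have "\<dots> = of_nat (n z) * z * (1 + u + u\<^sup>2)"
      by (simp add: algebra_simps)
    finally have "(\<Sum>z\<in>fib w. of_nat (n z) * z) = of_nat (n z) * z * (1 + u + u\<^sup>2)" .
    moreover have "(\<Sum>z\<in>fib w. n z) = 3 * n z"
      using dist by (simp add: fib nn)
    ultimately show ?thesis using cr(1) by simp
  qed
  \<comment> \<open>Over 1 the fibre is {1, u, u^2} with equal multiplicities at u and u^2. It
    contributes n(1) - n(u) to the sum and n(1) + 2 n(u) to the length, which agree modulo 3. For k
    = 0 the fibre is just {1}.\<close>
  have one: "\<exists>c::int. (\<Sum>z\<in>fib 1. of_nat (n z) * z) = of_int c \<and> c mod 3 = int (\<Sum>z\<in>fib 1. n z) mod 3"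
  proof (cases "k = 0")
    case True
    then have "fib 1 = {1}" by (auto simp: fib_def U_def cube_def)
    then show ?thesis by (intro exI[of _ "int (n 1)"]) auto
  next
    case False
    define u where "u = cis (2 * pi / 3)"
    have u3: "u ^ 3 = 1" by (simp add: u_def DeMoivre)
    have u1: "u \<noteq> 1"
    proof
      assume "u = 1"
      then have "cos (2 * pi / 3) = 1" by (simp add: u_def complex_eq_iff)
      then show False by (simp add: cos_120)
    qed
    note cr = cube_root_factor[OF u3 u1]
    have uU: "t \<in> U" if "t ^ 3 = 1" for t
    proof -
      have "t ^ (3 ^ k) = (t ^ 3) ^ (3 ^ (k - 1))"
        using False by (simp flip: power_mult power_Suc)
      then show ?thesis using that by (simp add: U_def)
    qed
    have fib: "fib 1 = {1, u, u\<^sup>2}"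
      using uU cr(2) by (auto simp: fib_def cube_def)
    have dist: "1 \<noteq> u" "1 \<noteq> u\<^sup>2" "u \<noteq> u\<^sup>2"
    proof -
      show "1 \<noteq> u" using u1 by simp
      show "u \<noteq> u\<^sup>2" using u1 u3 by (auto simp: power2_eq_square)
      show "1 \<noteq> u\<^sup>2"
      proof
        assume "1 = u\<^sup>2"
        then have "u ^ 3 = u" by (simp add: power3_eq_cube power2_eq_square)
        with u3 u1 show False by simp
      qed
    qed
    have nn: "n (u\<^sup>2) = n u"
      using neq[of 2 u] uU[OF u3] by simp
    have "(\<Sum>z\<in>fib 1. of_nat (n z) * z) = of_nat (n 1) + of_nat (n u) * (u + u\<^sup>2)"
      using dist by (simp add: fib nn algebra_simps)
    also have "u + u\<^sup>2 = -1" using cr(1) by (simp add: eq_neg_iff_add_eq_0 add.assoc add.commute)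
    finally have "(\<Sum>z\<in>fib 1. of_nat (n z) * z) = of_int (int (n 1) - int (n u))" by simp
    moreover have "(\<Sum>z\<in>fib 1. n z) = n 1 + 2 * n u"
      using dist by (simp add: fib nn)
    moreover have "(int (n 1) - int (n u)) mod 3 = int (n 1 + 2 * n u) mod 3"
      by presburger
    ultimately show ?thesis by metis
  qed
  have 1: "1 \<in> cube ` U" by (auto simp: cube_def U_def intro!: image_eqI[of _ _ 1])
  obtain c :: int where c: "(\<Sum>z\<in>fib 1. of_nat (n z) * z) = of_int c" "c mod 3 = int (\<Sum>z\<in>fib 1. n z) mod 3"
    using one by blast
  have "(\<Sum>e\<leftarrow>es. e) = (\<Sum>z\<in>U. of_nat (n z) * z)"
    using sum_es[of "\<lambda>e. e"] by simp
  also have "\<dots> = (\<Sum>w\<in>cube ` U. \<Sum>z\<in>fib w. of_nat (n z) * z)"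
    unfolding fib_def by (rule sum.image_gen[OF finU])
  also have "\<dots> = (\<Sum>z\<in>fib 1. of_nat (n z) * z) + (\<Sum>w\<in>cube ` U - {1}. \<Sum>z\<in>fib w. of_nat (n z) * z)"
    using finU 1 by (intro sum.remove) auto
  also have "(\<Sum>w\<in>cube ` U - {1}. \<Sum>z\<in>fib w. of_nat (n z) * z) = 0"
    using generic by (intro sum.neutral) auto
  finally have A: "(\<Sum>e\<leftarrow>es. e) = of_int c" using c by simp
  have "length es = (\<Sum>w\<in>cube ` U. \<Sum>z\<in>fib w. n z)"
    unfolding fib_def len by (rule sum.image_gen[OF finU])
  also have "\<dots> = (\<Sum>z\<in>fib 1. n z) + (\<Sum>w\<in>cube ` U - {1}. \<Sum>z\<in>fib w. n z)"
    using finU 1 by (intro sum.remove) auto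
  finally have "length es mod 3 = ((\<Sum>z\<in>fib 1. n z) + (\<Sum>w\<in>cube ` U - {1}. \<Sum>z\<in>fib w. n z)) mod 3"
    by simp
  also have "\<dots> = (\<Sum>z\<in>fib 1. n z) mod 3"
  proof -
    have "3 dvd (\<Sum>w\<in>cube ` U - {1}. \<Sum>z\<in>fib w. n z)"
      by (rule dvd_sum) (use generic in \<open>auto simp: mod_eq_0_iff_dvd\<close>)
    then show ?thesis by (metis add.right_neutral mod_add_right_eq mod_eq_0_iff_dvd)
  qed
  finally have "c mod 3 = int (length es) mod 3"
    using c(2) by (metis of_nat_mod of_nat_numeral)
  with A show ?thesis by blast
qed

text \<open>Conjugacy of \<sigma> with its powers gives the eigenvalues and their
  \<open>a\<close>-th powers equal power sums, so the multiset of eigenvalues is stable under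
  \<open>a\<close>-th powers, as \<open>rational_power_sum\<close> requires. The congruence then
  relates the sum of the eigenvalues to their number.\<close>

lemma Irr_value_congruence:
  fixes G (structure)
  assumes G: "group G" "finite (carrier G)" and \<chi>: "\<chi> \<in> Irr G" and \<sigma>: "\<sigma> \<in> carrier G"
    and ord: "\<sigma> [^] ((3::nat) ^ k) = \<one>"
    and rat: "\<And>a::nat. coprime a 3 \<Longrightarrow> \<exists>h\<in>carrier G. h \<otimes> \<sigma> \<otimes> inv h = \<sigma> [^] a"
  shows "\<exists>c::int. \<exists>d::nat. \<chi> \<sigma> = of_int c \<and> \<chi> \<one> = of_nat d \<and> c mod 3 = int d mod 3"
proof -
  interpret group G by fact
  obtain n \<rho> where r: "irreducible_rep G n \<rho>" "\<chi> = rep_character G \<rho>"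
    using \<chi> by (auto simp: Irr_def)
  then have rep: "matrix_rep G n \<rho>" by (auto simp: irreducible_rep_def)
  obtain es where es: "length es = n" "\<And>m::nat. mtr (\<rho> (\<sigma> [^] m)) = (\<Sum>e\<leftarrow>es. e ^ m)"
    "\<And>N::nat. \<sigma> [^] N = \<one> \<Longrightarrow> \<forall>e\<in>set es. e ^ N = 1"
    by (rule rep_eigenvalues[OF rep G \<sigma>]) (rule that)
  have eN: "e ^ (3 ^ k) = 1" if "e \<in> set es" for e
    using es(3)[OF ord] that by blast
  have "mset (map (\<lambda>e. e ^ a) es) = mset es" if a: "coprime a 3" for a :: nat
  proof (rule power_sums_determine[of "3 ^ k"])
    fix m :: nat
    obtain h where h: "h \<in> carrier G" "h \<otimes> \<sigma> \<otimes> inv h = \<sigma> [^] a"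
      using rat[OF a] by blast
    have "h \<otimes> (\<sigma> [^] m) \<otimes> inv h = (h \<otimes> \<sigma> \<otimes> inv h) [^] m"
    proof (induction m)
      case (Suc m)
      have "(h \<otimes> \<sigma> \<otimes> inv h) [^] Suc m = h \<otimes> (\<sigma> [^] m) \<otimes> inv h \<otimes> (h \<otimes> \<sigma> \<otimes> inv h)"
        using Suc by simp
      also have "\<dots> = h \<otimes> (\<sigma> [^] m) \<otimes> (inv h \<otimes> h) \<otimes> \<sigma> \<otimes> inv h"
        using h(1) \<sigma> by (simp only: m_assoc m_closed inv_closed nat_pow_closed)
      also have "\<dots> = h \<otimes> (\<sigma> [^] Suc m) \<otimes> inv h"
        using h(1) \<sigma> by (simp add: m_assoc)
      finally show ?case by simp
    qed (use h(1) in simp)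
    then have "h \<otimes> (\<sigma> [^] m) \<otimes> inv h = \<sigma> [^] (a * m)"
      using h \<sigma> by (simp add: nat_pow_pow)
    then have "\<chi> (\<sigma> [^] (a * m)) = \<chi> (\<sigma> [^] m)"
      using Irr_conj[OF G(1) \<chi>, of "\<sigma> [^] m" h] h \<sigma> by simp
    then show "(\<Sum>e\<leftarrow>map (\<lambda>e. e ^ a) es. e ^ m) = (\<Sum>e\<leftarrow>es. e ^ m)"
      using \<sigma> by (simp add: r rep_character_mtr es(2) comp_def flip: power_mult)
  next
    fix e assume "e \<in> set (map (\<lambda>e. e ^ a) es)"
    then obtain e' where e': "e' \<in> set es" "e = e' ^ a" by auto
    have "e ^ 3 ^ k = (e' ^ 3 ^ k) ^ a" unfolding e' by (metis power_mult mult.commute)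
    then show "e ^ 3 ^ k = 1" using eN[OF e'(1)] by simp
  qed (use eN in auto)
  from rational_power_sum[OF eN this] obtain c :: int
    where "(\<Sum>e\<leftarrow>es. e) = of_int c" "c mod 3 = int (length es) mod 3" by blast
  moreover have "\<chi> \<sigma> = (\<Sum>e\<leftarrow>es. e)"
    using es(2)[of 1] \<sigma> r by (simp add: rep_character_mtr)
  moreover have "\<chi> \<one> = of_nat n"
    using es(2)[of 0] es(1) r by (simp add: rep_character_mtr sum_list_triv)
  ultimately show ?thesis using es(1) by metis
qed

theorem Irr_p'_eqI:
  fixes G (structure)
  assumes G: "group G" "finite (carrier G)" and \<sigma>: "\<sigma> \<in> carrier G"
    and ord: "\<sigma> [^] ((3::nat) ^ k) = \<one>"
    and rat: "\<And>a::nat. coprime a 3 \<Longrightarrow> \<exists>h\<in>carrier G. h \<otimes> \<sigma> \<otimes> inv h = \<sigma> [^] a"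
    and cent: "card {g \<in> carrier G. g \<otimes> \<sigma> = \<sigma> \<otimes> g} \<le> n"
    and \<chi>: "\<And>j. j < n \<Longrightarrow> \<chi> j \<in> Irr_p' 3 G" and inj: "inj_on \<chi> {..<n}"
  shows "Irr_p' 3 G = \<chi> ` {..<n}"
proof (rule antisym)
  show "\<chi> ` {..<n} \<subseteq> Irr_p' 3 G" using \<chi> by auto
  show "Irr_p' 3 G \<subseteq> \<chi> ` {..<n}"
  proof
    fix \<psi> assume \<psi>: "\<psi> \<in> Irr_p' 3 G"
    show "\<psi> \<in> \<chi> ` {..<n}"
    proof (rule ccontr)
      assume new: "\<psi> \<notin> \<chi> ` {..<n}"
      define S where "S = insert \<psi> (\<chi> ` {..<n})"
      have S: "finite S" "S \<subseteq> Irr_p' 3 G" using \<psi> \<chi> by (auto simp: S_def)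
      have cS: "card S = Suc n" using new inj by (simp add: S_def card_image)
      have one: "1 \<le> (norm (\<phi> \<sigma>))\<^sup>2" if "\<phi> \<in> S" for \<phi>
      proof -
        have \<phi>: "\<phi> \<in> Irr G" using that S by (auto simp: Irr_p'_def)
        obtain c :: int and d :: nat where cd: "\<phi> \<sigma> = of_int c" "\<phi> \<one> = of_nat d" "c mod 3 = int d mod 3"
          using Irr_value_congruence[OF G \<phi> \<sigma> ord rat] by blast
        have "coprime d 3" using that S cd(2) by (auto simp: Irr_p'_def)
        then have "\<not> 3 dvd d" using coprime_common_divisor[of d 3 3] by auto
        then have "c \<noteq> 0" using cd(3) by presburger
        then have "1 \<le> \<bar>c\<bar>" by simp
        then have "1 \<le> norm (\<phi> \<sigma>)" using cd(1) by simp
        then show ?thesis by (simp add: one_le_power)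
      qed
      have "real (Suc n) = (\<Sum>\<phi>\<in>S. 1)" using cS by simp
      also have "\<dots> \<le> (\<Sum>\<phi>\<in>S. (norm (\<phi> \<sigma>))\<^sup>2)" by (rule sum_mono) (rule one)
      also have "\<dots> \<le> card {g \<in> carrier G. g \<otimes> \<sigma> = \<sigma> \<otimes> g}"
        using S by (intro sum_squares_le_centralizer[OF G _ _ \<sigma>]) (auto simp: Irr_p'_def)
      also have "\<dots> \<le> real n" using cent by simp
      finally show False by simp
    qed
  qed
qed

section \<open>Exterior powers of monomial representations\<close>

text \<open>Equal sizes of the colour classes allow matching them class by class. Colours will
  encode membership: two for one subset, four for a pair of subsets.\<close>

lemma colouring_permutes:
  assumes "finite A" "\<And>c. card {x \<in> A. f x = c} = card {x \<in> A. f' x = c}"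
  obtains p where "p permutes A" "\<And>x. x \<in> A \<Longrightarrow> f x = f' (p x)"
proof -
  have "image_mset f (mset_set A) = image_mset f' (mset_set A)"
    by (rule multiset_eqI) (simp add: count_image_mset_eq_card_vimage[OF assms(1)] assms(2))
  from image_mset_eq_implies_permutes[OF assms(1) this] show thesis using that by metis
qed

lemma permutes_imageI:
  assumes "p permutes A" "B \<subseteq> A" "C \<subseteq> A" "\<And>x. x \<in> A \<Longrightarrow> x \<in> B \<longleftrightarrow> p x \<in> C"
  shows "p ` B = C"
proof
  show "p ` B \<subseteq> C" using assms by auto
  show "C \<subseteq> p ` B"
  proof
    fix y assume y: "y \<in> C"
    then have "y \<in> p ` A" using assms(3) unfolding permutes_image[OF assms(1)] by (rule set_mp[rotated])
    then obtain x where "x \<in> A" "y = p x" by (rule imageE) simp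
    then show "y \<in> p ` B" using assms(4)[of x] y by auto
  qed
qed

lemma ex_permutes_image:
  assumes "finite A" "B \<subseteq> A" "C \<subseteq> A" "card B = card C"
  shows "\<exists>h. h permutes A \<and> h ` B = C"
proof -
  have fin: "finite B" "finite C" using assms finite_subset by auto
  have "card {x \<in> A. (x \<in> B) = c} = card {x \<in> A. (x \<in> C) = c}" for c
  proof (cases c)
    case True
    have "{x \<in> A. (x \<in> B) = c} = B" "{x \<in> A. (x \<in> C) = c} = C" using True assms by auto
    then show ?thesis using assms by simp
  next
    case False
    have "{x \<in> A. (x \<in> B) = c} = A - B" "{x \<in> A. (x \<in> C) = c} = A - C" using False by auto
    then show ?thesis using assms fin by (simp add: card_Diff_subset)
  qed
  then obtain p where p: "p permutes A" "\<And>x. x \<in> A \<Longrightarrow> (x \<in> B) = (p x \<in> C)"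
    using colouring_permutes[OF assms(1), of "\<lambda>x. x \<in> B" "\<lambda>x. x \<in> C"] by blast
  then show ?thesis using permutes_imageI[OF p(1) assms(2,3)] by blast
qed

text \<open>A chosen enumeration of \<open>B\<close>, that is, an ordering of the factors in the
  wedge product belonging to \<open>B\<close>. It is extended to a permutation of
  \<open>{..<n}\<close> so that it can be inverted and composed as a permutation.\<close>

definition frame :: "nat \<Rightarrow> nat set \<Rightarrow> nat \<Rightarrow> nat"
  where "frame n B = (SOME h. h permutes {..<n} \<and> h ` {..<card B} = B)"

lemma frame:
  assumes "B \<subseteq> {..<n}"
  shows "frame n B permutes {..<n}" "frame n B ` {..<card B} = B"
proof -
  have "card B \<le> n" using card_mono[of "{..<n}" B] assms by simp
  then have "\<exists>h. h permutes {..<n} \<and> h ` {..<card B} = B"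
    using assms by (intro ex_permutes_image) auto
  from someI_ex[OF this] show "frame n B permutes {..<n}" "frame n B ` {..<card B} = B"
    unfolding frame_def by auto
qed

text \<open>The sign of \<open>p\<close> as a map from \<open>B\<close> to \<open>p ` B\<close>, relative to the chosen frames.\<close>

definition frame_sign :: "nat \<Rightarrow> (nat \<Rightarrow> nat) \<Rightarrow> nat set \<Rightarrow> int"
  where "frame_sign n p B = sign_on {..<card B} (inv' (frame n (p ` B)) \<circ> p \<circ> frame n B)"

lemma card_image_permutes: "p permutes A \<Longrightarrow> card (p ` B) = card B"
  by (rule card_image) (rule permutes_inj_on)

lemma image_permutes_subset: "p permutes A \<Longrightarrow> B \<subseteq> A \<Longrightarrow> p ` B \<subseteq> A"
  using permutes_in_image[of p A] by blast

lemma frame_bij: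
  assumes p: "p permutes {..<n}" and B: "B \<subseteq> {..<n}"
  shows "bij_betw (inv' (frame n (p ` B)) \<circ> p \<circ> frame n B) {..<card B} {..<card B}"
proof -
  have pB: "p ` B \<subseteq> {..<n}" using p B by (rule image_permutes_subset)
  note f = frame[OF B] and g = frame[OF pB]
  let ?h = "inv' (frame n (p ` B)) \<circ> p \<circ> frame n B"
  have "?h permutes {..<n}"
    by (intro permutes_compose f(1) p permutes_inv g(1))
  then have inj: "inj_on ?h {..<card B}"
    by (rule permutes_inj_on)
  have "?h ` {..<card B} = inv' (frame n (p ` B)) ` p ` B"
    by (simp only: image_comp[symmetric] f(2))
  also have "\<dots> = inv' (frame n (p ` B)) ` frame n (p ` B) ` {..<card (p ` B)}"
    by (simp only: g(2))
  also have "\<dots> = {..<card B}"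
    using permutes_inv_o(2)[OF g(1)] by (simp only: card_image_permutes[OF p] image_comp image_id id_apply)
  finally show ?thesis using inj by (simp add: bij_betw_def)
qed

text \<open>The frame of the intermediate set cancels; this is the multiplicativity of the exterior
  power on wedge products of basis vectors.\<close>

lemma frame_sign_compose:
  assumes p: "p permutes {..<n}" and q: "q permutes {..<n}" and B: "B \<subseteq> {..<n}"
  shows "frame_sign n (p \<circ> q) B = frame_sign n p (q ` B) * frame_sign n q B"
proof -
  have qB: "q ` B \<subseteq> {..<n}" using q B by (rule image_permutes_subset)
  have c: "card (q ` B) = card B" using q by (rule card_image_permutes)
  have eq: "inv' (frame n ((p \<circ> q) ` B)) \<circ> (p \<circ> q) \<circ> frame n B =
      (inv' (frame n (p ` q ` B)) \<circ> p \<circ> frame n (q ` B)) \<circ> (inv' (frame n (q ` B)) \<circ> q \<circ> frame n B)"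
    using permutes_inverses(1)[OF frame(1)[OF qB]] by (auto simp: fun_eq_iff image_comp)
  have "frame_sign n (p \<circ> q) B = sign_on {..<card B} (inv' (frame n (p ` q ` B)) \<circ> p \<circ> frame n (q ` B)) *
      sign_on {..<card B} (inv' (frame n (q ` B)) \<circ> q \<circ> frame n B)"
    unfolding frame_sign_def eq
    by (rule sign_on_compose[OF frame_bij[OF p qB, unfolded c] frame_bij[OF q B]]) simp
  then show ?thesis
    unfolding frame_sign_def c .
qed

text \<open>On a stable set the frame acts by conjugation, which preserves the sign. Diagonal
  entries, and so the character, are therefore independent of the chosen frames.\<close>

lemma frame_sign_stab:
  assumes p: "p permutes {..<n}" and B: "B \<subseteq> {..<n}" and pB: "p ` B = B"
  shows "frame_sign n p B = sign_on B p"
proof -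
  let ?h = "frame n B"
  note f = frame[OF B]
  have pb: "bij_betw p B B" using pB permutes_inj_on[OF p] by (simp add: bij_betw_def)
  have finB: "finite B" using B finite_subset by blast
  have mem: "x < card B \<longleftrightarrow> ?h x \<in> B" for x
    using f permutes_inj[OF f(1)] by (metis inj_image_mem_iff lessThan_iff)
  have "restrict_id (inv' ?h \<circ> p \<circ> ?h) {..<card B} = inv' ?h \<circ> restrict_id p B \<circ> ?h"
    using mem permutes_inverses(2)[OF f(1)] by (auto simp: fun_eq_iff restrict_id_def)
  moreover have "sign (inv' ?h \<circ> restrict_id p B \<circ> ?h) = sign (restrict_id p B)"
  proof -
    have h: "permutation ?h" "permutation (inv' ?h)"
      using f(1) permutes_imp_permutation permutes_inv by blast+
    have r: "permutation (restrict_id p B)"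
      using permutes_restrict_id[OF pb] finB permutes_imp_permutation by blast
    have "sign (inv' ?h \<circ> restrict_id p B \<circ> ?h) = sign ?h * sign (restrict_id p B) * sign ?h"
      using h r by (simp add: sign_compose permutation_compose sign_inverse)
    then show ?thesis by (simp add: sign_def)
  qed
  ultimately show ?thesis
    unfolding frame_sign_def sign_on_def pB by simp
qed

text \<open>\<open>g\<close> sends the basis vector with index \<open>y\<close> to
  \<open>b g y\<close> times the one with index \<open>\<pi> g y\<close>; \<open>b_mult\<close> is
  the cocycle condition that makes this an action. Norm 1 makes the characters of stabilizers
  derived from it unitary.\<close>

locale monomial_action = group G for G (structure) +
  fixes n :: nat and \<pi> :: "'a \<Rightarrow> nat \<Rightarrow> nat" and b :: "'a \<Rightarrow> nat \<Rightarrow> complex"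
  assumes finG: "finite (carrier G)"
    and perm: "g \<in> carrier G \<Longrightarrow> \<pi> g permutes {..<n}"
    and \<pi>_mult: "g \<in> carrier G \<Longrightarrow> h \<in> carrier G \<Longrightarrow> \<pi> (g \<otimes> h) = \<pi> g \<circ> \<pi> h"
    and b_mult: "g \<in> carrier G \<Longrightarrow> h \<in> carrier G \<Longrightarrow> y < n \<Longrightarrow> b (g \<otimes> h) y = b g (\<pi> h y) * b h y"
    and b_norm: "g \<in> carrier G \<Longrightarrow> y < n \<Longrightarrow> norm (b g y) = 1"
begin

lemma pi_one_idem: "\<pi> \<one> \<circ> \<pi> \<one> = \<pi> \<one>"
  by (rule trans[OF \<pi>_mult[OF one_closed one_closed, symmetric]]) (rule arg_cong[where f=\<pi>], rule l_one, rule one_closed)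

lemma \<pi>_one: "\<pi> \<one> = id"
proof -
  have "\<pi> \<one> = inv' (\<pi> \<one>) \<circ> (\<pi> \<one> \<circ> \<pi> \<one>)"
    using permutes_inv_o(2)[OF perm[OF one_closed]] by (metis comp_assoc comp_id id_comp)
  then show ?thesis unfolding pi_one_idem using permutes_inv_o(2)[OF perm[OF one_closed]] by simp
qed

lemma b_one: "y < n \<Longrightarrow> b \<one> y = 1"
proof -
  assume y: "y < n"
  have 1: "b (\<one> \<otimes> \<one>) y = b \<one> (\<pi> \<one> y) * b \<one> y"
    using y by (rule b_mult[OF one_closed one_closed])
  have "b \<one> y = b \<one> y * b \<one> y"
    using 1 unfolding \<pi>_one by (simp only: l_one[OF one_closed] id_apply)
  moreover have "b \<one> y \<noteq> 0" using b_norm[OF one_closed y] by auto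
  ultimately show ?thesis by simp
qed

section \<open>Linear characters of stabilizers and the monomial characters of invariant
  families\<close>

definition stab :: "nat set \<Rightarrow> 'a set"
  where "stab B = {g \<in> carrier G. \<pi> g ` B = B}"

text \<open>The scalar by which an element of \<open>stab B\<close> acts on the wedge product of the
  basis vectors in \<open>B\<close>.\<close>

definition val :: "'a \<Rightarrow> nat set \<Rightarrow> complex"
  where "val g B = of_int (sign_on B (\<pi> g)) * (\<Prod>y\<in>B. b g y)"

definition invariant :: "nat set set \<Rightarrow> bool"
  where "invariant F \<longleftrightarrow> (\<forall>B\<in>F. B \<subseteq> {..<n}) \<and> (\<forall>g\<in>carrier G. \<forall>B\<in>F. \<pi> g ` B \<in> F)"

text \<open>The trace on the span of the wedge products indexed by \<open>F\<close>. Defining it by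
  this formula confines the frames to the proof of \<open>echar_rep\<close>.\<close>

definition echar :: "nat set set \<Rightarrow> 'a \<Rightarrow> complex"
  where "echar F = (\<lambda>g\<in>carrier G. \<Sum>B | B \<in> F \<and> \<pi> g ` B = B. val g B)"

lemma invariant_finite: "invariant F \<Longrightarrow> finite F"
  by (rule finite_subset[of _ "Pow {..<n}"]) (auto simp: invariant_def)

lemma image_\<pi>_mult: "g \<in> carrier G \<Longrightarrow> h \<in> carrier G \<Longrightarrow> \<pi> (g \<otimes> h) ` B = \<pi> g ` \<pi> h ` B"
  by (simp only: \<pi>_mult image_comp)

lemma image_\<pi>_inv: "g \<in> carrier G \<Longrightarrow> \<pi> (inv g) ` \<pi> g ` B = B"
  by (simp only: image_\<pi>_mult[symmetric] inv_closed l_inv \<pi>_one image_id id_apply)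

lemma stab_carrier: "g \<in> stab B \<Longrightarrow> g \<in> carrier G"
  by (simp add: stab_def)

lemma stab_bij:
  assumes "g \<in> stab B"
  shows "bij_betw (\<pi> g) B B"
  using assms permutes_inj_on[OF perm] by (simp add: stab_def bij_betw_def)

lemma stab_mult: "g \<in> stab B \<Longrightarrow> h \<in> stab B \<Longrightarrow> g \<otimes> h \<in> stab B"
  by (simp add: stab_def image_\<pi>_mult)

lemma stab_inv: "g \<in> stab B \<Longrightarrow> inv g \<in> stab B"
proof -
  assume g: "g \<in> stab B"
  then have gc: "g \<in> carrier G" and gB: "\<pi> g ` B = B" by (auto simp: stab_def)
  have "\<pi> (inv g) ` B = B" using image_\<pi>_inv[OF gc, of B] gB by simp
  then show ?thesis using gc by (simp add: stab_def)
qed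

lemma val_mult:
  assumes "g \<in> stab B" "h \<in> stab B" "B \<subseteq> {..<n}"
  shows "val (g \<otimes> h) B = val g B * val h B"
proof -
  have gh: "g \<in> carrier G" "h \<in> carrier G" using assms by (auto simp: stab_def)
  have finB: "finite B" using assms finite_subset by blast
  have "(\<Prod>y\<in>B. b (g \<otimes> h) y) = (\<Prod>y\<in>B. b g (\<pi> h y)) * (\<Prod>y\<in>B. b h y)"
    using assms(3) gh by (simp add: b_mult prod.distrib subset_iff)
  also have "(\<Prod>y\<in>B. b g (\<pi> h y)) = (\<Prod>y\<in>B. b g y)"
    by (rule prod.reindex_bij_betw[OF stab_bij[OF assms(2)]])
  finally show ?thesis
    using sign_on_compose[OF stab_bij[OF assms(1)] stab_bij[OF assms(2)] finB] gh
    by (simp add: val_def \<pi>_mult)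
qed

lemma val_norm:
  assumes "g \<in> stab B" "B \<subseteq> {..<n}"
  shows "val g B * cnj (val g B) = 1"
proof -
  have "norm (of_int (sign_on B (\<pi> g)) :: complex) = 1"
    by (simp add: sign_on_def sign_def)
  moreover have "norm (\<Prod>y\<in>B. b g y) = 1"
    unfolding prod_norm[symmetric] using assms b_norm
    by (intro prod.neutral) (auto simp: stab_def subset_iff)
  ultimately have "norm (val g B) = 1"
    by (simp add: val_def norm_mult)
  then show ?thesis by (simp flip: complex_norm_square)
qed

lemma echar_rep:
  assumes F: "invariant F"
  shows "\<exists>M. set_mset M \<subseteq> Irr G \<and> (\<forall>g\<in>carrier G. echar F g = (\<Sum>\<phi>\<in>#M. \<phi> g))"
proof -
  have Fsub: "B \<subseteq> {..<n}" if "B \<in> F" for B using F that by (auto simp: invariant_def)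
  have Finv: "\<pi> g ` B \<in> F" if "g \<in> carrier G" "B \<in> F" for g B using F that by (auto simp: invariant_def)
  have finF: "finite F" by (rule invariant_finite[OF F])
  \<comment> \<open>The matrix of \<open>g\<close> on the wedge products, with signs relative to the
    frames.\<close>
  define R where "R g A B = (if A = \<pi> g ` B then of_int (frame_sign n (\<pi> g) B) * (\<Prod>y\<in>B. b g y) else 0)"
    for g A B
  obtain \<rho> where \<rho>: "matrix_rep G (card F) \<rho>" "\<And>g. g \<in> carrier G \<Longrightarrow> mtr (\<rho> g) = (\<Sum>A\<in>F. R g A A)"
  proof (rule rep_of_indexed[OF is_group finF, of R])
    fix A B assume AB: "A \<in> F" "B \<in> F"
    have "frame_sign n id B = 1"
      using frame_sign_stab[of id n B] Fsub[OF AB(2)] by (simp add: permutes_id)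
    moreover have "(\<Prod>y\<in>B. b \<one> y) = 1"
      using Fsub[OF AB(2)] by (intro prod.neutral) (auto simp: b_one)
    ultimately show "R \<one> A B = (if A = B then 1 else 0)"
      by (simp add: R_def \<pi>_one)
  next
    fix g h A B assume gh: "g \<in> carrier G" "h \<in> carrier G" and AB: "A \<in> F" "B \<in> F"
    note B = Fsub[OF AB(2)]
    have hB: "\<pi> h ` B \<in> F" using Finv gh AB by blast
    have "(\<Sum>C\<in>F. R g A C * R h C B) = (\<Sum>C\<in>F. if C = \<pi> h ` B then R g A C * R h C B else 0)"
      by (intro sum.cong) (auto simp: R_def)
    also have "\<dots> = R g A (\<pi> h ` B) * R h (\<pi> h ` B) B"
      using hB finF by simp
    also have "\<dots> = R (g \<otimes> h) A B"
    proof -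
      have "(\<Prod>y\<in>B. b (g \<otimes> h) y) = (\<Prod>y\<in>B. b g (\<pi> h y)) * (\<Prod>y\<in>B. b h y)"
        using B gh by (simp add: b_mult prod.distrib subset_iff)
      also have "(\<Prod>y\<in>B. b g (\<pi> h y)) = (\<Prod>y\<in>\<pi> h ` B. b g y)"
        using permutes_inj[OF perm[OF gh(2)]] by (simp add: prod.reindex[OF permutes_inj_on[OF perm[OF gh(2)]]])
      finally show ?thesis
        using frame_sign_compose[OF perm[OF gh(1)] perm[OF gh(2)] B] gh
        by (simp add: R_def \<pi>_mult image_comp)
    qed
    finally show "R (g \<otimes> h) A B = (\<Sum>C\<in>F. R g A C * R h C B)" by simp
  qed (rule that)
  obtain M where M: "set_mset M \<subseteq> Irr G" "\<forall>g\<in>carrier G. mtr (\<rho> g) = (\<Sum>\<phi>\<in>#M. \<phi> g)"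
    using rep_decompose[OF is_group \<rho>(1)] by blast
  have "echar F g = mtr (\<rho> g)" if g: "g \<in> carrier G" for g
  proof -
    have "mtr (\<rho> g) = (\<Sum>A\<in>F. if \<pi> g ` A = A then val g A else 0)"
      unfolding \<rho>(2)[OF g]
    proof (rule sum.cong)
      fix A assume A: "A \<in> F"
      show "R g A A = (if \<pi> g ` A = A then val g A else 0)"
        using frame_sign_stab[OF perm[OF g] Fsub[OF A]] by (auto simp: R_def val_def)
    qed simp
    then show ?thesis
      using finF g by (simp add: echar_def sum.inter_filter)
  qed
  then show ?thesis using M by auto
qed

lemma echar_Un:
  assumes "invariant F" "invariant F'" "F \<inter> F' = {}" "g \<in> carrier G"
  shows "echar (F \<union> F') g = echar F g + echar F' g"
proof -
  let ?S = "\<lambda>F. {B. B \<in> F \<and> \<pi> g ` B = B}"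
  have fin: "finite (?S F)" "finite (?S F')"
    using invariant_finite[OF assms(1)] invariant_finite[OF assms(2)] by simp_all
  have disj: "?S F \<inter> ?S F' = {}" using assms(3) by blast
  have "?S (F \<union> F') = ?S F \<union> ?S F'" by blast
  then show ?thesis
    unfolding echar_def restrict_apply'[OF assms(4)]
    by (simp only: sum.union_disjoint[OF fin disj])
qed

lemma echar_one:
  assumes "invariant F"
  shows "echar F \<one> = of_nat (card F)"
proof -
  have "val \<one> B = 1" if "B \<in> F" for B
  proof -
    have "y < n" if "y \<in> B" for y using that \<open>B \<in> F\<close> assms by (auto simp: invariant_def)
    then show ?thesis by (simp add: val_def \<pi>_one b_one)
  qed
  then show ?thesis by (simp add: echar_def \<pi>_one)
qed

definition pairing :: "nat set \<Rightarrow> nat set \<Rightarrow> complex"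
  where "pairing B B' = (\<Sum>g\<in>stab B \<inter> stab B'. val g B * cnj (val g B'))"

text \<open>The Mackey formula before pairs are gathered into orbits: exchanging the sums leaves,
  for each pair of sets, the linear characters of the two stabilizers compared on their
  intersection.\<close>

lemma cinner_echar:
  assumes F: "invariant F" "invariant F'"
  shows "cinner G (echar F) (echar F') =
    (\<Sum>B\<in>F. \<Sum>B'\<in>F'. pairing B B') / of_nat (card (carrier G))"
proof -
  have fin: "finite F" "finite F'" using F invariant_finite by auto
  have "(\<Sum>g\<in>carrier G. echar F g * cnj (echar F' g)) =
     (\<Sum>g\<in>carrier G. \<Sum>B\<in>F. \<Sum>B'\<in>F'. if g \<in> stab B \<inter> stab B' then val g B * cnj (val g B') else 0)"
  proof (rule sum.cong)
    fix g assume g: "g \<in> carrier G"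
    have e: "echar F g = (\<Sum>B\<in>F. if g \<in> stab B then val g B else 0)" if "finite F" for F
      using that g by (simp add: echar_def stab_def sum.inter_filter)
    show "echar F g * cnj (echar F' g) =
      (\<Sum>B\<in>F. \<Sum>B'\<in>F'. if g \<in> stab B \<inter> stab B' then val g B * cnj (val g B') else 0)"
      unfolding e[OF fin(1)] e[OF fin(2)] cnj_sum sum_product
      by (intro sum.cong refl) auto
  qed simp
  also have "\<dots> = (\<Sum>B\<in>F. \<Sum>B'\<in>F'. \<Sum>g\<in>carrier G. if g \<in> stab B \<inter> stab B' then val g B * cnj (val g B') else 0)"
    by (subst sum.swap, subst (2) sum.swap) (rule refl)
  also have "\<dots> = (\<Sum>B\<in>F. \<Sum>B'\<in>F'. pairing B B')"
  proof (intro sum.cong refl)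
    fix B B'
    have "{g \<in> carrier G. g \<in> stab B \<inter> stab B'} = stab B \<inter> stab B'" by (auto simp: stab_def)
    then show "(\<Sum>g\<in>carrier G. if g \<in> stab B \<inter> stab B' then val g B * cnj (val g B') else 0) = pairing B B'"
      using finG by (simp add: pairing_def flip: sum.inter_filter)
  qed
  finally show ?thesis by (simp add: cinner_def)
qed

text \<open>The summand is a linear character of the common stabilizer.\<close>

lemma pairing_zero:
  assumes B: "B \<subseteq> {..<n}" "B' \<subseteq> {..<n}" and h: "h \<in> stab B" "h \<in> stab B'"
    and ne: "val h B * cnj (val h B') \<noteq> 1"
  shows "pairing B B' = 0"
proof -
  have hc: "h \<in> carrier G" using h by (simp add: stab_def)
  have "(\<Sum>g\<in>stab B \<inter> stab B'. val (h \<otimes> g) B * cnj (val (h \<otimes> g) B')) = pairing B B'"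
    unfolding pairing_def
  proof (rule sum.reindex_bij_witness[of _ "\<lambda>g. inv h \<otimes> g" "\<lambda>g. h \<otimes> g"])
    fix g assume g: "g \<in> stab B \<inter> stab B'"
    then have gc: "g \<in> carrier G" by (auto dest: stab_carrier)
    show "inv h \<otimes> (h \<otimes> g) = g" "h \<otimes> (inv h \<otimes> g) = g"
      using hc gc by (simp_all add: m_assoc[symmetric])
    show "h \<otimes> g \<in> stab B \<inter> stab B'" "inv h \<otimes> g \<in> stab B \<inter> stab B'"
      using g h by (simp_all add: stab_mult stab_inv)
  qed (rule refl)
  moreover have "(\<Sum>g\<in>stab B \<inter> stab B'. val (h \<otimes> g) B * cnj (val (h \<otimes> g) B')) =
      (val h B * cnj (val h B')) * pairing B B'"
    unfolding pairing_def sum_distrib_left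
    using h B by (intro sum.cong) (auto simp: val_mult)
  ultimately show ?thesis using ne by (metis mult_cancel_right2)
qed

lemma pairing_self: "B \<subseteq> {..<n} \<Longrightarrow> pairing B B = of_nat (card (stab B))"
  by (simp add: pairing_def val_norm)

text \<open>The group is partitioned by where it sends the base pair. Each class is a coset of the
  common stabilizer of the image pair, so these stabilizer sizes add up to the group order.\<close>

lemma sum_stab_transitive:
  assumes Y: "finite Y" "(B0, B0') \<in> Y"
    and inv: "\<And>g B B'. g \<in> carrier G \<Longrightarrow> (B, B') \<in> Y \<Longrightarrow> (\<pi> g ` B, \<pi> g ` B') \<in> Y"
    and trans: "\<And>B B'. (B, B') \<in> Y \<Longrightarrow> \<exists>g\<in>carrier G. \<pi> g ` B0 = B \<and> \<pi> g ` B0' = B'"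
  shows "(\<Sum>(B, B')\<in>Y. card (stab B \<inter> stab B')) = card (carrier G)"
proof -
  define tr where "tr B B' = {g \<in> carrier G. \<pi> g ` B0 = B \<and> \<pi> g ` B0' = B'}" for B B'
  have "card (stab B \<inter> stab B') = card (tr B B')" if Y': "(B, B') \<in> Y" for B B'
  proof -
    obtain h where h: "h \<in> carrier G" "\<pi> h ` B0 = B" "\<pi> h ` B0' = B'"
      using trans[OF Y'] by blast
    have hinv: "\<pi> (inv h) ` B = B0" "\<pi> (inv h) ` B' = B0'"
      using h(1) unfolding h(2)[symmetric] h(3)[symmetric] by (simp_all only: image_\<pi>_inv)
    have "bij_betw (\<lambda>g. g \<otimes> h) (stab B \<inter> stab B') (tr B B')"
    proof (rule bij_betw_byWitness[of _ "\<lambda>g. g \<otimes> inv h"])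
      show "\<forall>a\<in>stab B \<inter> stab B'. a \<otimes> h \<otimes> inv h = a"
        using h by (auto simp: stab_def m_assoc)
      show "\<forall>a'\<in>tr B B'. a' \<otimes> inv h \<otimes> h = a'"
        using h by (auto simp: tr_def m_assoc)
      show "(\<lambda>g. g \<otimes> h) ` (stab B \<inter> stab B') \<subseteq> tr B B'"
      proof
        fix x assume "x \<in> (\<lambda>g. g \<otimes> h) ` (stab B \<inter> stab B')"
        then obtain g where g: "g \<in> stab B" "g \<in> stab B'" "x = g \<otimes> h" by auto
        then show "x \<in> tr B B'"
          using h unfolding tr_def g(3) by (simp add: image_\<pi>_mult stab_def)
      qed
      show "(\<lambda>g. g \<otimes> inv h) ` tr B B' \<subseteq> stab B \<inter> stab B'"
      proof
        fix x assume "x \<in> (\<lambda>g. g \<otimes> inv h) ` tr B B'"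
        then obtain g where g: "g \<in> tr B B'" "x = g \<otimes> inv h" by auto
        then show "x \<in> stab B \<inter> stab B'"
          using h(1) hinv unfolding g(2) by (simp add: image_\<pi>_mult stab_def tr_def)
      qed
    qed
    then show ?thesis by (rule bij_betw_same_card)
  qed
  then have "(\<Sum>(B, B')\<in>Y. card (stab B \<inter> stab B')) = (\<Sum>(B, B')\<in>Y. card (tr B B'))"
    by (intro sum.cong) auto
  also have "\<dots> = card (\<Union>(B, B')\<in>Y. tr B B')"
    using Y finG by (subst card_UN_disjoint) (auto simp: tr_def case_prod_unfold)
  also have "(\<Union>(B, B')\<in>Y. tr B B') = carrier G"
    using inv[OF _ Y(2)] by (auto simp: tr_def)
  finally show ?thesis .
qed

end

section \<open>Hook characters of symmetric groups\<close>

text \<open>Points start at 0, unlike in \<open>sym_group\<close>, so that they can be read as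
  strings of ternary digits; \<open>sym_group_iso\<close> performs the shift.\<close>

definition symg :: "nat \<Rightarrow> (nat \<Rightarrow> nat) monoid"
  where "symg n = (sym_group n)\<lparr>carrier := {p. p permutes {..<n}}\<rparr>"

lemma symg_simps:
  "g \<in> carrier (symg n) \<longleftrightarrow> g permutes {..<n}"
  "g \<otimes>\<^bsub>symg n\<^esub> h = g \<circ> h" "\<one>\<^bsub>symg n\<^esub> = id"
  by (simp_all add: symg_def sym_group_def)

lemma symg_group: "group (symg n)"
proof (rule groupI)
  fix g assume "g \<in> carrier (symg n)"
  then show "\<exists>h\<in>carrier (symg n). h \<otimes>\<^bsub>symg n\<^esub> g = \<one>\<^bsub>symg n\<^esub>"
    by (intro bexI[of _ "inv' g"]) (auto simp: symg_simps permutes_inv permutes_inv_o)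
qed (auto simp: symg_simps permutes_compose comp_assoc permutes_id)

lemma symg_inv: "g permutes {..<n} \<Longrightarrow> inv\<^bsub>symg n\<^esub> g = inv' g"
proof -
  assume g: "g permutes {..<n}"
  interpret group "symg n" by (rule symg_group)
  show ?thesis
    by (rule inv_equality) (use g in \<open>simp_all add: symg_simps permutes_inv permutes_inv_o\<close>)
qed

lemma symg_finite: "finite (carrier (symg n))"
  by (simp add: symg_def finite_permutations)

lemma card_symg: "card (carrier (symg n)) = fact n"
  by (simp add: symg_def card_permutations)

section \<open>Exterior powers of the permutation module and their Gram matrix\<close>

definition subsets :: "nat \<Rightarrow> nat \<Rightarrow> nat set set"
  where "subsets n j = {B. B \<subseteq> {..<n} \<and> card B = j}"

lemma finite_subsets: "finite (subsets n j)"
  by (rule finite_subset[of _ "Pow {..<n}"]) (auto simp: subsets_def)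

lemma card_subsets: "card (subsets n j) = n choose j"
  using n_subsets[of "{..<n}" j] by (simp add: subsets_def)

context
  fixes n :: nat
begin

interpretation S: monomial_action "symg n" n "\<lambda>g. g" "\<lambda>_ _. 1"
proof -
  interpret group "symg n" by (rule symg_group)
  show "monomial_action (symg n) n (\<lambda>g. g) (\<lambda>_ _. 1)"
    by unfold_locales (auto simp: symg_simps symg_finite)
qed

definition ext_sym :: "nat \<Rightarrow> (nat \<Rightarrow> nat) \<Rightarrow> complex"
  where "ext_sym j = S.echar (subsets n j)"

lemma ext_sym_apply:
  "g permutes {..<n} \<Longrightarrow> ext_sym j g = (\<Sum>B | B \<subseteq> {..<n} \<and> card B = j \<and> g ` B = B. of_int (sign_on B g))"
  by (simp add: ext_sym_def S.echar_def symg_simps S.val_def subsets_def conj_assoc)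

lemma subsets_invariant: "S.invariant (subsets n j)"
  unfolding S.invariant_def subsets_def
  by (simp add: symg_simps card_image_permutes image_permutes_subset)

text \<open>The transposition of \<open>x\<close> and \<open>y\<close> stabilizes both sets, with
  sign -1 on \<open>B\<close> and 1 on \<open>B'\<close>.\<close>

lemma pairing_sym_zero:
  assumes B: "B \<subseteq> {..<n}" "B' \<subseteq> {..<n}" and xy: "x \<noteq> y" "x \<in> B" "y \<in> B" "x \<notin> B'" "y \<notin> B'"
  shows "S.pairing B B' = 0" "S.pairing B' B = 0"
proof -
  let ?h = "Transposition.transpose x y"
  have p: "?h permutes {..<n}" using xy B by (intro permutes_swap_id) auto
  have hB: "?h ` B = B" using xy by (intro permutes_image permutes_swap_id) auto
  have fix': "?h z = z" if "z \<in> B'" for z using that xy by (auto simp: transpose_def)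
  have hB': "?h ` B' = B'" using fix' by auto
  have h: "?h \<in> S.stab B" "?h \<in> S.stab B'"
    using p hB hB' by (simp_all add: S.stab_def symg_simps)
  have vB: "S.val ?h B = -1"
    using sign_on_transpose[OF xy(2,3,1)] by (simp add: S.val_def)
  have "sign_on B' ?h = sign_on B' id"
    by (rule sign_on_cong) (simp_all add: fix')
  then have vB': "S.val ?h B' = 1" by (simp add: S.val_def)
  show "S.pairing B B' = 0" "S.pairing B' B = 0"
    by (rule S.pairing_zero[OF B h], simp add: vB vB', rule S.pairing_zero[OF B(2,1) h(2,1)], simp add: vB vB')
qed

text \<open>An element of both stabilizers fixes the at most one point of each difference, so both
  signs equal the sign on the intersection and the two linear characters agree.\<close>

lemma pairing_sym_one:
  assumes B: "B \<subseteq> {..<n}" "B' \<subseteq> {..<n}" and c: "card (B - B') \<le> 1" "card (B' - B) \<le> 1"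
  shows "S.pairing B B' = of_nat (card (S.stab B \<inter> S.stab B'))"
proof -
  have sgn: "sign_on A g = sign_on (A \<inter> A') g"
    if g: "g permutes {..<n}" and A: "A \<subseteq> {..<n}" "card (A - A') \<le> 1" "g ` A = A" "g ` A' = A'" for g A A'
  proof -
    have "finite (A - A')" by (rule finite_Diff[OF finite_subset[OF A(1)]]) simp
    have inj: "inj g" using g by (rule permutes_inj)
    have "g ` (A - A') = A - A'" using A inj by (simp add: image_set_diff)
    then have fix': "g x = x" if "x \<in> A - A'" for x
      using that A(2) \<open>finite (A - A')\<close> by (metis card_le_Suc0_iff_eq image_eqI One_nat_def)
    have "restrict_id g A = restrict_id g (A \<inter> A')"
      using fix' by (auto simp: restrict_id_def fun_eq_iff)
    then show ?thesis by (simp add: sign_on_def)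
  qed
  have "S.val g B * cnj (S.val g B') = 1" if "g \<in> S.stab B \<inter> S.stab B'" for g
  proof -
    have g: "g permutes {..<n}" "g ` B = B" "g ` B' = B'"
      using that by (auto simp: S.stab_def symg_simps)
    have "sign_on B g = sign_on B' g"
      using sgn[OF g(1) B(1) c(1) g(2,3)] sgn[OF g(1) B(2) c(2) g(3,2)] by (simp add: Int_commute)
    then show ?thesis
      by (simp add: S.val_def sign_on_def flip: of_int_mult)
  qed
  then show ?thesis by (simp add: S.pairing_def)
qed

text \<open>The orbits of the symmetric group on pairs of subsets are distinguished by these three
  cardinalities.\<close>

definition pairs :: "nat \<Rightarrow> nat \<Rightarrow> nat \<Rightarrow> (nat set \<times> nat set) set"
  where "pairs a b c = {(B, B'). B \<subseteq> {..<n} \<and> B' \<subseteq> {..<n} \<and>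
    card (B \<inter> B') = a \<and> card (B - B') = b \<and> card (B' - B) = c}"

text \<open>When nonempty, the set is a single orbit: a permutation matching the four regions cut
  out by two pairs carries one pair to the other.\<close>

lemma pairs_sum:
  "(\<Sum>(B, B')\<in>pairs a b c. card (S.stab B \<inter> S.stab B')) = (if a + b + c \<le> n then fact n else 0)"
proof -
  have union: "card (B \<union> B') = a + b + c" if "(B, B') \<in> pairs a b c" for B B'
  proof -
    have fin: "finite B" "finite B'" using that finite_subset by (auto simp: pairs_def)
    have "B \<union> B' = (B \<inter> B') \<union> (B - B') \<union> (B' - B)" by auto
    also have "card \<dots> = card (B \<inter> B') + card (B - B') + card (B' - B)"
      using fin by (subst card_Un_disjoint, auto)+
    finally show ?thesis using that by (simp add: pairs_def)
  qed
  show ?thesis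
  proof (cases "a + b + c \<le> n")
    case False
    have "pairs a b c = {}"
    proof (rule ccontr)
      assume "pairs a b c \<noteq> {}"
      then obtain B B' where BB: "(B, B') \<in> pairs a b c" by auto
      then have "B \<union> B' \<subseteq> {..<n}" by (auto simp: pairs_def)
      then have "card (B \<union> B') \<le> n" using card_mono[of "{..<n}" "B \<union> B'"] by simp
      then show False using union[OF BB] False by simp
    qed
    then show ?thesis using False by simp
  next
    case True
    define B0 where "B0 = {..<a + b}"
    define B0' where "B0' = {..<a} \<union> {a + b..<a + b + c}"
    have I: "B0 \<inter> B0' = {..<a}" "B0 - B0' = {a..<a + b}" "B0' - B0 = {a + b..<a + b + c}"
      by (auto simp: B0_def B0'_def)
    have "B0 \<subseteq> {..<n}" "B0' \<subseteq> {..<n}"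
      using True by (auto simp: B0_def B0'_def)
    then have Y0: "(B0, B0') \<in> pairs a b c"
      by (simp add: pairs_def I)
    have "(\<Sum>(B, B')\<in>pairs a b c. card (S.stab B \<inter> S.stab B')) = card (carrier (symg n))"
    proof (rule S.sum_stab_transitive[OF _ Y0])
      show "finite (pairs a b c)"
        by (rule finite_subset[of _ "Pow {..<n} \<times> Pow {..<n}"]) (auto simp: pairs_def)
    next
      fix g B B' assume g: "g \<in> carrier (symg n)" and Y: "(B, B') \<in> pairs a b c"
      then have gp: "g permutes {..<n}" by (simp add: symg_simps)
      have inj: "inj g" using gp by (rule permutes_inj)
      show "(g ` B, g ` B') \<in> pairs a b c"
        using Y gp image_permutes_subset[OF gp]
        by (simp add: pairs_def card_image_permutes[OF gp] flip: image_Int[OF inj] image_set_diff[OF inj])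
    next
      fix B B' assume Y: "(B, B') \<in> pairs a b c"
      have cards: "card {x \<in> {..<n}. (x \<in> A, x \<in> A') = uv} =
          (if uv = (True, True) then a else if uv = (True, False) then b
           else if uv = (False, True) then c else n - (a + b + c))" if A: "(A, A') \<in> pairs a b c" for A A' uv
      proof -
        have sub: "A \<subseteq> {..<n}" "A' \<subseteq> {..<n}" and ca: "card (A \<inter> A') = a" "card (A - A') = b" "card (A' - A) = c"
          using A by (auto simp: pairs_def)
        obtain u v where uv: "uv = (u, v)" by (cases uv)
        have "{x \<in> {..<n}. (x \<in> A, x \<in> A') = (u, v)} =
          (if u then if v then A \<inter> A' else A - A' else if v then A' - A else {..<n} - (A \<union> A'))"
          using sub by auto
        moreover have "card ({..<n} - (A \<union> A')) = n - (a + b + c)"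
          using union[OF A] sub by (subst card_Diff_subset) (auto intro: finite_subset)
        ultimately show ?thesis using ca uv by simp
      qed
      obtain p where p: "p permutes {..<n}" "\<And>x. x \<in> {..<n} \<Longrightarrow> (x \<in> B0, x \<in> B0') = (p x \<in> B, p x \<in> B')"
      proof (rule colouring_permutes[of "{..<n}" "\<lambda>x. (x \<in> B0, x \<in> B0')" "\<lambda>x. (x \<in> B, x \<in> B')"])
        show "card {x \<in> {..<n}. (x \<in> B0, x \<in> B0') = uv} = card {x \<in> {..<n}. (x \<in> B, x \<in> B') = uv}" for uv
          by (simp only: cards[OF Y0] cards[OF Y])
      qed (simp, rule that)
      have "p ` B0 = B"
        by (rule permutes_imageI[OF p(1)]) (use Y Y0 p(2) in \<open>auto simp: pairs_def\<close>)
      moreover have "p ` B0' = B'"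
        by (rule permutes_imageI[OF p(1)]) (use Y Y0 p(2) in \<open>auto simp: pairs_def\<close>)
      ultimately show "\<exists>g\<in>carrier (symg n). g ` B0 = B \<and> g ` B0' = B'"
        using p(1) by (auto simp: symg_simps)
    qed
    then show ?thesis using True by (simp add: card_symg)
  qed
qed

text \<open>Only the orbits \<open>pairs a b c\<close> with b and c at most 1, a + b = i and a + c =
  j survive, and each contributes 1. There are two for i = j > 0, one for i = j = 0 or neighbouring
  degrees, and none otherwise; the bounds on \<open>i\<close> and \<open>j\<close> guarantee a + b +
  c \<le> n. This is the Gram matrix of sums of neighbours in an orthonormal sequence.\<close>

lemma ext_sym_gram:
  assumes i: "i < n" and j: "j < n"
  shows "cinner (symg n) (ext_sym i) (ext_sym j) =
    (if i = j then if i = 0 then 1 else 2 else if i = Suc j \<or> j = Suc i then 1 else 0)"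
proof -
  define good where "good = {(B, B'). (B, B') \<in> subsets n i \<times> subsets n j \<and> card (B - B') \<le> 1 \<and> card (B' - B) \<le> 1}"
  have fin: "finite B" if "B \<in> subsets n m" for B m using that finite_subset by (auto simp: subsets_def)
  have "(\<Sum>B\<in>subsets n i. \<Sum>B'\<in>subsets n j. S.pairing B B') =
      (\<Sum>(B, B')\<in>subsets n i \<times> subsets n j. S.pairing B B')"
    by (simp add: sum.cartesian_product)
  also have "\<dots> = (\<Sum>(B, B')\<in>good. S.pairing B B')"
  proof (rule sum.mono_neutral_right)
    show "\<forall>BB\<in>subsets n i \<times> subsets n j - good. (case BB of (B, B') \<Rightarrow> S.pairing B B') = 0"
    proof safe
      fix B B' assume B: "B \<in> subsets n i" "B' \<in> subsets n j" and ng: "(B, B') \<notin> good"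
      have sub: "B \<subseteq> {..<n}" "B' \<subseteq> {..<n}" using B by (auto simp: subsets_def)
      have "\<not> card (B - B') \<le> Suc 0 \<or> \<not> card (B' - B) \<le> Suc 0" using ng B by (auto simp: good_def)
      then show "S.pairing B B' = 0"
      proof
        assume "\<not> card (B - B') \<le> Suc 0"
        then obtain x y where "x \<in> B - B'" "y \<in> B - B'" "x \<noteq> y"
          using fin[OF B(1)] card_le_Suc0_iff_eq[of "B - B'"] by auto
        then show ?thesis using pairing_sym_zero(1)[OF sub] by blast
      next
        assume "\<not> card (B' - B) \<le> Suc 0"
        then obtain x y where "x \<in> B' - B" "y \<in> B' - B" "x \<noteq> y"
          using fin[OF B(2)] card_le_Suc0_iff_eq[of "B' - B"] by auto
        then show ?thesis using pairing_sym_zero(2)[OF sub(2,1)] by blast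
      qed
    qed
  qed (auto simp: good_def finite_subsets)
  also have "\<dots> = of_nat (\<Sum>(B, B')\<in>good. card (S.stab B \<inter> S.stab B'))"
    unfolding of_nat_sum by (intro sum.cong) (auto simp: good_def subsets_def intro!: pairing_sym_one)
  finally have sum1: "cinner (symg n) (ext_sym i) (ext_sym j) =
      of_nat (\<Sum>(B, B')\<in>good. card (S.stab B \<inter> S.stab B')) / of_nat (fact n)"
    unfolding ext_sym_def S.cinner_echar[OF subsets_invariant subsets_invariant] card_symg by simp
  have mem: "(B, B') \<in> good \<longleftrightarrow>
      (\<exists>a b c. (B, B') \<in> pairs a b c \<and> b \<le> 1 \<and> c \<le> 1 \<and> a + b = i \<and> a + c = j)" for B B'
  proof -
    have "card B = card (B \<inter> B') + card (B - B')" "card B' = card (B \<inter> B') + card (B' - B)"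
      if "B \<subseteq> {..<n}" "B' \<subseteq> {..<n}"
      using that finite_subset[of B "{..<n}"] finite_subset[of B' "{..<n}"]
        card_Int_Diff[of B B'] card_Int_Diff[of B' B] by (simp_all add: Int_commute)
    then show ?thesis by (auto simp: good_def subsets_def pairs_def)
  qed
  have finp: "finite (pairs a b c)" for a b c
    by (rule finite_subset[of _ "Pow {..<n} \<times> Pow {..<n}"]) (auto simp: pairs_def)
  have disj: "pairs a b c \<inter> pairs a' b' c' = {}" if "(a, b, c) \<noteq> (a', b', c')" for a b c a' b' c'
    using that by (auto simp: pairs_def)
  consider "i = j" "i = 0" | m where "i = j" "i = Suc m" | "i = Suc j" | "j = Suc i"
    | "i \<noteq> j" "i \<noteq> Suc j" "j \<noteq> Suc i" by (cases i) auto
  then show ?thesis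
  proof cases
    case 1
    have "good = pairs 0 0 0"
      unfolding set_eq_iff split_paired_All mem using 1 by auto
    then show ?thesis unfolding sum1 using 1 by (simp add: pairs_sum)
  next
    case 2
    have "good = pairs i 0 0 \<union> pairs m 1 1"
    proof (unfold set_eq_iff split_paired_All mem, intro allI iffI)
      fix B B' assume "\<exists>a b c. (B, B') \<in> pairs a b c \<and> b \<le> 1 \<and> c \<le> 1 \<and> a + b = i \<and> a + c = j"
      then obtain a b c where "(B, B') \<in> pairs a b c" "b \<le> 1" "c \<le> 1" "a + b = i" "a + c = j" by blast
      moreover from this have "b = 0 \<and> c = 0 \<and> a = i \<or> b = 1 \<and> c = 1 \<and> a = m" using 2 by arith
      ultimately show "(B, B') \<in> pairs i 0 0 \<union> pairs m 1 1" by auto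
    next
      fix B B' assume "(B, B') \<in> pairs i 0 0 \<union> pairs m 1 1"
      then have "(B, B') \<in> pairs i 0 0 \<or> (B, B') \<in> pairs m 1 1" by simp
      then show "\<exists>a b c. (B, B') \<in> pairs a b c \<and> b \<le> 1 \<and> c \<le> 1 \<and> a + b = i \<and> a + c = j"
      proof
        assume "(B, B') \<in> pairs i 0 0" then show ?thesis using 2 by (intro exI[of _ i] exI[of _ 0]) simp
      next
        assume "(B, B') \<in> pairs m 1 1" then show ?thesis using 2 by (intro exI[of _ m] exI[of _ 1]) simp
      qed
    qed
    moreover have "pairs i 0 0 \<inter> pairs m 1 1 = {}" by (rule disj) simp
    ultimately have "(\<Sum>(B, B')\<in>good. card (S.stab B \<inter> S.stab B')) = fact n + fact n"
      using 2 i by (simp only: sum.union_disjoint[OF finp finp] pairs_sum) simp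
    then show ?thesis unfolding sum1 using 2 by simp
  next
    case 3
    have "good = pairs j 1 0"
    proof (unfold set_eq_iff split_paired_All mem, intro allI iffI)
      fix B B' assume "\<exists>a b c. (B, B') \<in> pairs a b c \<and> b \<le> 1 \<and> c \<le> 1 \<and> a + b = i \<and> a + c = j"
      then obtain a b c where "(B, B') \<in> pairs a b c" "b \<le> 1" "c \<le> 1" "a + b = i" "a + c = j" by blast
      moreover from this have "b = 1 \<and> c = 0 \<and> a = j" using 3 by arith
      ultimately show "(B, B') \<in> pairs j 1 0" by simp
    next
      fix B B' assume "(B, B') \<in> pairs j 1 0"
      then show "\<exists>a b c. (B, B') \<in> pairs a b c \<and> b \<le> 1 \<and> c \<le> 1 \<and> a + b = i \<and> a + c = j"
        using 3 by (intro exI[of _ j] exI[of _ 1] exI[of _ 0]) simp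
    qed
    then show ?thesis unfolding sum1 using 3 i by (simp add: pairs_sum)
  next
    case 4
    have "good = pairs i 0 1"
    proof (unfold set_eq_iff split_paired_All mem, intro allI iffI)
      fix B B' assume "\<exists>a b c. (B, B') \<in> pairs a b c \<and> b \<le> 1 \<and> c \<le> 1 \<and> a + b = i \<and> a + c = j"
      then obtain a b c where "(B, B') \<in> pairs a b c" "b \<le> 1" "c \<le> 1" "a + b = i" "a + c = j" by blast
      moreover from this have "b = 0 \<and> c = 1 \<and> a = i" using 4 by arith
      ultimately show "(B, B') \<in> pairs i 0 1" by simp
    next
      fix B B' assume "(B, B') \<in> pairs i 0 1"
      then show "\<exists>a b c. (B, B') \<in> pairs a b c \<and> b \<le> 1 \<and> c \<le> 1 \<and> a + b = i \<and> a + c = j"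
        using 4 by (intro exI[of _ i] exI[of _ 0] exI[of _ 1]) simp
    qed
    then show ?thesis unfolding sum1 using 4 j by (simp add: pairs_sum)
  next
    case 5
    have "good = {}"
    proof (rule ccontr)
      assume "good \<noteq> {}"
      then obtain B B' where "(B, B') \<in> good" by auto
      then obtain a b c where "b \<le> 1" "c \<le> 1" "a + b = i" "a + c = j" unfolding mem by blast
      then show False using 5 by arith
    qed
    then show ?thesis unfolding sum1 using 5 by simp
  qed
qed

text \<open>The character of the exterior power \<open>\<Lambda>\<^sup>j V\<close>, where \<open>\<complex>\<^sup>n = V \<oplus> 1\<close>.\<close>

fun hook :: "nat \<Rightarrow> (nat \<Rightarrow> nat) \<Rightarrow> complex"
  where
    "hook 0 = ext_sym 0"
  | "hook (Suc j) = (\<lambda>g\<in>carrier (symg n). ext_sym (Suc j) g - hook j g)"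

lemma cinner_hook_Suc: "cinner (symg n) (hook (Suc j)) f = cinner (symg n) (ext_sym (Suc j)) f - cinner (symg n) (hook j) f"
  by (subst cinner_diff_left[symmetric]) (rule cinner_cong, simp_all)

lemma cinner_hook_Suc': "cinner (symg n) f (hook (Suc j)) = cinner (symg n) f (ext_sym (Suc j)) - cinner (symg n) f (hook j)"
  by (subst cinner_diff_right[symmetric]) (rule cinner_cong, simp_all)

text \<open>Induction along the recursion telescopes the tridiagonal Gram matrix; for j > 0 it
  reflects that \<open>ext_sym j\<close> is the sum of \<open>hook j\<close> and
  \<open>hook (j - 1)\<close> on the group.\<close>

lemma cinner_hook_ext:
  assumes "i < n" "j < n"
  shows "cinner (symg n) (hook i) (ext_sym j) = (if j = i \<or> j = Suc i then 1 else 0)"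
  using assms(1)
proof (induction i)
  case 0
  then show ?case using assms(2) by (simp add: ext_sym_gram)
next
  case (Suc i)
  then show ?case using assms(2) by (simp only: cinner_hook_Suc ext_sym_gram) auto
qed

lemma hook_orthonormal:
  assumes "i < n" "j < n"
  shows "cinner (symg n) (hook i) (hook j) = (if i = j then 1 else 0)"
  using assms(2)
proof (induction j)
  case 0
  then show ?case using assms(1) by (auto simp: cinner_hook_ext)
next
  case (Suc j)
  then show ?case using assms(1) by (simp only: cinner_hook_Suc' cinner_hook_ext) auto
qed

text \<open>Pascal's rule matches the recursion of \<open>hook\<close>.\<close>

lemma hook_degree: "j < n \<Longrightarrow> hook j id = of_nat ((n - 1) choose j)"
proof (induction j)
  case 0
  have "hook 0 id = S.echar (subsets n 0) \<one>\<^bsub>symg n\<^esub>" by (simp add: ext_sym_def symg_simps)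
  then show ?case by (simp only: S.echar_one[OF subsets_invariant] card_subsets) simp
next
  case (Suc j)
  obtain m where m: "n = Suc m" using Suc by (cases n) auto
  have "ext_sym (Suc j) id = S.echar (subsets n (Suc j)) \<one>\<^bsub>symg n\<^esub>" by (simp add: ext_sym_def symg_simps)
  then have "ext_sym (Suc j) id = of_nat (n choose Suc j)"
    by (simp only: S.echar_one[OF subsets_invariant] card_subsets)
  moreover have "hook (Suc j) id = ext_sym (Suc j) id - hook j id"
    by (simp add: symg_simps)
  moreover have "n choose Suc j = ((n - 1) choose j) + ((n - 1) choose Suc j)"
    by (simp add: m)
  ultimately show ?case using Suc.IH Suc.prems by (simp only:) simp
qed

lemma hook_virtual:
  "\<exists>M M'. set_mset M \<subseteq> Irr (symg n) \<and> set_mset M' \<subseteq> Irr (symg n) \<and>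
    (\<forall>g\<in>carrier (symg n). hook j g = (\<Sum>\<phi>\<in>#M. \<phi> g) - (\<Sum>\<phi>\<in>#M'. \<phi> g))"
proof (induction j)
  case 0
  obtain M where "set_mset M \<subseteq> Irr (symg n)" "\<forall>g\<in>carrier (symg n). ext_sym 0 g = (\<Sum>\<phi>\<in>#M. \<phi> g)"
    using S.echar_rep[OF subsets_invariant, of 0] unfolding ext_sym_def by blast
  then show ?case by (intro exI[of _ M] exI[of _ "{#}"]) simp
next
  case (Suc j)
  obtain M where M: "set_mset M \<subseteq> Irr (symg n)" "\<forall>g\<in>carrier (symg n). ext_sym (Suc j) g = (\<Sum>\<phi>\<in>#M. \<phi> g)"
    using S.echar_rep[OF subsets_invariant, of "Suc j"] unfolding ext_sym_def by blast
  obtain N N' where N: "set_mset N \<subseteq> Irr (symg n)" "set_mset N' \<subseteq> Irr (symg n)"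
    "\<forall>g\<in>carrier (symg n). hook j g = (\<Sum>\<phi>\<in>#N. \<phi> g) - (\<Sum>\<phi>\<in>#N'. \<phi> g)"
    using Suc by blast
  show ?case
    by (intro exI[of _ "M + N'"] exI[of _ N]) (use M N in simp)
qed

theorem hook_irreducible:
  assumes "j < n"
  shows "hook j \<in> Irr (symg n)"
proof -
  obtain M M' where M: "set_mset M \<subseteq> Irr (symg n)" "set_mset M' \<subseteq> Irr (symg n)"
    "\<And>g. g \<in> carrier (symg n) \<Longrightarrow> hook j g = (\<Sum>\<phi>\<in>#M. \<phi> g) - (\<Sum>\<phi>\<in>#M'. \<phi> g)"
    using hook_virtual by blast
  show ?thesis
  proof (rule virtual_character_irreducible[OF symg_group symg_finite M])
    show "cinner (symg n) (hook j) (hook j) = 1"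
      using hook_orthonormal[OF assms assms] by simp
    show "0 < Re (hook j \<one>\<^bsub>symg n\<^esub>)"
      using assms by (simp add: symg_simps hook_degree)
    show "hook j g = undefined" if "g \<notin> carrier (symg n)" for g
      using that by (cases j) (simp_all add: ext_sym_def S.echar_def)
  qed
qed

lemma hook_inj: "inj_on hook {..<n}"
proof (rule inj_onI)
  fix i j assume ij: "i \<in> {..<n}" "j \<in> {..<n}" "hook i = hook j"
  then have "cinner (symg n) (hook i) (hook j) = 1"
    using hook_orthonormal[of i i] by simp
  then show "i = j" using hook_orthonormal[of i j] ij by (auto split: if_splits)
qed

end

text \<open>Absorption gives j * C(3^k, j) = 3^k * C(3^k - 1, j - 1), and 3^k cannot divide
  j.\<close>

lemma binomial_3_power:
  assumes "0 < j" "j < 3 ^ k"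
  shows "3 dvd ((3 :: nat) ^ k choose j)"
proof (rule ccontr)
  assume "\<not> 3 dvd ((3 :: nat) ^ k choose j)"
  then have cop: "coprime ((3 :: nat) ^ k choose j) (3 ^ k)"
    by (simp add: coprime_3_iff dvd_eq_mod_eq_0)
  obtain m where m: "j = Suc m" using assms by (cases j) auto
  have "j * ((3 :: nat) ^ k choose j) = 3 ^ k * ((3 ^ k - 1) choose m)"
    using binomial_absorption[of m "3 ^ k"] by (simp add: m)
  then have "(3 :: nat) ^ k dvd j * (3 ^ k choose j)" by simp
  then have "(3 :: nat) ^ k dvd j" using cop by (simp add: coprime_dvd_mult_left_iff coprime_commute)
  then show False using assms by (auto dest: dvd_imp_le)
qed

text \<open>By Pascal's rule two neighbouring binomials of 3^k - 1 add up to one of 3^k, hence to 0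
  modulo 3, so being nonzero modulo 3 passes from each to the next.\<close>

lemma hook_degree_coprime:
  assumes "j < 3 ^ k"
  shows "coprime (((3 :: nat) ^ k - 1) choose j) 3"
  using assms
proof (induction j)
  case (Suc j)
  have "((3 :: nat) ^ k choose Suc j) = ((3 ^ k - 1) choose j) + ((3 ^ k - 1) choose Suc j)"
    by (metis binomial_Suc_Suc Suc_diff_1 zero_less_numeral zero_less_power)
  moreover have "3 dvd ((3 :: nat) ^ k choose Suc j)" using Suc by (intro binomial_3_power) auto
  moreover have "coprime (((3 :: nat) ^ k - 1) choose j) 3" using Suc by simp
  ultimately show ?case unfolding coprime_3_iff by presburger
qed simp

lemma hook_Irr_p':
  assumes "j < 3 ^ k"
  shows "hook (3 ^ k) j \<in> Irr_p' 3 (symg (3 ^ k))"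
  using hook_irreducible[OF assms] hook_degree[OF assms] hook_degree_coprime[OF assms]
  by (auto simp: Irr_p'_def symg_simps)

section \<open>Ternary digits\<close>

definition dg :: "nat \<Rightarrow> nat \<Rightarrow> nat"
  where "dg i x = (x div 3 ^ i) mod 3"

lemma dg_less [simp]: "dg i x < 3"
  by (simp add: dg_def)

lemma mod_3_Suc: "x mod 3 ^ Suc i = x mod 3 ^ i + 3 ^ i * dg i x"
  using mod_mult2_eq[of x "3 ^ i" 3] by (simp add: dg_def mult.commute)

lemma dg_small: "x < 3 ^ i \<Longrightarrow> dg i x = 0"
  by (simp add: dg_def)

lemma dg_eq_imp_mod_eq:
  assumes "\<And>l. l < i \<Longrightarrow> dg l x = dg l y"
  shows "x mod 3 ^ i = y mod 3 ^ i"
  using assms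
proof (induction i)
  case (Suc i)
  then show ?case by (simp only: mod_3_Suc)
qed simp

lemma mod_eq_imp_dg_eq:
  assumes "x mod 3 ^ Suc i = y mod 3 ^ Suc i"
  shows "dg i x = dg i y"
proof -
  have low: "x mod 3 ^ i = y mod 3 ^ i"
    using assms by (metis le_imp_power_dvd lessI less_imp_le mod_mod_cancel)
  have "(3::nat) ^ i \<noteq> 0" by simp
  with low show ?thesis
    using assms unfolding mod_3_Suc by simp
qed

lemma dg_eqI: "x < 3 ^ k \<Longrightarrow> y < 3 ^ k \<Longrightarrow> (\<And>i. i < k \<Longrightarrow> dg i x = dg i y) \<Longrightarrow> x = y"
  using dg_eq_imp_mod_eq[of k x y] by simp

fun undigits :: "nat \<Rightarrow> (nat \<Rightarrow> nat) \<Rightarrow> nat"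
  where
    "undigits 0 d = 0"
  | "undigits (Suc m) d = undigits m d + d m * 3 ^ m"

lemma undigits_less: "(\<And>i. i < m \<Longrightarrow> d i < 3) \<Longrightarrow> undigits m d < 3 ^ m"
proof (induction m)
  case (Suc m)
  have "undigits m d < 3 ^ m" using Suc by simp
  moreover have "d m * 3 ^ m \<le> 2 * 3 ^ m" using Suc.prems[of m] by (intro mult_right_mono) auto
  ultimately have "undigits m d + d m * 3 ^ m < 3 ^ m + 2 * 3 ^ m" by linarith
  then show ?case by simp
qed simp

lemma dg_add_high: "dg i (x + q * 3 ^ Suc i) = dg i x"
proof -
  have "x + q * 3 ^ Suc i = x + 3 ^ i * (3 * q)" by simp
  then have "(x + q * 3 ^ Suc i) div 3 ^ i = x div 3 ^ i + 3 * q"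
    by (simp only:) (subst div_mult_self2, simp_all)
  then show ?thesis by (simp add: dg_def)
qed

lemma dg_undigits: "(\<And>i. i < m \<Longrightarrow> d i < 3) \<Longrightarrow> i < m \<Longrightarrow> dg i (undigits m d) = d i"
proof (induction m)
  case (Suc m)
  have less: "undigits m d < 3 ^ m" using Suc.prems by (intro undigits_less) simp
  show ?case
  proof (cases "i = m")
    case True
    then show ?thesis using less Suc.prems(1)[of m] by (simp add: dg_def)
  next
    case False
    then have i: "i < m" using Suc.prems by simp
    then obtain q where q: "m = Suc i + q" by (metis less_iff_Suc_add add_Suc)
    have "undigits (Suc m) d = undigits m d + (d m * 3 ^ q) * 3 ^ Suc i"
      unfolding q by (simp add: power_add mult.assoc mult.commute)
    then have "dg i (undigits (Suc m) d) = dg i (undigits m d)" by (simp only: dg_add_high)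
    then show ?thesis using Suc i by simp
  qed
qed simp

lemma undigits_dg: "undigits m (\<lambda>i. dg i x) = x mod 3 ^ m"
  by (induction m) (simp_all only: undigits.simps mod_3_Suc, simp_all add: mult.commute)

lemma dg_power: "dg i (3 ^ i) = 1" "dg i (2 * 3 ^ i) = 2"
  by (simp_all add: dg_def)

lemma mod_3_affine:
  "(e * (y mod 3) + c) mod 3 = (e * y + c) mod (3::nat)"
  "((e mod 3) * y + c) mod 3 = (e * y + c) mod (3::nat)"
  by (metis mod_add_left_eq mod_mult_right_eq, metis mod_add_left_eq mod_mult_left_eq)

lemma mult_mod_3_cancel:
  fixes e a b c :: nat
  assumes "e = 1 \<or> e = 2" "(e * a + c) mod 3 = (e * b + c) mod 3" "a < 3" "b < 3"
  shows "a = b"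
  using assms(1)
proof
  assume "e = 1"
  then have "(a + c) mod 3 = (b + c) mod 3" using assms(2) by simp
  then show ?thesis using assms(3,4) by presburger
next
  assume "e = 2"
  then have "(2 * a + c) mod 3 = (2 * b + c) mod 3" using assms(2) by simp
  then show ?thesis using assms(3,4) by presburger
qed

text \<open>In a finite group the inverse of an element is one of its powers.\<close>

lemma (in group) finite_closed_subgroup:
  assumes fin: "finite (carrier G)" and H: "H \<subseteq> carrier G" "\<one> \<in> H"
    and cl: "\<And>g h. g \<in> H \<Longrightarrow> h \<in> H \<Longrightarrow> g \<otimes> h \<in> H"
  shows "subgroup H G"
proof (rule subgroupI)
  fix g assume g: "g \<in> H"
  then have gc: "g \<in> carrier G" using H by auto
  have pow: "g [^] (m::nat) \<in> H" for m
    by (induction m) (use H g cl in auto)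
  define N where "N = Coset.order G"
  have N: "N > 0" using fin by (simp add: N_def order_gt_0_iff_finite)
  have "inv g = g [^] (N - 1)"
  proof (rule inv_equality)
    have "g [^] (N - 1) \<otimes> g = g [^] (Suc (N - 1))" by simp
    also have "\<dots> = g [^] N" using N by (simp only: Suc_diff_1)
    finally show "g [^] (N - 1) \<otimes> g = \<one>" using pow_order_eq_1[OF gc] by (simp add: N_def)
  qed (use gc in auto)
  then show "inv g \<in> H" using pow by simp
qed (use H cl in auto)

section \<open>The normalizer of a Sylow 3-subgroup in coordinates\<close>

locale ternary =
  fixes k :: nat
  assumes k: "k > 0"
begin

text \<open>Points are the numbers below \<open>3\<^sup>k\<close>; the blocks of level \<open>i\<close> are the residue classes
  modulo \<open>3\<^sup>i\<close>. An element acts on the digit \<open>i\<close> of \<open>x\<close> by an affine map whose linear part depends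
  on \<open>i\<close> only and whose translation part depends on the block of \<open>x\<close>.\<close>

definition tri :: "(nat \<Rightarrow> nat) \<Rightarrow> (nat \<Rightarrow> nat) \<Rightarrow> (nat \<Rightarrow> nat \<Rightarrow> nat) \<Rightarrow> bool"
  where "tri g e c \<longleftrightarrow> g permutes {..<3 ^ k} \<and> (\<forall>i<k. e i = 1 \<or> e i = 2) \<and>
    (\<forall>i<k. \<forall>x<3 ^ k. dg i (g x) = (e i * dg i x + c i (x mod 3 ^ i)) mod 3)"

definition nor :: "(nat \<Rightarrow> nat) set"
  where "nor = {g. \<exists>e c. tri g e c}"

text \<open>The linear part at digit \<open>i\<close>: the points 0 and 3^i lie in the same block
  and differ by 1 in that digit, so the digits of their images differ by the linear part. The factor
  2 stands for -1 modulo 3.\<close>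

definition eps :: "(nat \<Rightarrow> nat) \<Rightarrow> nat \<Rightarrow> nat"
  where "eps g i = (dg i (g (3 ^ i)) + 2 * dg i (g 0)) mod 3"

text \<open>For r < 3^i, the translation part on the block with residue \<open>r\<close>, read at
  the point \<open>r\<close> itself, whose digit \<open>i\<close> is 0.\<close>

definition off :: "(nat \<Rightarrow> nat) \<Rightarrow> nat \<Rightarrow> nat \<Rightarrow> nat"
  where "off g i r = dg i (g r)"

text \<open>The kernel of the linear parts, which multiply modulo 3 under composition; this will be
  the Sylow subgroup.\<close>

definition syl :: "(nat \<Rightarrow> nat) set"
  where "syl = {g \<in> nor. \<forall>i<k. eps g i = 1}"

lemma pow_less: "i < k \<Longrightarrow> (3::nat) ^ i < 3 ^ k"
  by simp

lemma less_pow: "(r::nat) < 3 ^ i \<Longrightarrow> i \<le> k \<Longrightarrow> r < 3 ^ k"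
  using power_increasing[of i k "3::nat"] by linarith

lemma tri_eps: "tri g e c \<Longrightarrow> i < k \<Longrightarrow> eps g i = e i"
proof -
  assume t: "tri g e c" and i: "i < k"
  have 1: "dg i (g (3 ^ i)) = (e i + c i 0) mod 3"
    using t i pow_less[OF i] by (simp add: tri_def dg_power)
  have 2: "dg i (g 0) = c i 0 mod 3"
    using t i by (simp add: tri_def dg_def)
  have "e i = 1 \<or> e i = 2" using t i by (simp add: tri_def)
  moreover have "((d + c) mod 3 + 2 * (c mod 3)) mod 3 = d mod 3" for c d :: nat
  proof -
    have "((d + c) mod 3 + 2 * (c mod 3)) mod 3 = (2 * c + (d + c) mod 3) mod 3"
      by (subst add.commute) (rule mod_3_affine(1))
    also have "\<dots> = (d + 3 * c) mod 3" by (simp add: mod_add_right_eq)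
    finally show ?thesis by simp
  qed
  ultimately show ?thesis unfolding eps_def 1 2 by auto
qed

lemma tri_off: "tri g e c \<Longrightarrow> i < k \<Longrightarrow> r < 3 ^ i \<Longrightarrow> off g i r = c i r mod 3"
  using less_pow[of r i] by (simp add: tri_def off_def dg_small)

lemma norD:
  assumes "g \<in> nor"
  shows "g permutes {..<3 ^ k}"
    and "\<And>i. i < k \<Longrightarrow> eps g i = 1 \<or> eps g i = 2"
    and "\<And>i x. i < k \<Longrightarrow> x < 3 ^ k \<Longrightarrow> dg i (g x) = (eps g i * dg i x + off g i (x mod 3 ^ i)) mod 3"
proof -
  obtain e c where t: "tri g e c" using assms by (auto simp: nor_def)
  show "g permutes {..<3 ^ k}" using t by (simp add: tri_def)
  show "eps g i = 1 \<or> eps g i = 2" if "i < k" for i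
    using t that tri_eps[OF t that] by (simp add: tri_def)
  show "dg i (g x) = (eps g i * dg i x + off g i (x mod 3 ^ i)) mod 3" if "i < k" "x < 3 ^ k" for i x
    using t that tri_eps[OF t that(1)] tri_off[OF t that(1), of "x mod 3 ^ i"]
    by (simp add: tri_def mod_simps)
qed

lemma norI: "tri g e c \<Longrightarrow> g \<in> nor"
  by (auto simp: nor_def)

lemma sylI: "tri g e c \<Longrightarrow> (\<And>i. i < k \<Longrightarrow> e i = 1) \<Longrightarrow> g \<in> syl"
  by (simp add: syl_def norI tri_eps)

lemma nor_less: "g \<in> nor \<Longrightarrow> x < 3 ^ k \<Longrightarrow> g x < 3 ^ k"
  using permutes_in_image[OF norD(1)] by simp

text \<open>The block system is preserved: by induction on the level, equal residues give equal
  translation parts, and the linear part can be cancelled.\<close>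

lemma nor_mod_eq_iff:
  assumes g: "g \<in> nor" and x: "x < 3 ^ k" and y: "y < 3 ^ k" and i: "i \<le> k"
  shows "g x mod 3 ^ i = g y mod 3 ^ i \<longleftrightarrow> x mod 3 ^ i = y mod 3 ^ i"
  using i
proof (induction i)
  case (Suc i)
  then have i: "i < k" and IH: "g x mod 3 ^ i = g y mod 3 ^ i \<longleftrightarrow> x mod 3 ^ i = y mod 3 ^ i" by auto
  have split: "u mod 3 ^ Suc i = v mod 3 ^ Suc i \<longleftrightarrow> u mod 3 ^ i = v mod 3 ^ i \<and> dg i u = dg i v" for u v :: nat
  proof
    assume uv: "u mod 3 ^ Suc i = v mod 3 ^ Suc i"
    have "u mod 3 ^ i = v mod 3 ^ i"
      using uv by (metis le_imp_power_dvd lessI less_imp_le mod_mod_cancel)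
    then show "u mod 3 ^ i = v mod 3 ^ i \<and> dg i u = dg i v"
      using mod_eq_imp_dg_eq[OF uv] by simp
  qed (simp only: mod_3_Suc)
  have "dg i (g x) = dg i (g y) \<longleftrightarrow> dg i x = dg i y" if "x mod 3 ^ i = y mod 3 ^ i"
    unfolding norD(3)[OF g i x] norD(3)[OF g i y] that
    using mult_mod_3_cancel[OF norD(2)[OF g i] _ dg_less dg_less] by metis
  then show ?case unfolding split IH by blast
qed simp

lemma nor_mod: "g \<in> nor \<Longrightarrow> x < 3 ^ k \<Longrightarrow> i \<le> k \<Longrightarrow> g (x mod 3 ^ i) mod 3 ^ i = g x mod 3 ^ i"
  by (subst nor_mod_eq_iff) (auto intro: le_less_trans[OF mod_less_eq_dividend])

text \<open>Affine maps compose. The linear part is reduced modulo 3 because \<open>tri\<close>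
  demands the value 1 or 2, while any natural number may serve as translation part.\<close>

lemma nor_compose_tri:
  assumes g: "g \<in> nor" and h: "h \<in> nor"
  shows "tri (g \<circ> h) (\<lambda>i. (eps g i * eps h i) mod 3) (\<lambda>i r. eps g i * off h i r + off g i (h r mod 3 ^ i))"
  unfolding tri_def
proof (intro conjI allI impI)
  show "g \<circ> h permutes {..<3 ^ k}" using norD(1)[OF g] norD(1)[OF h] by (rule permutes_compose[rotated])
  show "(eps g i * eps h i) mod 3 = 1 \<or> (eps g i * eps h i) mod 3 = 2" if "i < k" for i
    using norD(2)[OF g that] norD(2)[OF h that] by auto
  fix i x assume i: "i < k" and x: "x < (3::nat) ^ k"
  have hx: "h x < 3 ^ k" using nor_less[OF h x] .
  have m: "h x mod 3 ^ i = h (x mod 3 ^ i) mod 3 ^ i" using nor_mod[OF h x] i by simp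
  have "dg i ((g \<circ> h) x) = (eps g i * ((eps h i * dg i x + off h i (x mod 3 ^ i)) mod 3) + off g i (h x mod 3 ^ i)) mod 3"
    by (simp only: comp_apply norD(3)[OF g i hx] norD(3)[OF h i x])
  also have "\<dots> = (eps g i * (eps h i * dg i x + off h i (x mod 3 ^ i)) + off g i (h x mod 3 ^ i)) mod 3"
    by (rule mod_3_affine)
  also have "\<dots> = (eps g i * eps h i * dg i x + (eps g i * off h i (x mod 3 ^ i) + off g i (h x mod 3 ^ i))) mod 3"
    by (simp add: algebra_simps)
  finally show "dg i ((g \<circ> h) x) = ((eps g i * eps h i) mod 3 * dg i x +
      (eps g i * off h i (x mod 3 ^ i) + off g i (h (x mod 3 ^ i) mod 3 ^ i))) mod 3"
    by (simp only: m mod_3_affine)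
qed

lemma eps_compose: "g \<in> nor \<Longrightarrow> h \<in> nor \<Longrightarrow> i < k \<Longrightarrow> eps (g \<circ> h) i = (eps g i * eps h i) mod 3"
  using tri_eps[OF nor_compose_tri] by blast

lemma off_compose:
  "g \<in> nor \<Longrightarrow> h \<in> nor \<Longrightarrow> i < k \<Longrightarrow> r < 3 ^ i \<Longrightarrow>
    off (g \<circ> h) i r = (eps g i * off h i r + off g i (h r mod 3 ^ i)) mod 3"
  using tri_off[OF nor_compose_tri] by blast

lemma id_tri: "tri id (\<lambda>_. 1) (\<lambda>_ _. 0)"
  by (simp add: tri_def permutes_id)

lemma nor_subgroup: "subgroup nor (symg (3 ^ k))"
proof -
  interpret group "symg (3 ^ k)" by (rule symg_group)
  show ?thesis
  proof (rule finite_closed_subgroup)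
    show "nor \<subseteq> carrier (symg (3 ^ k))" using norD(1) by (auto simp: symg_simps)
  qed (auto simp: symg_simps symg_finite intro: norI[OF id_tri] norI[OF nor_compose_tri])
qed

lemma syl_subgroup: "subgroup syl (symg (3 ^ k))"
proof -
  interpret group "symg (3 ^ k)" by (rule symg_group)
  show ?thesis
  proof (rule finite_closed_subgroup)
    show "syl \<subseteq> carrier (symg (3 ^ k))" using norD(1) by (auto simp: symg_simps syl_def)
    show "\<one>\<^bsub>symg (3 ^ k)\<^esub> \<in> syl" unfolding symg_simps by (rule sylI[OF id_tri]) simp
    show "g \<otimes>\<^bsub>symg (3 ^ k)\<^esub> h \<in> syl" if "g \<in> syl" "h \<in> syl" for g h
      unfolding symg_simps using that by (auto simp: syl_def eps_compose intro: norI[OF nor_compose_tri])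
  qed (simp add: symg_finite)
qed

lemma inv_nor: "g \<in> nor \<Longrightarrow> inv' g \<in> nor"
  using subgroup.m_inv_closed[OF nor_subgroup, of g] norD(1)[of g] by (simp add: symg_inv)

text \<open>Realizes freely prescribed linear and translation parts; it parametrizes
  \<open>syl\<close> and supplies the test elements in the character computations.\<close>

definition mk :: "(nat \<Rightarrow> nat) \<Rightarrow> (nat \<Rightarrow> nat \<Rightarrow> nat) \<Rightarrow> nat \<Rightarrow> nat"
  where "mk e c x = (if x < 3 ^ k then undigits k (\<lambda>i. (e i * dg i x + c i (x mod 3 ^ i)) mod 3) else x)"

lemma mk_tri:
  assumes e: "\<And>i. i < k \<Longrightarrow> e i = 1 \<or> e i = 2"
  shows "tri (mk e c) e c"
proof -
  have d: "dg i (mk e c x) = (e i * dg i x + c i (x mod 3 ^ i)) mod 3" if "i < k" "x < 3 ^ k" for i x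
    using that by (simp add: mk_def dg_undigits)
  have "inj_on (mk e c) {..<3 ^ k}"
  proof (rule inj_onI)
    fix x y assume xy: "x \<in> {..<3 ^ k}" "y \<in> {..<3 ^ k}" "mk e c x = mk e c y"
    have "i \<le> k \<Longrightarrow> x mod 3 ^ i = y mod 3 ^ i" for i
    proof (induction i)
      case (Suc i)
      then have i: "i < k" and IH: "x mod 3 ^ i = y mod 3 ^ i" by auto
      have "(e i * dg i x + c i (x mod 3 ^ i)) mod 3 = (e i * dg i y + c i (x mod 3 ^ i)) mod 3"
        using d[OF i, of x] d[OF i, of y] xy IH by simp
      then have "dg i x = dg i y" by (rule mult_mod_3_cancel[OF e[OF i] _ dg_less dg_less])
      then show ?case using IH by (simp only: mod_3_Suc)
    qed simp
    from this[of k] show "x = y" using xy by simp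
  qed
  then have "mk e c permutes {..<3 ^ k}"
    by (rule inj_imp_permutes) (auto simp: mk_def intro!: undigits_less)
  then show ?thesis using e d by (simp add: tri_def)
qed

text \<open>An element is determined by one translation modulo 3 for each of the 3^i blocks of each
  level i < k, and these can be chosen freely.\<close>

lemma card_syl: "card syl = 3 ^ (\<Sum>i<k. 3 ^ i)"
proof -
  define I where "I = Sigma {..<k} (\<lambda>i. {..<(3::nat) ^ i})"
  have finI: "finite I" by (simp add: I_def)
  define f where "f c = mk (\<lambda>_. 1) (\<lambda>i r. c (i, r))" for c
  have t: "tri (f c) (\<lambda>_. 1) (\<lambda>i r. c (i, r))" for c unfolding f_def by (rule mk_tri) simp
  have "bij_betw f (I \<rightarrow>\<^sub>E {..<3}) syl"
  proof (rule bij_betwI')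
    fix c c' :: "nat \<times> nat \<Rightarrow> nat"
    assume c: "c \<in> I \<rightarrow>\<^sub>E {..<3}" "c' \<in> I \<rightarrow>\<^sub>E {..<3}"
    show "(f c = f c') = (c = c')"
    proof
      assume eq: "f c = f c'"
      show "c = c'"
      proof (rule PiE_ext[OF c])
        fix p assume p: "p \<in> I"
        then obtain i r where ir: "p = (i, r)" "i < k" "r < 3 ^ i" by (auto simp: I_def)
        have "c p mod 3 = c' p mod 3"
          using tri_off[OF t ir(2,3), of c] tri_off[OF t ir(2,3), of c'] eq ir(1) by simp
        moreover have "c p < 3" "c' p < 3" using c p by auto
        ultimately show "c p = c' p" by simp
      qed
    qed simp
  next
    fix c show "f c \<in> syl" by (rule sylI[OF t]) simp
  next
    fix g assume g: "g \<in> syl"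
    then have gn: "g \<in> nor" and g1: "\<And>i. i < k \<Longrightarrow> eps g i = 1" by (auto simp: syl_def)
    define c where "c = restrict (\<lambda>(i, r). off g i r) I"
    have "g x = f c x" for x
    proof (cases "x < 3 ^ k")
      case True
      have "dg i (g x) = dg i (f c x)" if i: "i < k" for i
      proof -
        have "(i, x mod 3 ^ i) \<in> I" using i by (simp add: I_def)
        then show ?thesis
          using t[of c] i True norD(3)[OF gn i True] g1[OF i] by (simp add: tri_def c_def)
      qed
      moreover have "f c x < 3 ^ k" using nor_less[OF norI[OF t] True] .
      ultimately show ?thesis using dg_eqI[OF nor_less[OF gn True]] by blast
    next
      case False
      then show ?thesis using permutes_not_in[OF norD(1)[OF gn]] by (simp add: f_def mk_def)
    qed
    then have "g = f c" by (rule HOL.ext)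
    moreover have "c \<in> I \<rightarrow>\<^sub>E {..<3}" by (auto simp: c_def off_def I_def)
    ultimately show "\<exists>c\<in>I \<rightarrow>\<^sub>E {..<3}. g = f c" by blast
  qed
  then have "card syl = card (I \<rightarrow>\<^sub>E {..<3::nat})" by (rule bij_betw_same_card[symmetric])
  also have "\<dots> = 3 ^ card I" using finI by (simp add: card_PiE)
  also have "card I = (\<Sum>i<k. 3 ^ i)" by (simp add: I_def)
  finally show ?thesis .
qed

section \<open>A long cycle\<close>

definition cyc :: "nat \<Rightarrow> nat"
  where "cyc x = (if x < 3 ^ k then (x + 1) mod 3 ^ k else x)"

definition scl :: "nat \<Rightarrow> nat \<Rightarrow> nat"
  where "scl a x = (if x < 3 ^ k then (a * x) mod 3 ^ k else x)"

lemma dg_mod: "i < k \<Longrightarrow> dg i (x mod 3 ^ k) = dg i x"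
  by (rule mod_eq_imp_dg_eq, rule mod_mod_cancel, rule le_imp_power_dvd) simp

text \<open>Adding 1 carries into digit \<open>i\<close> exactly when all lower digits are 2, that
  is, when the residue is 3^i - 1; for i = 0 this is always the case. The wrap-around at 3^k only
  drops the carry out of the last digit.\<close>

lemma cyc_tri: "tri cyc (\<lambda>_. 1) (\<lambda>i r. if r = 3 ^ i - 1 then 1 else 0)"
  unfolding tri_def
proof (intro conjI allI impI)
  have "inj_on cyc {..<3 ^ k}"
    by (rule inj_onI) (auto simp: cyc_def mod_Suc split: if_splits)
  then show "cyc permutes {..<3 ^ k}"
    by (rule inj_imp_permutes) (auto simp: cyc_def)
  fix i x assume i: "i < k" and x: "x < (3::nat) ^ k"
  have "dg i (cyc x) = dg i (x + 1)" using x dg_mod[OF i] by (simp add: cyc_def)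
  also have "\<dots> = (dg i x + (if x mod 3 ^ i = 3 ^ i - 1 then 1 else 0)) mod 3"
  proof -
    have "Suc x div 3 ^ i = (if Suc (x mod 3 ^ i) = 3 ^ i then Suc (x div 3 ^ i) else x div 3 ^ i)"
      by (simp add: div_Suc mod_Suc)
    moreover have "Suc (x mod 3 ^ i) = 3 ^ i \<longleftrightarrow> x mod 3 ^ i = 3 ^ i - 1"
      by (metis Suc_diff_1 diff_Suc_1 zero_less_numeral zero_less_power)
    ultimately show ?thesis by (simp add: dg_def mod_simps)
  qed
  finally show "dg i (cyc x) = (1 * dg i x + (if x mod 3 ^ i = 3 ^ i - 1 then 1 else 0)) mod 3" by simp
qed simp

text \<open>Multiplication by \<open>a\<close> multiplies digit \<open>i\<close> by
  \<open>a\<close>, up to a carry from the lower digits, which depends on the block alone.\<close>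

lemma scl_tri:
  assumes a: "coprime a 3"
  shows "tri (scl a) (\<lambda>_. a mod 3) (\<lambda>i r. dg i (a * r))"
  unfolding tri_def
proof (intro conjI allI impI)
  have cop: "coprime a (3 ^ k)" using a by simp
  have "inj_on (scl a) {..<3 ^ k}"
  proof (rule inj_onI)
    fix x y assume xy: "x \<in> {..<3 ^ k}" "y \<in> {..<3 ^ k}" "scl a x = scl a y"
    then have "[a * x = a * y] (mod 3 ^ k)" by (simp add: scl_def cong_def)
    then have "[x = y] (mod 3 ^ k)" using cop cong_mult_lcancel_nat by blast
    then show "x = y" using xy by (simp add: cong_def)
  qed
  then show "scl a permutes {..<3 ^ k}"
    by (rule inj_imp_permutes) (auto simp: scl_def)
  show "a mod 3 = 1 \<or> a mod 3 = 2" using a unfolding coprime_3_iff by presburger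
  fix i x assume i: "i < k" and x: "x < (3::nat) ^ k"
  have "dg i (scl a x) = dg i (a * x)" using x dg_mod[OF i] by (simp add: scl_def)
  also have "a * x = a * (x mod 3 ^ i) + 3 ^ i * (a * (x div 3 ^ i))"
    by (metis add.commute distrib_left mult.left_commute mult_div_mod_eq)
  also have "dg i \<dots> = ((a * (x mod 3 ^ i)) div 3 ^ i + a * (x div 3 ^ i)) mod 3"
    unfolding dg_def by (subst div_mult_self2) (simp, subst add.commute, rule refl)
  also have "\<dots> = (a mod 3 * dg i x + dg i (a * (x mod 3 ^ i))) mod 3"
    unfolding dg_def by (simp only: mod_3_affine mod_add_right_eq) (simp only: add.commute)
  finally show "dg i (scl a x) = (a mod 3 * dg i x + dg i (a * (x mod 3 ^ i))) mod 3" .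
qed

lemma cyc_pow: "x < 3 ^ k \<Longrightarrow> (cyc ^^ m) x = (x + m) mod 3 ^ k"
  by (induction m) (simp_all add: cyc_def mod_simps)

lemma symg_pow: "g [^]\<^bsub>symg n\<^esub> (m::nat) = g ^^ m"
  by (induction m) (simp_all add: symg_simps nat_pow_def funpow_swap1 fun_eq_iff)

lemma cyc_order: "cyc ^^ (3 ^ k) = id"
proof
  fix x show "(cyc ^^ (3 ^ k)) x = id x"
  proof (cases "x < 3 ^ k")
    case False
    then have "(cyc ^^ m) x = x" for m by (induction m) (simp_all add: cyc_def)
    then show ?thesis by simp
  qed (simp add: cyc_pow)
qed

lemma scl_conj_cyc:
  assumes a: "coprime a 3"
  shows "scl a \<circ> cyc \<circ> inv' (scl a) = cyc ^^ a"
proof -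
  have p: "scl a permutes {..<3 ^ k}" using scl_tri[OF a] by (simp add: tri_def)
  have "scl a \<circ> cyc = (cyc ^^ a) \<circ> scl a"
  proof
    fix x
    show "(scl a \<circ> cyc) x = ((cyc ^^ a) \<circ> scl a) x"
    proof (cases "x < 3 ^ k")
      case True
      have "(scl a \<circ> cyc) x = (a * (x + 1)) mod 3 ^ k" using True by (simp add: scl_def cyc_def mod_mult_right_eq)
      also have "\<dots> = (a * x mod 3 ^ k + a) mod 3 ^ k" by (simp only: mod_add_left_eq distrib_left mult_1_right)
      also have "\<dots> = ((cyc ^^ a) \<circ> scl a) x" using True by (simp add: cyc_pow scl_def)
      finally show ?thesis .
    next
      case False
      have "(cyc ^^ m) x = x" for m using False by (induction m) (simp_all add: cyc_def)
      then show ?thesis using False by (simp add: scl_def cyc_def)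
    qed
  qed
  then have "scl a \<circ> cyc \<circ> inv' (scl a) = (cyc ^^ a) \<circ> (scl a \<circ> inv' (scl a))"
    by (simp only: comp_assoc)
  then show ?thesis using permutes_inv_o(1)[OF p] by simp
qed

text \<open>A permutation commuting with the long cycle is determined by its image of 0. The set
  \<open>K\<close> allows the bound to be used in both groups.\<close>

lemma centralizer_cyc:
  assumes "K \<subseteq> {g. g permutes {..<3 ^ k}}"
  shows "card {g \<in> K. g \<circ> cyc = cyc \<circ> g} \<le> 3 ^ k"
proof -
  let ?C = "{g \<in> K. g \<circ> cyc = cyc \<circ> g}"
  have comm: "g ((cyc ^^ m) x) = (cyc ^^ m) (g x)" if "g \<in> ?C" for g m x
  proof (induction m)
    case (Suc m)
    have "g \<circ> cyc = cyc \<circ> g" using that by simp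
    from fun_cong[OF this] have "g (cyc y) = cyc (g y)" for y by simp
    then show ?case using Suc by simp
  qed simp
  have "inj_on (\<lambda>g. g 0) ?C"
  proof (rule inj_onI)
    fix g h assume gh: "g \<in> ?C" "h \<in> ?C" "g 0 = h 0"
    show "g = h"
    proof
      fix x show "g x = h x"
      proof (cases "x < 3 ^ k")
        case True
        have x: "(cyc ^^ x) 0 = x" using True by (simp add: cyc_pow)
        show ?thesis using comm[OF gh(1), of x 0] comm[OF gh(2), of x 0] gh(3) by (simp add: x)
      next
        case False
        moreover have "g permutes {..<3 ^ k}" "h permutes {..<3 ^ k}" using gh assms by auto
        ultimately show ?thesis by (simp add: permutes_not_in)
      qed
    qed
  qed
  moreover have "(\<lambda>g. g 0) ` ?C \<subseteq> {..<3 ^ k}"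
  proof
    fix y assume "y \<in> (\<lambda>g. g 0) ` ?C"
    then obtain g where g: "g permutes {..<3 ^ k}" "y = g 0" using assms by auto
    then show "y \<in> {..<3 ^ k}" using permutes_in_image[OF g(1), of 0] by simp
  qed
  ultimately have "card ?C \<le> card {..<(3::nat) ^ k}" by (intro card_inj_on_le) auto
  then show ?thesis by simp
qed

end

section \<open>Principal minors of monomial matrices\<close>

text \<open>The coefficients are sums of principal minors, hence traces of exterior powers. When the
  factors of the Leibniz formula are expanded, \<open>B\<close> collects the columns contributing
  the term with \<open>t\<close>; a permutation survives only if it is \<open>p\<close> on
  \<open>B\<close> and the identity elsewhere.\<close>

lemma det_monomial:
  fixes a :: "nat \<Rightarrow> complex"
  assumes p: "p permutes {..<n}"
  shows "det (mat n n (\<lambda>(x, y). (if x = y then 1 else 0) + t * (if x = p y then a y else 0))) =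
    (\<Sum>B | B \<subseteq> {..<n} \<and> p ` B = B. t ^ card B * (of_int (sign_on B p) * (\<Prod>y\<in>B. a y)))"
proof -
  let ?A = "mat n n (\<lambda>(x, y). (if x = y then 1 else 0) + t * (if x = p y then a y else 0))"
  let ?Q = "{q. q permutes {..<n}}"
  define tm where "tm B q = of_int (sign q) * ((\<Prod>j\<in>B. t * (if q j = p j then a j else 0)) *
    (\<Prod>j\<in>{..<n} - B. if q j = j then 1 else 0))" for B q
  have finQ: "finite ?Q" by (simp add: finite_permutations)
  have "det ?A = (\<Sum>q\<in>?Q. of_int (sign q) * (\<Prod>j<n. ?A $$ (q j, j)))"
    by (subst det_col[of _ n]) (simp_all add: atLeast0LessThan)
  also have "\<dots> = (\<Sum>q\<in>?Q. \<Sum>B\<in>Pow {..<n}. tm B q)"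
  proof (rule sum.cong)
    fix q assume q: "q \<in> ?Q"
    have "(\<Prod>j<n. ?A $$ (q j, j)) = (\<Prod>j<n. t * (if q j = p j then a j else 0) + (if q j = j then 1 else 0))"
      using q permutes_in_image[of q "{..<n}"] by (intro prod.cong) (auto simp: add.commute)
    then show "of_int (sign q) * (\<Prod>j<n. ?A $$ (q j, j)) = (\<Sum>B\<in>Pow {..<n}. tm B q)"
      by (simp only: prod_add[OF finite_lessThan] sum_distrib_left tm_def)
  qed simp
  also have "\<dots> = (\<Sum>B\<in>Pow {..<n}. \<Sum>q\<in>?Q. tm B q)"
    by (rule sum.swap)
  also have "\<dots> = (\<Sum>B\<in>Pow {..<n}. if p ` B = B then t ^ card B * (of_int (sign_on B p) * (\<Prod>y\<in>B. a y)) else 0)"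
  proof (rule sum.cong)
    fix B assume "B \<in> Pow {..<n}"
    then have B: "B \<subseteq> {..<n}" and finB: "finite B" using finite_subset by auto
    have nz: "(\<forall>j\<in>B. q j = p j) \<and> (\<forall>j\<in>{..<n} - B. q j = j)" if "tm B q \<noteq> 0" for q
    proof (intro conjI ballI)
      fix j assume "j \<in> B"
      then show "q j = p j" using that finB by (auto simp: tm_def split: if_splits)
    next
      fix j assume "j \<in> {..<n} - B"
      then show "q j = j" using that by (auto simp: tm_def split: if_splits)
    qed
    show "(\<Sum>q\<in>?Q. tm B q) = (if p ` B = B then t ^ card B * (of_int (sign_on B p) * (\<Prod>y\<in>B. a y)) else 0)"
    proof (cases "p ` B = B")
      case True
      let ?r = "restrict_id p B"
      have r: "?r permutes B"
        using True permutes_inj_on[OF p] by (intro permutes_restrict_id) (simp add: bij_betw_def)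
      then have rQ: "?r \<in> ?Q" using B permutes_subset by blast
      have "tm B q = 0" if "q \<in> ?Q" "q \<noteq> ?r" for q
      proof (rule ccontr)
        assume "tm B q \<noteq> 0"
        from nz[OF this] have "q x = ?r x" for x
          using that(1) B by (cases "x < n") (auto simp: restrict_id_def permutes_not_in)
        then have "q = ?r" by (rule HOL.ext)
        with that show False by simp
      qed
      then have "(\<Sum>q\<in>?Q. tm B q) = (\<Sum>q\<in>?Q. if q = ?r then tm B ?r else 0)"
        by (intro sum.cong) auto
      also have "\<dots> = tm B ?r" using finQ rQ by simp
      also have "\<dots> = t ^ card B * (of_int (sign_on B p) * (\<Prod>y\<in>B. a y))"
        by (simp add: tm_def sign_on_def prod.distrib)
      finally show ?thesis using True by simp
    next
      case False
      have "tm B q = 0" if q: "q \<in> ?Q" for q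
      proof (rule ccontr)
        assume "tm B q \<noteq> 0"
        note e = nz[OF this]
        have "q ` B = B"
        proof -
          have "q ` ({..<n} - B) = {..<n} - B" using e by force
          moreover have "q ` ({..<n} - B) = q ` {..<n} - q ` B"
            using q permutes_inj by (intro image_set_diff) blast
          moreover have "q ` {..<n} = {..<n}" using q permutes_image by blast
          moreover have "q ` B \<subseteq> {..<n}" using q B image_permutes_subset by blast
          ultimately have "{..<n} - B = {..<n} - q ` B" by simp
          then show ?thesis using B \<open>q ` B \<subseteq> {..<n}\<close> by blast
        qed
        moreover have "q ` B = p ` B" using e by (intro image_cong) auto
        ultimately show False using False by simp
      qed
      then show ?thesis using False by simp
    qed
  qed simp
  also have "\<dots> = (\<Sum>B | B \<subseteq> {..<n} \<and> p ` B = B. t ^ card B * (of_int (sign_on B p) * (\<Prod>y\<in>B. a y)))"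
  proof -
    have "{B. B \<subseteq> {..<n} \<and> p ` B = B} = {B \<in> Pow {..<n}. p ` B = B}" by simp
    then show ?thesis by (simp only: sum.inter_filter[OF finite_Pow_iff[THEN iffD2, OF finite_lessThan]])
  qed
  finally show ?thesis .
qed

text \<open>Conjugate matrices A have the same polynomial det (1 + t A), and its coefficients are
  compared. This replaces a change of basis inside the exterior powers.\<close>

lemma monomial_minors_eq:
  fixes a a' :: "nat \<Rightarrow> complex"
  assumes p: "p permutes {..<n}" and p': "p' permutes {..<n}"
    and S: "S \<in> carrier_mat n n" "det S \<noteq> 0"
    and eq: "mat n n (\<lambda>(x, y). if x = p y then a y else 0) * S = S * mat n n (\<lambda>(x, y). if x = p' y then a' y else 0)"
  shows "(\<Sum>B | B \<subseteq> {..<n} \<and> card B = j \<and> p ` B = B. of_int (sign_on B p) * (\<Prod>y\<in>B. a y)) =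
    (\<Sum>B | B \<subseteq> {..<n} \<and> card B = j \<and> p' ` B = B. of_int (sign_on B p') * (\<Prod>y\<in>B. a' y))"
proof -
  define co where "co p a j = (\<Sum>B | B \<subseteq> {..<n} \<and> card B = j \<and> p ` B = B. of_int (sign_on B p) * (\<Prod>y\<in>B. a y))"
    for p and a :: "nat \<Rightarrow> complex" and j
  define D where "D p a t = mat n n (\<lambda>(x, y). (if x = y then 1 else 0) + t * (if x = p y then a y else 0))"
    for p and a :: "nat \<Rightarrow> complex" and t
  define F where "F p a = (\<Sum>j\<le>n. monom (co p a j) j)" for p a
  have coef: "poly (F p a) t = det (D p a t)" if "p permutes {..<n}" for p a t
  proof -
    let ?T = "{B. B \<subseteq> {..<n} \<and> p ` B = B}"
    have finT: "finite ?T" by (rule finite_subset[of _ "Pow {..<n}"]) auto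
    have cT: "card ` ?T \<subseteq> {..n}" using card_mono[of "{..<n}"] by auto
    have "det (D p a t) = (\<Sum>B\<in>?T. t ^ card B * (of_int (sign_on B p) * (\<Prod>y\<in>B. a y)))"
      unfolding D_def by (rule det_monomial[OF that])
    also have "\<dots> = (\<Sum>j\<le>n. \<Sum>B\<in>{B \<in> ?T. card B = j}. t ^ card B * (of_int (sign_on B p) * (\<Prod>y\<in>B. a y)))"
      by (rule sum.group[symmetric, OF finT _ cT]) simp
    also have "\<dots> = (\<Sum>j\<le>n. co p a j * t ^ j)"
    proof (rule sum.cong)
      fix j
      have "{B \<in> ?T. card B = j} = {B. B \<subseteq> {..<n} \<and> card B = j \<and> p ` B = B}" by auto
      then show "(\<Sum>B\<in>{B \<in> ?T. card B = j}. t ^ card B * (of_int (sign_on B p) * (\<Prod>y\<in>B. a y))) = co p a j * t ^ j"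
        by (simp add: co_def sum_distrib_left mult.commute)
    qed simp
    finally show ?thesis by (simp add: F_def poly_sum poly_monom)
  qed
  have "det (D p a t) = det (D p' a' t)" for t
  proof -
    have spl: "D p a t = 1\<^sub>m n + t \<cdot>\<^sub>m mat n n (\<lambda>(x, y). if x = p y then a y else 0)" for p and a :: "nat \<Rightarrow> complex"
      by (rule eq_matI) (auto simp: D_def)
    define A where "A = mat n n (\<lambda>(x, y). if x = p y then a y else 0)"
    define A' where "A' = mat n n (\<lambda>(x, y). if x = p' y then a' y else 0)"
    have A: "A \<in> carrier_mat n n" "A' \<in> carrier_mat n n" by (simp_all add: A_def A'_def)
    have "D p a t * S = S + t \<cdot>\<^sub>m (A * S)"
      unfolding spl A_def[symmetric] using S(1) A
      by (simp add: add_mult_distrib_mat[OF one_carrier_mat smult_carrier_mat[OF A(1)] S(1)] mult_smult_assoc_mat[of _ n n])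
    also have "A * S = S * A'" using eq by (simp add: A_def A'_def)
    also have "S + t \<cdot>\<^sub>m (S * A') = S * D p' a' t"
      unfolding spl A'_def[symmetric] using S(1) A
      by (simp add: mult_add_distrib_mat[OF S(1) one_carrier_mat smult_carrier_mat[OF A(2)]] mult_smult_distrib[of _ n n])
    finally have "D p a t * S = S * D p' a' t" .
    then have "det (D p a t) * det S = det S * det (D p' a' t)"
      using S(1) det_mult[of "D p a t" n S] det_mult[of S n "D p' a' t"] by (simp add: D_def)
    then show ?thesis using S(2) by simp
  qed
  then have "poly (F p a) = poly (F p' a')"
    by (simp add: fun_eq_iff coef[OF p] coef[OF p'])
  then have FF: "F p a = F p' a'" by (simp only: poly_eq_poly_eq_iff)
  have "co p a j = co p' a' j"
  proof (cases "j \<le> n")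
    case True
    have "coeff (F p a) j = co p a j" for p a
      using True by (simp add: F_def coeff_sum)
    then show ?thesis using FF by metis
  next
    case False
    then have "{B. B \<subseteq> {..<n} \<and> card B = j \<and> q ` B = B} = {}" for q
      using card_mono[of "{..<n}"] by fastforce
    then show ?thesis by (simp only: co_def sum.empty)
  qed
  then show ?thesis by (simp add: co_def)
qed

section \<open>A monomial basis\<close>

text \<open>A wave number y > 0 is read as a ternary numeral: its leading digit
  \<open>lead y\<close> stands at place \<open>lev y\<close> and names a nontrivial character of
  that digit, and the digits below it, \<open>rest y\<close>, name a block of that level. The number
  0, with level and lead 0, is the constant wave.\<close>

definition lev :: "nat \<Rightarrow> nat"
  where "lev y = (LEAST i. y < 3 ^ Suc i)"

definition lead :: "nat \<Rightarrow> nat"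
  where "lead y = y div 3 ^ lev y"

definition rest :: "nat \<Rightarrow> nat"
  where "rest y = y mod 3 ^ lev y"

lemma lev_upper: "y < 3 ^ Suc (lev y)"
proof -
  have "y < 3 ^ y" by (rule power_gt_expt) simp
  also have "(3::nat) ^ y < 3 ^ Suc y" by simp
  finally show ?thesis unfolding lev_def by (rule LeastI[of "\<lambda>i. y < 3 ^ Suc i"])
qed

lemma lead_rest: "y = lead y * 3 ^ lev y + rest y"
  unfolding lead_def rest_def by (rule div_mult_mod_eq[symmetric])

lemma rest_less: "rest y < 3 ^ lev y"
  by (simp add: rest_def)

lemma lead_cases: "y > 0 \<Longrightarrow> lead y = 1 \<or> lead y = 2"
proof -
  assume y: "y > 0"
  have "lead y < 3" using lev_upper[of y] by (simp add: lead_def less_mult_imp_div_less)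
  moreover have "3 ^ lev y \<le> y"
  proof (cases "lev y")
    case (Suc i)
    then have "\<not> y < 3 ^ Suc i"
      using not_less_Least[of i "\<lambda>i. y < 3 ^ Suc i"] by (simp add: lev_def)
    then show ?thesis using Suc by simp
  qed (use y in simp)
  then have "lead y > 0" by (simp add: lead_def div_greater_zero_iff)
  ultimately show ?thesis by linarith
qed

lemma lev_code:
  assumes "d = 1 \<or> d = 2" "r < 3 ^ i"
  shows "lev (d * 3 ^ i + r) = i" "lead (d * 3 ^ i + r) = d" "rest (d * 3 ^ i + r) = r"
proof -
  have up: "d * 3 ^ i + r < 3 ^ Suc i" using assms by auto
  have low: "3 ^ i \<le> d * 3 ^ i + r" using assms(1) by auto
  show lev: "lev (d * 3 ^ i + r) = i"
    unfolding lev_def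
  proof (rule Least_equality)
    show "d * 3 ^ i + r < 3 ^ Suc i" by (rule up)
    fix l assume "d * 3 ^ i + r < 3 ^ Suc l"
    then have "(3::nat) ^ i < 3 ^ Suc l" using low by linarith
    then have "i < Suc l" by (rule power_less_imp_less_exp[rotated]) simp
    then show "i \<le> l" by simp
  qed
  show "lead (d * 3 ^ i + r) = d" "rest (d * 3 ^ i + r) = r"
    using assms(2) by (simp_all add: lead_def rest_def lev)
qed

lemma lev_0 [simp]: "lev 0 = 0" "lead 0 = 0" "rest 0 = 0"
  by (simp_all add: lev_def lead_def rest_def Least_equality)

section \<open>A primitive cube root of unity\<close>

definition omega :: complex
  where "omega = cis (2 * pi / 3)"

lemma omega_3: "omega ^ 3 = 1"
  by (simp add: omega_def DeMoivre)

lemma omega_mod: "omega ^ (m mod 3) = omega ^ m"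
proof -
  have "omega ^ m = omega ^ (m mod 3 + 3 * (m div 3))" by simp
  also have "\<dots> = omega ^ (m mod 3)" by (simp only: power_add power_mult omega_3) simp
  finally show ?thesis by simp
qed

lemma omega_cong: "m mod 3 = m' mod 3 \<Longrightarrow> omega ^ m = omega ^ m'"
  by (metis omega_mod)

lemma omega_eq_1_iff: "omega ^ m = 1 \<longleftrightarrow> m mod 3 = 0"
proof -
  have ne1: "omega \<noteq> 1"
  proof
    assume "omega = 1"
    then have "cos (2 * pi / 3) = 1" by (simp add: omega_def complex_eq_iff)
    then show False by (simp add: cos_120)
  qed
  have "omega ^ 2 \<noteq> 1"
  proof
    assume "omega ^ 2 = 1"
    then have "omega ^ 3 = omega" by (simp add: power3_eq_cube power2_eq_square)
    then show False using ne1 omega_3 by simp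
  qed
  moreover have "m mod 3 = 0 \<or> m mod 3 = 1 \<or> m mod 3 = 2" by linarith
  ultimately show ?thesis using ne1 omega_mod[of m] by auto
qed

lemma omega_norm: "norm omega = 1"
  by (simp add: omega_def)

lemma omega_cnj: "cnj omega = omega ^ 2"
proof -
  have 1: "omega * cnj omega = 1" using omega_norm by (simp flip: complex_norm_square)
  have "cnj omega = (omega * omega ^ 2) * cnj omega"
    using omega_3 by (simp add: power3_eq_cube power2_eq_square mult.assoc)
  also have "\<dots> = (omega * cnj omega) * omega ^ 2" by (simp only: mult.assoc mult.left_commute mult.commute)
  finally show ?thesis using 1 by simp
qed

lemma cnj_omega_power: "cnj (omega ^ m) = omega ^ (2 * m)"
  by (simp add: omega_cnj power_mult)

context ternary
begin

text \<open>The action on wave numbers: the block is moved by \<open>g\<close>, and the character is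
  multiplied by the linear part, which is its own inverse modulo 3. Numbers out of range are fixed
  so that \<open>star g\<close> is a permutation.\<close>

definition star :: "(nat \<Rightarrow> nat) \<Rightarrow> nat \<Rightarrow> nat"
  where "star g y = (if y < 3 ^ k
    then (eps g (lev y) * lead y) mod 3 * 3 ^ lev y + g (rest y) mod 3 ^ lev y else y)"

text \<open>The phase that \<open>g\<close> gives to a wave; the factor 2 in the exponent is -1
  modulo 3.\<close>

definition cocycle :: "(nat \<Rightarrow> nat) \<Rightarrow> nat \<Rightarrow> complex"
  where "cocycle g y = omega ^ (2 * eps g (lev y) * lead y * off g (lev y) (rest y))"

definition wave :: "nat \<Rightarrow> nat \<Rightarrow> complex"
  where "wave y x = (if x mod 3 ^ lev y = rest y then omega ^ (lead y * dg (lev y) x) else 0)"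

lemma lev_less: "y < 3 ^ k \<Longrightarrow> lev y < k"
proof (cases "y = 0")
  case False
  assume y: "y < 3 ^ k"
  have "1 \<le> lead y" using lead_cases[of y] False by auto
  then have "3 ^ lev y \<le> lead y * 3 ^ lev y" by simp
  then have "3 ^ lev y \<le> y" using lead_rest[of y] by linarith
  then have "(3::nat) ^ lev y < 3 ^ k" using y by linarith
  then show ?thesis by (rule power_less_imp_less_exp[rotated]) simp
qed (use k in simp)

lemma code_less:
  fixes d r i :: nat
  assumes a: "d = 1 \<or> d = 2" "r < 3 ^ i" "i < k"
  shows "d * 3 ^ i + r < 3 ^ k"
proof -
  have "d * 3 ^ i + r < 3 ^ Suc i" using a by auto
  also have "(3::nat) ^ Suc i \<le> 3 ^ k" using a by (intro power_increasing) auto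
  finally show ?thesis .
qed

lemma star_code:
  assumes g: "g \<in> nor" and y: "y < 3 ^ k"
  shows "lev (star g y) = lev y" "lead (star g y) = (eps g (lev y) * lead y) mod 3"
    "rest (star g y) = g (rest y) mod 3 ^ lev y" "star g y < 3 ^ k" "star g y = 0 \<longleftrightarrow> y = 0"
proof -
  have "lev (star g y) = lev y \<and> lead (star g y) = (eps g (lev y) * lead y) mod 3 \<and>
    rest (star g y) = g (rest y) mod 3 ^ lev y \<and> star g y < 3 ^ k \<and> (star g y = 0 \<longleftrightarrow> y = 0)"
  proof (cases "y = 0")
    case False
    have "lead y = 1 \<or> lead y = 2" "eps g (lev y) = 1 \<or> eps g (lev y) = 2"
      using lead_cases False norD(2)[OF g lev_less[OF y]] by auto
    then have d: "(eps g (lev y) * lead y) mod 3 = 1 \<or> (eps g (lev y) * lead y) mod 3 = 2"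
      by auto
    have r: "g (rest y) mod 3 ^ lev y < 3 ^ lev y" by simp
    show ?thesis
      unfolding star_def if_P[OF y] lev_code[OF d r] using code_less[OF d r lev_less[OF y]] d False by auto
  qed (simp add: star_def)
  then show "lev (star g y) = lev y" "lead (star g y) = (eps g (lev y) * lead y) mod 3"
    "rest (star g y) = g (rest y) mod 3 ^ lev y" "star g y < 3 ^ k" "star g y = 0 \<longleftrightarrow> y = 0" by auto
qed

lemma code_eqI: "lev x = lev y \<Longrightarrow> lead x = lead y \<Longrightarrow> rest x = rest y \<Longrightarrow> x = y"
  using lead_rest[of x] lead_rest[of y] by simp

lemma rest_small: "y < 3 ^ k \<Longrightarrow> rest y < 3 ^ k"
  using rest_less[of y] lev_less[of y] less_pow[of "rest y" "lev y"] by simp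

lemma star_compose:
  assumes g: "g \<in> nor" and h: "h \<in> nor"
  shows "star (g \<circ> h) = star g \<circ> star h"
proof (rule HOL.ext)
  fix y show "star (g \<circ> h) y = (star g \<circ> star h) y"
  proof (cases "y < 3 ^ k")
    case True
    note gh = norI[OF nor_compose_tri[OF g h]] and hy = star_code[OF h True]
    note sh = star_code[OF g hy(4)] and sgh = star_code[OF gh True]
    have "star (g \<circ> h) y = star g (star h y)"
    proof (rule code_eqI)
      show "lev (star (g \<circ> h) y) = lev (star g (star h y))" by (simp add: sh sgh hy)
      show "lead (star (g \<circ> h) y) = lead (star g (star h y))"
        unfolding sh sgh hy eps_compose[OF g h lev_less[OF True]]
        by (simp add: mod_mult_left_eq mod_mult_right_eq mult.assoc)
      show "rest (star (g \<circ> h) y) = rest (star g (star h y))"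
        unfolding sh sgh hy
        using nor_mod[OF g nor_less[OF h rest_small[OF True]], of "lev y"] lev_less[OF True] by simp
    qed
    then show ?thesis by simp
  next
    case False
    then show ?thesis by (simp add: star_def)
  qed
qed

lemma eps_id: "i < k \<Longrightarrow> eps id i = 1"
  using tri_eps[OF id_tri] by blast

lemma star_id: "star id = id"
proof
  fix y show "star id y = id y"
  proof (cases "y < 3 ^ k")
    case True
    have "lead y mod 3 = lead y" using lead_cases[of y] by (cases "y = 0") auto
    then have "star id y = lead y * 3 ^ lev y + rest y"
      using True rest_less[of y] by (simp add: star_def eps_id lev_less)
    then show ?thesis using lead_rest[of y] by simp
  qed (simp add: star_def)
qed

lemma star_permutes:
  assumes g: "g \<in> nor"
  shows "star g permutes {..<3 ^ k}"
proof -
  have "star (inv' g) \<circ> star g = id"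
    using star_compose[OF inv_nor[OF g] g] permutes_inv_o(2)[OF norD(1)[OF g]] by (simp add: star_id)
  then have "inj_on (star g) {..<3 ^ k}"
    by (intro inj_on_inverseI[of _ "star (inv' g)"]) (simp add: fun_eq_iff)
  then show ?thesis
    by (rule inj_imp_permutes) (use star_code(4)[OF g] in \<open>auto simp: star_def[of g]\<close>)
qed

lemma eps_sq: "g \<in> nor \<Longrightarrow> i < k \<Longrightarrow> (eps g i * eps g i) mod 3 = 1"
  using norD(2)[of g i] by auto

lemma cocycle_compose:
  assumes g: "g \<in> nor" and h: "h \<in> nor" and y: "y < 3 ^ k"
  shows "cocycle (g \<circ> h) y = cocycle g (star h y) * cocycle h y"
proof -
  let ?i = "lev y" and ?d = "lead y" and ?r = "rest y"
  have i: "?i < k" using lev_less[OF y] .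
  note hy = star_code[OF h y]
  have "cocycle g (star h y) * cocycle h y =
      omega ^ (2 * eps g ?i * ((eps h ?i * ?d) mod 3) * off g ?i (h ?r mod 3 ^ ?i) + 2 * eps h ?i * ?d * off h ?i ?r)"
    by (simp add: cocycle_def hy power_add)
  \<comment> \<open>The square of \<open>eps g ?i\<close>, which is 1 modulo 3, is inserted so that
    both summands share a factor and \<open>off_compose\<close> applies.\<close>
  also have "\<dots> = omega ^ (2 * eps g ?i * eps h ?i * ?d * off g ?i (h ?r mod 3 ^ ?i)
      + (eps g ?i * eps g ?i) * (2 * eps h ?i * ?d * off h ?i ?r))"
  proof (rule omega_cong)
    have "[2 * eps g ?i * ((eps h ?i * ?d) mod 3) * off g ?i (h ?r mod 3 ^ ?i) + 1 * (2 * eps h ?i * ?d * off h ?i ?r)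
      = 2 * eps g ?i * (eps h ?i * ?d) * off g ?i (h ?r mod 3 ^ ?i) + (eps g ?i * eps g ?i) * (2 * eps h ?i * ?d * off h ?i ?r)] (mod 3)"
      using eps_sq[OF g i] by (intro cong_add cong_mult cong_refl) (simp_all add: cong_def)
    then show "(2 * eps g ?i * ((eps h ?i * ?d) mod 3) * off g ?i (h ?r mod 3 ^ ?i) + 2 * eps h ?i * ?d * off h ?i ?r) mod 3
      = (2 * eps g ?i * eps h ?i * ?d * off g ?i (h ?r mod 3 ^ ?i) + (eps g ?i * eps g ?i) * (2 * eps h ?i * ?d * off h ?i ?r)) mod 3"
      by (simp add: cong_def mult.assoc)
  qed
  also have "\<dots> = omega ^ (2 * (eps g ?i * eps h ?i) * ?d * (eps g ?i * off h ?i ?r + off g ?i (h ?r mod 3 ^ ?i)))"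
    by (simp add: algebra_simps)
  also have "\<dots> = cocycle (g \<circ> h) y"
    unfolding cocycle_def eps_compose[OF g h i] off_compose[OF g h i rest_less]
  proof (rule omega_cong)
    have "[2 * (eps g ?i * eps h ?i) * ?d * (eps g ?i * off h ?i ?r + off g ?i (h ?r mod 3 ^ ?i))
      = 2 * ((eps g ?i * eps h ?i) mod 3) * ?d * ((eps g ?i * off h ?i ?r + off g ?i (h ?r mod 3 ^ ?i)) mod 3)] (mod 3)"
      by (intro cong_mult cong_refl) (simp_all add: cong_def)
    then show "(2 * (eps g ?i * eps h ?i) * ?d * (eps g ?i * off h ?i ?r + off g ?i (h ?r mod 3 ^ ?i))) mod 3
      = (2 * ((eps g ?i * eps h ?i) mod 3) * ?d * ((eps g ?i * off h ?i ?r + off g ?i (h ?r mod 3 ^ ?i)) mod 3)) mod 3"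
      by (simp add: cong_def)
  qed
  finally show ?thesis by simp
qed

lemma cocycle_0: "cocycle g 0 = 1"
  by (simp add: cocycle_def)

lemma cocycle_norm: "norm (cocycle g y) = 1"
  by (simp add: cocycle_def norm_power omega_norm)

text \<open>Carrying the function \<open>wave y\<close> along by \<open>g\<close> gives
  \<open>cocycle g y\<close> times \<open>wave (star g y)\<close>. Evaluation at \<open>g x\<close>
  keeps the inverse of \<open>g\<close> out of the formula.\<close>

lemma wave_equivariant:
  assumes g: "g \<in> nor" and y: "y < 3 ^ k" and x: "x < 3 ^ k"
  shows "wave (star g y) (g x) * cocycle g y = wave y x"
proof -
  let ?i = "lev y" and ?d = "lead y" and ?r = "rest y"
  have i: "?i < k" using lev_less[OF y] .
  note gy = star_code[OF g y]
  have "g x mod 3 ^ ?i = g ?r mod 3 ^ ?i \<longleftrightarrow> x mod 3 ^ ?i = ?r"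
    using nor_mod_eq_iff[OF g x rest_small[OF y], of ?i] i rest_less[of y] by simp
  moreover have "omega ^ (((eps g ?i * ?d) mod 3) * dg ?i (g x)) * cocycle g y = omega ^ (?d * dg ?i x)"
    if r: "x mod 3 ^ ?i = ?r"
  proof -
    let ?e = "eps g ?i" and ?o = "off g ?i ?r" and ?c = "dg ?i x"
    have "omega ^ (((?e * ?d) mod 3) * dg ?i (g x)) * cocycle g y
        = omega ^ (((?e * ?d) mod 3) * ((?e * ?c + ?o) mod 3) + 2 * ?e * ?d * ?o)"
      unfolding norD(3)[OF g i x] r by (simp add: cocycle_def power_add)
    also have "\<dots> = omega ^ ((?e * ?d) * (?e * ?c + ?o) + 2 * ?e * ?d * ?o)"
    proof (rule omega_cong)
      have "[((?e * ?d) mod 3) * ((?e * ?c + ?o) mod 3) + 2 * ?e * ?d * ?o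
          = (?e * ?d) * (?e * ?c + ?o) + 2 * ?e * ?d * ?o] (mod 3)"
        by (intro cong_add cong_mult cong_refl) (simp_all add: cong_def)
      then show "(((?e * ?d) mod 3) * ((?e * ?c + ?o) mod 3) + 2 * ?e * ?d * ?o) mod 3
          = ((?e * ?d) * (?e * ?c + ?o) + 2 * ?e * ?d * ?o) mod 3"
        by (simp add: cong_def)
    qed
    also have "(?e * ?d) * (?e * ?c + ?o) + 2 * ?e * ?d * ?o = (?e * ?e) * (?d * ?c) + 3 * (?e * ?d * ?o)"
      by (simp add: algebra_simps)
    also have "omega ^ \<dots> = omega ^ (?d * ?c)"
    proof (rule omega_cong)
      have "[(?e * ?e) * (?d * ?c) = 1 * (?d * ?c)] (mod 3)"
        using eps_sq[OF g i] by (intro cong_mult cong_refl) (simp add: cong_def)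
      then show "((?e * ?e) * (?d * ?c) + 3 * (?e * ?d * ?o)) mod 3 = (?d * ?c) mod 3"
        by (simp add: cong_def)
    qed
    finally show ?thesis .
  qed
  ultimately show ?thesis by (simp add: wave_def gy)
qed

text \<open>Shifting the digit \<open>i\<close> multiplies a wave of level \<open>i\<close> by a root of unity and fixes those of
  lower level, which makes distinct waves orthogonal.\<close>

lemma wave_orthogonal:
  assumes y: "y < 3 ^ k" and y': "y' < 3 ^ k" and lv: "lev y \<le> lev y'" and ne: "y \<noteq> y'"
  shows "(\<Sum>x<3 ^ k. cnj (wave y x) * wave y' x) = 0"
proof -
  let ?i = "lev y'"
  \<comment> \<open>\<open>h\<close> adds 1 to digit \<open>?i\<close> in every block and leaves the
    other digits alone, so it preserves the support of both waves.\<close>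
  define h where "h = mk (\<lambda>_. 1) (\<lambda>l r. if l = ?i then 1 else 0)"
  have t: "tri h (\<lambda>_. 1) (\<lambda>l r. if l = ?i then 1 else 0)"
    unfolding h_def by (rule mk_tri) simp
  have hp: "h permutes {..<3 ^ k}" using t by (simp add: tri_def)
  have i: "?i < k" using lev_less[OF y'] .
  have dgh: "dg l (h x) = (if l = ?i then (dg l x + 1) mod 3 else dg l x)" if "l < k" "x < 3 ^ k" for l x
    using t that by (simp add: tri_def)
  have modh: "h x mod 3 ^ l = x mod 3 ^ l" if "l \<le> ?i" "x < 3 ^ k" for l x
    using that i by (intro dg_eq_imp_mod_eq) (simp add: dgh)
  have wh': "wave y' (h x) = omega ^ lead y' * wave y' x" if "x < 3 ^ k" for x
  proof -
    have "omega ^ (lead y' * ((dg ?i x + 1) mod 3)) = omega ^ (lead y' * (dg ?i x + 1))"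
      by (rule omega_cong) (rule mod_mult_right_eq)
    then show ?thesis using that i by (simp add: wave_def modh dgh algebra_simps power_add)
  qed
  \<comment> \<open>The factor by which a summand changes under \<open>h\<close>; on equal levels
    the conjugation doubles the exponent \<open>lead y\<close>.\<close>
  let ?c = "if lev y < ?i then omega ^ lead y' else omega ^ (2 * lead y + lead y')"
  have wh: "cnj (wave y (h x)) * wave y' (h x) = ?c * (cnj (wave y x) * wave y' x)" if x: "x < 3 ^ k" for x
  proof (cases "lev y < ?i")
    case True
    then have "wave y (h x) = wave y x"
      using x i by (simp add: wave_def modh dgh)
    then show ?thesis using True wh'[OF x] by simp
  next
    case False
    then have eq: "lev y = ?i" using lv by simp
    have "omega ^ (lead y * ((dg ?i x + 1) mod 3)) = omega ^ (lead y * (dg ?i x + 1))"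
      by (rule omega_cong) (rule mod_mult_right_eq)
    then have "wave y (h x) = omega ^ lead y * wave y x"
      using x i eq by (simp add: wave_def modh dgh algebra_simps power_add)
    then show ?thesis
      using False wh'[OF x] by (simp add: cnj_omega_power power_add del: complex_cnj_power)
  qed
  let ?S = "\<Sum>x<3 ^ k. cnj (wave y x) * wave y' x"
  have "?S = (\<Sum>x<3 ^ k. cnj (wave y (h x)) * wave y' (h x))"
    by (rule sum.reindex_bij_betw[symmetric, OF permutes_imp_bij[OF hp]])
  also have "\<dots> = ?c * ?S"
    unfolding sum_distrib_left by (intro sum.cong refl wh) simp
  finally have S: "?S = ?c * ?S" .
  show ?thesis
  proof (cases "?c = 1")
    case False
    then show ?thesis using S by simp
  next
    case True
    \<comment> \<open>Factor 1 forces equal levels and then equal leads, so the waves live on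
      different blocks and every summand is 0.\<close>
    have nlt: "\<not> lev y < ?i"
    proof
      assume lt: "lev y < ?i"
      then have "y' \<noteq> 0" by (metis lev_0(1) not_less_zero)
      then have "lead y' = 1 \<or> lead y' = 2" using lead_cases by simp
      then show False using True lt by (auto simp: omega_eq_1_iff)
    qed
    then have eq: "lev y = ?i" using lv by simp
    have "(2 * lead y + lead y') mod 3 = 0" using True nlt by (simp add: omega_eq_1_iff)
    moreover have "lead y < 3" "lead y' < 3" using lead_cases[of y] lead_cases[of y']
      by (cases "y = 0"; cases "y' = 0"; force)+
    ultimately have "lead y = lead y'" by presburger
    then have "rest y \<noteq> rest y'" using code_eqI[OF eq] ne by blast
    then show ?thesis by (intro sum.neutral) (auto simp: wave_def eq)
  qed
qed

lemma wave_orthogonal': "y < 3 ^ k \<Longrightarrow> y' < 3 ^ k \<Longrightarrow> y \<noteq> y' \<Longrightarrow> (\<Sum>x<3 ^ k. cnj (wave y x) * wave y' x) = 0"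
proof (cases "lev y \<le> lev y'")
  case False
  assume a: "y < 3 ^ k" "y' < 3 ^ k" "y \<noteq> y'"
  have "(\<Sum>x<3 ^ k. cnj (wave y' x) * wave y x) = 0"
    using a False by (intro wave_orthogonal) auto
  then have "cnj (\<Sum>x<3 ^ k. cnj (wave y' x) * wave y x) = 0" by simp
  then show ?thesis by (simp add: mult.commute)
qed (rule wave_orthogonal)

lemma wave_norm:
  assumes y: "y < 3 ^ k"
  shows "(\<Sum>x<3 ^ k. cnj (wave y x) * wave y x) \<noteq> 0"
proof -
  have "(\<Sum>x<3 ^ k. cnj (wave y x) * wave y x) = of_real (\<Sum>x<3 ^ k. (norm (wave y x))\<^sup>2)"
    by (simp add: complex_norm_square mult.commute del: of_real_power)
  moreover have "(norm (wave y (rest y)))\<^sup>2 = 1"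
    using rest_less[of y] by (simp add: wave_def norm_power omega_norm)
  then have "(\<Sum>x<3 ^ k. (norm (wave y x))\<^sup>2) \<ge> 1"
    using member_le_sum[of "rest y" "{..<3 ^ k}" "\<lambda>x. (norm (wave y x))\<^sup>2"] rest_small[OF y] by simp
  ultimately show ?thesis by (metis of_real_eq_0_iff not_one_le_zero)
qed

definition wmat :: "complex mat"
  where "wmat = mat (3 ^ k) (3 ^ k) (\<lambda>(x, y). wave y x)"

text \<open>Pairing the image of a kernel vector with each wave isolates one coefficient, by
  orthogonality.\<close>

lemma det_wmat: "det wmat \<noteq> 0"
proof
  let ?n = "3 ^ k :: nat"
  have W: "wmat \<in> carrier_mat ?n ?n" by (simp add: wmat_def)
  assume "det wmat = 0"
  then obtain v where v: "v \<in> carrier_vec ?n" "v \<noteq> 0\<^sub>v ?n" "wmat *\<^sub>v v = 0\<^sub>v ?n"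
    using det_0_iff_vec_prod_zero_field[OF W] by auto
  have "v $ y = 0" if y: "y < ?n" for y
  proof -
    have "0 = (\<Sum>x<?n. cnj (wave y x) * (wmat *\<^sub>v v) $ x)" by (simp add: v(3))
    also have "\<dots> = (\<Sum>x<?n. \<Sum>u<?n. cnj (wave y x) * (wave u x * v $ u))"
    proof (intro sum.cong refl)
      fix x assume x: "x \<in> {..<?n}"
      then have "(wmat *\<^sub>v v) $ x = (\<Sum>u<?n. wave u x * v $ u)"
        by (subst mult_mat_vec_entry[OF W v(1)]) (auto simp: wmat_def intro!: sum.cong)
      then show "cnj (wave y x) * (wmat *\<^sub>v v) $ x = (\<Sum>u<?n. cnj (wave y x) * (wave u x * v $ u))"
        by (simp only: sum_distrib_left)
    qed
    also have "\<dots> = (\<Sum>u<?n. (\<Sum>x<?n. cnj (wave y x) * wave u x) * v $ u)"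
      by (subst sum.swap) (simp add: sum_distrib_right mult.assoc)
    also have "\<dots> = (\<Sum>u<?n. if u = y then (\<Sum>x<?n. cnj (wave y x) * wave y x) * v $ y else 0)"
      using y by (intro sum.cong) (auto simp: wave_orthogonal')
    also have "\<dots> = (\<Sum>x<?n. cnj (wave y x) * wave y x) * v $ y"
      using y by simp
    finally show ?thesis using wave_norm[OF y] by simp
  qed
  then have "v = 0\<^sub>v ?n" using v(1) by (intro eq_vecI) auto
  with v show False by simp
qed

text \<open>The waves form a basis in which \<open>g\<close> is monomial with data
  \<open>star g\<close> and \<open>cocycle g\<close>; comparing principal minors transfers the
  exterior powers from points to waves.\<close>

lemma ext_sym_star:
  assumes g: "g \<in> nor"
  shows "ext_sym (3 ^ k) j g =
    (\<Sum>B | B \<subseteq> {..<3 ^ k} \<and> card B = j \<and> star g ` B = B. of_int (sign_on B (star g)) * (\<Prod>y\<in>B. cocycle g y))"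
proof -
  let ?n = "3 ^ k :: nat"
  let ?A = "mat ?n ?n (\<lambda>(x, y). if x = g y then 1 else 0 :: complex)"
  let ?D = "mat ?n ?n (\<lambda>(x, y). if x = star g y then cocycle g y else 0)"
  have gp: "g permutes {..<?n}" using norD(1)[OF g] .
  have "?A * wmat = wmat * ?D"
  proof (rule eq_matI)
    fix x y assume "x < dim_row (wmat * ?D)" "y < dim_col (wmat * ?D)"
    then have xy: "x < ?n" "y < ?n" by (simp_all add: wmat_def)
    have "x \<in> g ` {..<?n}" using xy permutes_image[OF gp] by simp
    then obtain w where w: "w < ?n" "x = g w" by auto
    have gw: "g w = g u \<longleftrightarrow> u = w" for u using permutes_inj[OF gp] by (auto simp: inj_eq)
    have "(?A * wmat) $$ (x, y) = (\<Sum>u<?n. ?A $$ (x, u) * wmat $$ (u, y))"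
      using xy by (intro mult_mat_entry[of _ ?n ?n _ ?n]) (simp_all add: wmat_def)
    also have "\<dots> = (\<Sum>u<?n. if u = w then wave y w else 0)"
      using xy w gw by (intro sum.cong) (auto simp: wmat_def)
    also have "\<dots> = wave y w" using w by simp
    also have "\<dots> = wave (star g y) x * cocycle g y"
      using wave_equivariant[OF g xy(2) w(1)] w by simp
    also have "\<dots> = (\<Sum>u<?n. if u = star g y then wave (star g y) x * cocycle g y else 0)"
      using star_code(4)[OF g xy(2)] by simp
    also have "\<dots> = (\<Sum>u<?n. wmat $$ (x, u) * ?D $$ (u, y))"
      using xy by (intro sum.cong) (auto simp: wmat_def)
    also have "\<dots> = (wmat * ?D) $$ (x, y)"
      using xy by (intro mult_mat_entry[of _ ?n ?n _ ?n, symmetric]) (simp_all add: wmat_def)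
    finally show "(?A * wmat) $$ (x, y) = (wmat * ?D) $$ (x, y)" .
  qed (simp_all add: wmat_def)
  from monomial_minors_eq[OF gp star_permutes[OF g] _ det_wmat this, of j]
  show ?thesis by (simp add: ext_sym_apply[OF gp] wmat_def)
qed

end

section \<open>The irreducible characters of the normalizer of degree prime to 3\<close>

text \<open>Exchanges two intervals of length \<open>m\<close>. It will describe the swap of the
  waves of lead 1 with those of lead 2 on one level, where m = 3^i is odd.\<close>

definition block_swap :: "nat \<Rightarrow> nat \<Rightarrow> nat \<Rightarrow> nat \<Rightarrow> nat"
  where "block_swap a c m y = (if a \<le> y \<and> y < a + m then y + (c - a)
    else if c \<le> y \<and> y < c + m then y - (c - a) else y)"

lemma sign_block_swap:
  "a + m \<le> c \<Longrightarrow> block_swap a c m permutes {..<c + m} \<and> sign (block_swap a c m) = (-1) ^ m"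
proof (induction m)
  case 0
  have "block_swap a c 0 = id" by (rule HOL.ext) (simp add: block_swap_def)
  then show ?case by (simp only: permutes_id sign_id power_0 simp_thms)
next
  case (Suc m)
  have IH: "block_swap a c m permutes {..<c + m}" "sign (block_swap a c m) = (-1) ^ m"
    using Suc.IH Suc.prems by simp_all
  have eq: "block_swap a c (Suc m) = block_swap a c m \<circ> Transposition.transpose (a + m) (c + m)"
  proof (rule HOL.ext)
    fix y
    have "y = a + m \<or> y = c + m \<or> Transposition.transpose (a + m) (c + m) y = y"
      by (simp add: transpose_def)
    then show "block_swap a c (Suc m) y = (block_swap a c m \<circ> Transposition.transpose (a + m) (c + m)) y"
      using Suc.prems by (auto simp: block_swap_def transpose_def)
  qed
  have t: "Transposition.transpose (a + m) (c + m) permutes {..<c + Suc m}"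
    using Suc.prems by (intro permutes_swap_id) auto
  have p: "block_swap a c m permutes {..<c + Suc m}" using IH(1) by (rule permutes_subset) auto
  have pt: "permutation (block_swap a c m)" "permutation (Transposition.transpose (a + m) (c + m))"
    using permutes_imp_permutation[OF _ p] permutation_swap_id by auto
  have "sign (block_swap a c (Suc m)) = sign (block_swap a c m) * sign (Transposition.transpose (a + m) (c + m))"
    unfolding eq by (rule sign_compose[OF pt])
  also have "\<dots> = (-1) ^ Suc m"
    using IH(2) Suc.prems by (simp add: sign_swap_id)
  finally have "sign (block_swap a c (Suc m)) = (-1) ^ Suc m" .
  moreover have "block_swap a c (Suc m) permutes {..<c + Suc m}"
    unfolding eq by (rule permutes_compose[OF t p])
  ultimately show ?case by (rule conjI[rotated])
qed

lemma undigits_sum: "undigits m d = (\<Sum>i<m. d i * 3 ^ i)"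
  by (induction m) simp_all

context ternary
begin

definition norg :: "(nat \<Rightarrow> nat) monoid"
  where "norg = (symg (3 ^ k))\<lparr>carrier := nor\<rparr>"

lemma norg_simps: "carrier norg = nor" "g \<otimes>\<^bsub>norg\<^esub> h = g \<circ> h" "\<one>\<^bsub>norg\<^esub> = id"
  by (simp_all add: norg_def symg_simps)

lemma norg_group: "group norg"
  unfolding norg_def by (rule group.subgroup_imp_group[OF symg_group nor_subgroup])

lemma norg_finite: "finite (carrier norg)"
  unfolding norg_simps
  by (rule finite_subset[OF _ symg_finite[of "3 ^ k"]]) (use norD(1) in \<open>auto simp: symg_simps\<close>)

interpretation N: monomial_action norg "3 ^ k" star cocycle
proof -
  interpret group norg by (rule norg_group)
  show "monomial_action norg (3 ^ k) star cocycle"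
    by unfold_locales
      (simp_all add: norg_simps norg_finite[unfolded norg_simps] star_permutes star_compose cocycle_compose cocycle_norm)
qed

text \<open>Dropping the constant wave 0 cuts the exterior powers of the permutation module down to
  those of V.\<close>

definition family :: "nat \<Rightarrow> nat set set"
  where "family j = {B. B \<subseteq> {1..<3 ^ k} \<and> card B = j}"

lemma family_invariant: "N.invariant (family j)"
  unfolding N.invariant_def
proof (intro conjI ballI)
  fix B assume "B \<in> family j"
  then show "B \<subseteq> {..<3 ^ k}" by (auto simp: family_def)
next
  fix g B assume g: "g \<in> carrier norg" and B: "B \<in> family j"
  then have gn: "g \<in> nor" by (simp add: norg_simps)
  have "star g y \<in> {1..<3 ^ k}" if "y \<in> B" for y
  proof -
    have "y < 3 ^ k" "y \<noteq> 0" using that B by (auto simp: family_def)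
    then show ?thesis using star_code(4,5)[OF gn, of y] by simp
  qed
  then show "star g ` B \<in> family j"
    using B card_image_permutes[OF star_permutes[OF gn], of B] by (auto simp: family_def)
qed

lemma star_0: "g \<in> nor \<Longrightarrow> star g 0 = 0"
  using star_code(5)[of g 0] by simp

lemma ext_sym_echar: "g \<in> nor \<Longrightarrow> ext_sym (3 ^ k) j g = N.echar (subsets (3 ^ k) j) g"
  by (simp add: ext_sym_star N.echar_def norg_simps N.val_def subsets_def conj_assoc)

text \<open>The decomposition of \<Lambda>^(j+1) (V + 1) into \<Lambda>^(j+1) V and \<Lambda>^j V: a
  set either avoids the fixed wave 0 or arises by inserting it into a smaller set, and wave 0
  contributes neither sign nor phase.\<close>

lemma echar_subsets_Suc:
  assumes g: "g \<in> nor"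
  shows "N.echar (subsets (3 ^ k) (Suc j)) g = N.echar (family (Suc j)) g + N.echar (family j) g"
proof -
  let ?S = "\<lambda>F. {B. B \<in> F \<and> star g ` B = B}"
  have inj: "inj (star g)" using star_permutes[OF g] by (rule permutes_inj)
  have ech: "N.echar F g = (\<Sum>B\<in>?S F. N.val g B)" for F
    using g by (simp add: N.echar_def norg_simps)
  have z: "star g 0 = 0" by (rule star_0[OF g])
  have stab0: "star g ` insert 0 B = insert 0 B \<longleftrightarrow> star g ` B = B" if "0 \<notin> B" for B
  proof -
    have "0 \<notin> star g ` B" using that z inj by (metis image_iff inj_eq)
    then show ?thesis using that by (simp add: z insert_ident)
  qed
  have fin: "finite B" if "B \<in> family j" for B j using that finite_subset by (auto simp: family_def)
  have zero: "0 \<notin> B" if "B \<in> family j" for B j using that by (auto simp: family_def)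
  have split: "?S (subsets (3 ^ k) (Suc j)) = ?S (family (Suc j)) \<union> insert 0 ` ?S (family j)"
  proof (rule Set.set_eqI)
    fix B
    show "B \<in> ?S (subsets (3 ^ k) (Suc j)) \<longleftrightarrow> B \<in> ?S (family (Suc j)) \<union> insert 0 ` ?S (family j)"
    proof (cases "0 \<in> B")
      case False
      have "B \<subseteq> {..<3 ^ k} \<longleftrightarrow> B \<subseteq> {1..<3 ^ k}"
      proof
        assume B: "B \<subseteq> {..<3 ^ k}"
        show "B \<subseteq> {1..<3 ^ k}"
        proof
          fix y assume y: "y \<in> B"
          then have "y \<noteq> 0" using False by metis
          then show "y \<in> {1..<3 ^ k}" using B y by auto
        qed
      qed auto
      then show ?thesis using False by (auto simp: subsets_def family_def)
    next
      case True
      define C where "C = B - {0}"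
      have B: "B = insert 0 C" "0 \<notin> C" using True by (auto simp: C_def)
      have "B \<in> ?S (subsets (3 ^ k) (Suc j)) \<longleftrightarrow> C \<in> ?S (family j)"
      proof -
        have "B \<subseteq> {..<3 ^ k} \<longleftrightarrow> C \<subseteq> {1..<3 ^ k}"
        proof
          assume C: "C \<subseteq> {1..<3 ^ k}"
          show "B \<subseteq> {..<3 ^ k}" unfolding B(1) using C by auto
        next
          assume S: "B \<subseteq> {..<3 ^ k}"
          show "C \<subseteq> {1..<3 ^ k}"
          proof
            fix y assume y: "y \<in> C"
            then have "y \<noteq> 0" using B(2) by metis
            moreover have "y \<in> B" using y B(1) by blast
            ultimately show "y \<in> {1..<3 ^ k}" using S by auto
          qed
        qed
        moreover have "card B = Suc j \<longleftrightarrow> card C = j" if "B \<subseteq> {..<3 ^ k}"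
        proof -
          have "finite C" using that B finite_subset[of C "{..<3 ^ k}"] by auto
          then show ?thesis using B by simp
        qed
        ultimately show ?thesis using stab0[OF B(2)] unfolding subsets_def family_def B(1)[symmetric] by blast
      qed
      moreover have "B \<in> insert 0 ` ?S (family j) \<longleftrightarrow> C \<in> ?S (family j)"
      proof
        assume "B \<in> insert 0 ` ?S (family j)"
        then obtain C' where C': "B = insert 0 C'" "C' \<in> ?S (family j)" by auto
        have "C' = C" using B C'(1) zero[of C' j] C'(2) by (auto simp: insert_ident)
        then show "C \<in> ?S (family j)" using C'(2) by simp
      qed (use B in blast)
      moreover have "B \<notin> ?S (family (Suc j))" using True zero by blast
      ultimately show ?thesis by (simp only: Un_iff simp_thms)
    qed
  qed
  have disj: "?S (family (Suc j)) \<inter> insert 0 ` ?S (family j) = {}"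
    using zero by blast
  have finS: "finite (?S (family j))" for j
    using N.invariant_finite[OF family_invariant, of j] by simp
  have inj0: "inj_on (insert 0) (?S (family j))"
  proof (rule inj_onI)
    fix B C assume "B \<in> ?S (family j)" "C \<in> ?S (family j)" "insert 0 B = insert 0 C"
    then show "B = C" using zero[of B j] zero[of C j] by (simp add: insert_ident)
  qed
  have "(\<Sum>B\<in>insert 0 ` ?S (family j). N.val g B) = (\<Sum>B\<in>?S (family j). N.val g B)"
    unfolding sum.reindex[OF inj0]
  proof (rule sum.cong)
    fix B assume "B \<in> ?S (family j)"
    then have B: "B \<in> family j" by simp
    have "restrict_id (star g) (insert 0 B) = restrict_id (star g) B"
      using z by (auto simp: restrict_id_def fun_eq_iff)
    then show "(N.val g \<circ> insert 0) B = N.val g B"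
      using fin[OF B] zero[OF B] by (simp add: N.val_def sign_on_def cocycle_0)
  qed simp
  then show ?thesis
    unfolding ech split using sum.union_disjoint[OF finS finite_imageI[OF finS] disj, of "N.val g"] by simp
qed

text \<open>The hook characters restrict to the exterior powers of the monomial representation on the
  nonconstant waves.\<close>

lemma hook_nor:
  assumes g: "g \<in> nor"
  shows "hook (3 ^ k) j g = N.echar (family j) g"
proof (induction j)
  case 0
  have "subsets (3 ^ k) 0 = family 0"
    by (auto simp: subsets_def family_def dest: finite_subset[OF _ finite_lessThan] finite_subset[OF _ finite_atLeastLessThan])
  then show ?case using ext_sym_echar[OF g, of 0] by simp
next
  case (Suc j)
  have "g permutes {..<3 ^ k}" using norD(1)[OF g] .
  then have "hook (3 ^ k) (Suc j) g = ext_sym (3 ^ k) (Suc j) g - hook (3 ^ k) j g"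
    by (simp add: symg_simps)
  then show ?case
    unfolding ext_sym_echar[OF g] echar_subsets_Suc[OF g] Suc by simp
qed

section \<open>The orbit of wave sets selected by the ternary digits of \<open>j\<close>\<close>

definition ones :: "nat \<Rightarrow> nat set"
  where "ones j = {i. i < k \<and> dg i j = 1}"

text \<open>A digit 0, 1, 2 of \<open>j\<close> at level \<open>i\<close> selects no wave, the waves with one of the two leading
  coefficients, or all waves of level \<open>i\<close>; the set \<open>U\<close> records the choices for the digits 1.\<close>

definition leads :: "nat \<Rightarrow> nat set \<Rightarrow> nat \<Rightarrow> nat set"
  where "leads j U i = (if dg i j = 2 then {1, 2} else if dg i j = 1 then {if i \<in> U then 2 else 1} else {})"

definition block :: "nat \<Rightarrow> nat set \<Rightarrow> nat set"
  where "block j U = {y. 0 < y \<and> y < 3 ^ k \<and> lead y \<in> leads j U (lev y)}"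

definition orbit_fam :: "nat \<Rightarrow> nat set set"
  where "orbit_fam j = block j ` Pow (ones j)"

lemma leads_sub: "leads j U i \<subseteq> {1, 2}"
  by (auto simp: leads_def)

lemma mem_block_code:
  assumes "d = 1 \<or> d = 2" "r < 3 ^ i" "i < k"
  shows "d * 3 ^ i + r \<in> block j U \<longleftrightarrow> d \<in> leads j U i"
  using lev_code[OF assms(1,2)] code_less[OF assms] assms(1) by (auto simp: block_def)

lemma block_sub: "block j U \<subseteq> {1..<3 ^ k}"
  by (auto simp: block_def)

lemma block_sub': "block j U \<subseteq> {..<3 ^ k}"
  by (auto simp: block_def)

text \<open>A digit d of \<open>j\<close> at level \<open>i\<close> selects d leads on each of the
  3^i blocks, so the sizes add up to the ternary expansion of \<open>j\<close>.\<close>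

lemma card_block:
  assumes "j < 3 ^ k"
  shows "card (block j U) = j"
proof -
  define I where "I = (SIGMA i:{..<k}. leads j U i \<times> {..<(3::nat) ^ i})"
  define f where "f = (\<lambda>(i, d, r). d * 3 ^ i + r :: nat)"
  have bij: "block j U = f ` I"
  proof
    show "block j U \<subseteq> f ` I"
    proof
      fix y assume y: "y \<in> block j U"
      then have "(lev y, lead y, rest y) \<in> I"
        using lev_less[of y] rest_less[of y] by (auto simp: I_def block_def)
      moreover have "y = f (lev y, lead y, rest y)" using lead_rest[of y] by (simp add: f_def)
      ultimately show "y \<in> f ` I" by blast
    qed
    show "f ` I \<subseteq> block j U"
    proof
      fix y assume "y \<in> f ` I"
      then obtain i d r where p: "i < k" "d \<in> leads j U i" "r < 3 ^ i" "y = d * 3 ^ i + r"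
        by (auto simp: I_def f_def)
      have "d = 1 \<or> d = 2" using p(2) leads_sub by blast
      then show "y \<in> block j U" unfolding p(4) using mem_block_code p by blast
    qed
  qed
  have "inj_on f I"
  proof (rule inj_onI)
    fix p q assume pq: "p \<in> I" "q \<in> I" "f p = f q"
    obtain i d r where p: "p = (i, d, r)" by (cases p)
    obtain i' d' r' where q: "q = (i', d', r')" by (cases q)
    have d: "d = 1 \<or> d = 2" "r < 3 ^ i" "d' = 1 \<or> d' = 2" "r' < 3 ^ i'"
      using pq p q leads_sub[of j U i] leads_sub[of j U i'] by (auto simp: I_def)
    show "p = q"
      using pq(3) lev_code[OF d(1,2)] lev_code[OF d(3,4)] by (simp add: p q f_def)
  qed
  then have "card (block j U) = card I" unfolding bij by (rule card_image)
  also have "\<dots> = (\<Sum>i<k. card (leads j U i \<times> {..<(3::nat) ^ i}))"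
    unfolding I_def by (rule card_SigmaI) (auto intro: finite_subset[OF leads_sub])
  also have "\<dots> = (\<Sum>i<k. dg i j * 3 ^ i)"
  proof (rule sum.cong)
    fix i
    have "dg i j = 0 \<or> dg i j = 1 \<or> dg i j = 2" using dg_less[of i j] by linarith
    then show "card (leads j U i \<times> {..<(3::nat) ^ i}) = dg i j * 3 ^ i"
      by (auto simp: leads_def card_cartesian_product)
  qed simp
  also have "\<dots> = j" using undigits_dg[of k j] assms by (simp add: undigits_sum)
  finally show ?thesis .
qed

text \<open>Linear part 2 exchanges the leads 1 and 2, so within \<open>ones j\<close> the set
  \<open>U\<close> changes by the symmetric difference with the levels where \<open>g\<close> has
  linear part 2.\<close>

definition flipped :: "(nat \<Rightarrow> nat) \<Rightarrow> nat \<Rightarrow> nat set \<Rightarrow> nat set"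
  where "flipped g j U = {i \<in> ones j. (i \<in> U) \<noteq> (eps g i = 2)}"

text \<open>One inclusion suffices, as both sets have \<open>j\<close> elements.\<close>

lemma star_block:
  assumes g: "g \<in> nor" and j: "j < 3 ^ k"
  shows "star g ` block j U = block j (flipped g j U)"
proof (rule card_subset_eq)
  show "finite (block j (flipped g j U))" by (rule finite_subset[OF block_sub]) simp
  show "card (star g ` block j U) = card (block j (flipped g j U))"
    by (simp add: card_image_permutes[OF star_permutes[OF g]] card_block[OF j])
  show "star g ` block j U \<subseteq> block j (flipped g j U)"
  proof
    fix z assume "z \<in> star g ` block j U"
    then obtain y where y: "y \<in> block j U" "z = star g y" by auto
    then have y': "0 < y" "y < 3 ^ k" "lead y \<in> leads j U (lev y)" by (auto simp: block_def)
    note s = star_code[OF g y'(2)]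
    have i: "lev y < k" by (rule lev_less[OF y'(2)])
    have e: "eps g (lev y) = 1 \<or> eps g (lev y) = 2" by (rule norD(2)[OF g i])
    have "(eps g (lev y) * lead y) mod 3 \<in> leads j (flipped g j U) (lev y)"
      using y'(3) e i by (auto simp: leads_def flipped_def ones_def split: if_splits)
    then show "z \<in> block j (flipped g j U)"
      using s y'(1) by (simp add: block_def y(2))
  qed
qed

lemma flipped_sub: "flipped g j U \<subseteq> ones j"
  by (auto simp: flipped_def)

lemma flipped_trivial: "U \<subseteq> ones j \<Longrightarrow> (\<And>i. i \<in> ones j \<Longrightarrow> eps g i = 1) \<Longrightarrow> flipped g j U = U"
  by (auto simp: flipped_def)

lemma orbit_fam_invariant:
  assumes j: "j < 3 ^ k"
  shows "N.invariant (orbit_fam j)"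
  unfolding N.invariant_def orbit_fam_def
  using block_sub' star_block[OF _ j] flipped_sub by (auto simp: norg_simps)

lemma orbit_fam_sub: "j < 3 ^ k \<Longrightarrow> orbit_fam j \<subseteq> family j"
  using block_sub card_block by (auto simp: orbit_fam_def family_def)

lemma block_inj: "inj_on (block j) (Pow (ones j))"
proof (rule inj_onI)
  fix U V assume UV: "U \<in> Pow (ones j)" "V \<in> Pow (ones j)" "block j U = block j V"
  have "i \<in> U \<longleftrightarrow> i \<in> V" if i: "i \<in> ones j" for i
  proof -
    have ik: "i < k" "dg i j = 1" using i by (auto simp: ones_def)
    have "i \<in> W \<longleftrightarrow> 2 * 3 ^ i + 0 \<in> block j W" for W
      using mem_block_code[of 2 0 i j W] ik by (simp add: leads_def)
    then show ?thesis using UV(3) by simp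
  qed
  then show "U = V" using UV by blast
qed

lemma card_orbit_fam: "card (orbit_fam j) = 2 ^ card (ones j)"
  unfolding orbit_fam_def by (subst card_image[OF block_inj]) (simp add: card_Pow ones_def)

lemma block_eqI:
  assumes "\<And>i. i < k \<Longrightarrow> leads j U i = leads j' U' i"
  shows "block j U = block j' U'"
proof -
  have "lead y \<in> leads j U (lev y) \<longleftrightarrow> lead y \<in> leads j' U' (lev y)" if "y < 3 ^ k" for y
    using assms[OF lev_less[OF that]] by simp
  then show ?thesis by (auto simp: block_def)
qed

lemma stab_block:
  assumes g: "g \<in> nor" and j: "j < 3 ^ k" and U: "U \<subseteq> ones j" and e: "\<And>i. i \<in> ones j \<Longrightarrow> eps g i = 1"
  shows "g \<in> N.stab (block j U)"
  using g star_block[OF g j] flipped_trivial[OF U e] by (simp add: N.stab_def norg_simps)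

text \<open>\<open>h\<close> turns digit \<open>i\<close> on the single block with residue 0, so
  only the waves on that block acquire a phase. Passing to \<open>h \<circ> h\<close> removes the
  sign coming from the permutation of waves of higher levels, and twice the lead in the exponent
  becomes four times the lead, which is congruent to the lead.\<close>

lemma val_rotation:
  assumes j: "j < 3 ^ k" and U: "U \<subseteq> ones j" and i: "i < k"
  defines "h \<equiv> mk (\<lambda>_. 1) (\<lambda>l r. if l = i \<and> r = 0 then 1 else 0)"
  shows "h \<in> N.stab (block j U)" "N.val (h \<circ> h) (block j U) = omega ^ (\<Sum>(leads j U i))"
proof -
  have t: "tri h (\<lambda>_. 1) (\<lambda>l r. if l = i \<and> r = 0 then 1 else 0)"
    unfolding h_def by (rule mk_tri) simp
  have hn: "h \<in> nor" by (rule norI[OF t])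
  have e: "eps h l = 1" if "l < k" for l using tri_eps[OF t that] .
  have o: "off h l r = (if l = i \<and> r = 0 then 1 else 0)" if "l < k" "r < 3 ^ l" for l r
    using tri_off[OF t that] by simp
  show hs: "h \<in> N.stab (block j U)"
    by (rule stab_block[OF hn j U]) (simp add: e ones_def)
  let ?B = "block j U" and ?D = "leads j U i"
  have finB: "finite ?B" by (rule finite_subset[OF block_sub]) simp
  have co: "cocycle h y = (if lev y = i \<and> rest y = 0 then omega ^ (2 * lead y) else 1)" if "y \<in> ?B" for y
    using that lev_less[of y] rest_less[of y] by (simp add: cocycle_def e o block_def)
  have part: "{y \<in> ?B. lev y = i \<and> rest y = 0} = (\<lambda>d. d * 3 ^ i) ` ?D"
  proof
    show "{y \<in> ?B. lev y = i \<and> rest y = 0} \<subseteq> (\<lambda>d. d * 3 ^ i) ` ?D"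
    proof
      fix y assume y: "y \<in> {y \<in> ?B. lev y = i \<and> rest y = 0}"
      then have "y = lead y * 3 ^ i" using lead_rest[of y] by simp
      moreover have "lead y \<in> ?D" using y by (auto simp: block_def)
      ultimately show "y \<in> (\<lambda>d. d * 3 ^ i) ` ?D" by blast
    qed
    show "(\<lambda>d. d * 3 ^ i) ` ?D \<subseteq> {y \<in> ?B. lev y = i \<and> rest y = 0}"
    proof
      fix y assume "y \<in> (\<lambda>d. d * 3 ^ i) ` ?D"
      then obtain d where d: "d \<in> ?D" "y = d * 3 ^ i + 0" by auto
      have d12: "d = 1 \<or> d = 2" using d(1) leads_sub by blast
      have r: "(0::nat) < 3 ^ i" by simp
      show "y \<in> {y \<in> ?B. lev y = i \<and> rest y = 0}"
        unfolding d(2) using lev_code[OF d12 r] mem_block_code[OF d12 r i] d(1) by simp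
    qed
  qed
  have "(\<Prod>y\<in>?B. cocycle h y) = (\<Prod>y\<in>?B. if lev y = i \<and> rest y = 0 then omega ^ (2 * lead y) else 1)"
    by (intro prod.cong) (simp_all add: co)
  also have "\<dots> = (\<Prod>y\<in>{y \<in> ?B. lev y = i \<and> rest y = 0}. omega ^ (2 * lead y))"
    by (rule prod.inter_filter[OF finB, symmetric])
  also have "\<dots> = (\<Prod>d\<in>?D. omega ^ (2 * lead (d * 3 ^ i)))"
    unfolding part by (subst prod.reindex) (auto simp: inj_on_def)
  also have "\<dots> = (\<Prod>d\<in>?D. omega ^ (2 * d))"
  proof (rule prod.cong)
    fix d assume "d \<in> ?D"
    then have "d = 1 \<or> d = 2" using leads_sub by blast
    then have "lead (d * 3 ^ i + 0) = d" by (rule lev_code) simp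
    then show "omega ^ (2 * lead (d * 3 ^ i)) = omega ^ (2 * d)" by simp
  qed simp
  also have "\<dots> = omega ^ (2 * \<Sum>?D)"
    by (simp add: power_sum[symmetric] sum_distrib_left)
  finally have pr: "(\<Prod>y\<in>?B. cocycle h y) = omega ^ (2 * \<Sum>?D)" .
  have "N.val (h \<otimes>\<^bsub>norg\<^esub> h) ?B = N.val h ?B * N.val h ?B"
    by (rule N.val_mult[OF hs hs block_sub'])
  also have "\<dots> = (of_int (sign_on ?B (star h)) * of_int (sign_on ?B (star h))) * (omega ^ (2 * \<Sum>?D) * omega ^ (2 * \<Sum>?D))"
    by (simp add: N.val_def pr)
  also have "of_int (sign_on ?B (star h)) * of_int (sign_on ?B (star h)) = (1 :: complex)"
    by (simp add: sign_on_def flip: of_int_mult)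
  also have "omega ^ (2 * \<Sum>?D) * omega ^ (2 * \<Sum>?D) = omega ^ (\<Sum>?D + 3 * \<Sum>?D)"
    by (simp add: power_add[symmetric])
  also have "\<dots> = omega ^ \<Sum>?D" by (rule omega_cong) (rule mod_mult_self2)
  finally show "N.val (h \<circ> h) ?B = omega ^ \<Sum>?D" by (simp only: norg_simps mult_1)
qed

text \<open>\<open>h\<close> inverts digit \<open>i\<close> everywhere and has trivial phases. Waves
  below level \<open>i\<close> are fixed, above it the two sets agree, and on level \<open>i\<close>
  the set \<open>block j' U'\<close> has 3^i additional exchanged pairs, an odd number.\<close>

lemma val_flip:
  assumes j: "j < 3 ^ k" "U \<subseteq> ones j" and j': "j' < 3 ^ k" "U' \<subseteq> ones j'" and i: "i < k"
    and D: "leads j U i = {}" "leads j' U' i = {1, 2}"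
    and above: "\<And>l. i < l \<Longrightarrow> l < k \<Longrightarrow> leads j U l = leads j' U' l"
  defines "h \<equiv> mk (\<lambda>l. if l = i then 2 else 1) (\<lambda>_ _. 0)"
  shows "h \<in> N.stab (block j U)" "h \<in> N.stab (block j' U')"
    "N.val h (block j' U') = - N.val h (block j U)"
proof -
  have t: "tri h (\<lambda>l. if l = i then 2 else 1) (\<lambda>_ _. 0)"
    unfolding h_def by (rule mk_tri) simp
  have hn: "h \<in> nor" by (rule norI[OF t])
  have e: "eps h l = (if l = i then 2 else 1)" if "l < k" for l using tri_eps[OF t that] .
  have o: "off h l r = 0" if "l < k" "r < 3 ^ l" for l r
    using tri_off[OF t that] by simp
  have dgh: "dg l (h x) = ((if l = i then 2 else 1) * dg l x) mod 3" if "l < k" "x < 3 ^ k" for l x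
    using t that by (simp add: tri_def)
  have modh: "h x mod 3 ^ l = x mod 3 ^ l" if "l \<le> i" "x < 3 ^ k" for l x
    using that i by (intro dg_eq_imp_mod_eq) (simp add: dgh)
  have notin: "i \<notin> ones j" "i \<notin> ones j'"
    using D by (auto simp: leads_def ones_def split: if_splits)
  show "h \<in> N.stab (block j U)"
    by (rule stab_block[OF hn j]) (use notin in \<open>auto simp: e ones_def\<close>)
  show "h \<in> N.stab (block j' U')"
    by (rule stab_block[OF hn j']) (use notin in \<open>auto simp: e ones_def\<close>)
  let ?s = "star h"
  have sbelow: "?s y = y" if y: "y < 3 ^ k" "lev y < i" for y
  proof -
    have "?s y = lead y mod 3 * 3 ^ lev y + rest y"
      using y i rest_less[of y] rest_small[of y] by (simp add: star_def e modh)
    moreover have "lead y mod 3 = lead y" using lead_cases[of y] by (cases "y = 0") auto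
    ultimately show ?thesis using lead_rest[of y] by simp
  qed
  have slev: "?s (d * 3 ^ i + r) = (2 * d) mod 3 * 3 ^ i + r" if d: "d = 1 \<or> d = 2" "r < 3 ^ i" for d r
    using code_less[OF d i] lev_code[OF d] i modh[of i r] less_pow[OF d(2)] d(2) by (simp add: star_def e)
  have co: "cocycle h y = 1" if "y < 3 ^ k" for y
    using lev_less[OF that] rest_less[of y] by (simp add: cocycle_def o)
  let ?B = "block j U" and ?B' = "block j' U'"
  \<comment> \<open>All waves of level \<open>i\<close> as two intervals of numbers, those of lead 1
    and those of lead 2.\<close>
  define L where "L = {3 ^ i..<3 ^ i + 3 ^ i} \<union> {2 * 3 ^ i..<2 * 3 ^ i + (3 ^ i :: nat)}"
  have memL: "y \<in> L \<longleftrightarrow> 0 < y \<and> y < 3 ^ k \<and> lev y = i" for y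
  proof
    assume "y \<in> L"
    then obtain d r where d: "d = 1 \<or> d = 2" "r < 3 ^ i" "y = d * 3 ^ i + r"
      unfolding L_def
    proof
      assume "y \<in> {3 ^ i..<3 ^ i + 3 ^ i}"
      then show thesis by (intro that[of 1 "y - 3 ^ i"]) auto
    next
      assume "y \<in> {2 * 3 ^ i..<2 * 3 ^ i + 3 ^ i}"
      then show thesis by (intro that[of 2 "y - 2 * 3 ^ i"]) auto
    qed
    then show "0 < y \<and> y < 3 ^ k \<and> lev y = i" using lev_code[OF d(1,2)] code_less[OF d(1,2) i] by auto
  next
    assume y: "0 < y \<and> y < 3 ^ k \<and> lev y = i"
    then show "y \<in> L" using lead_cases[of y] lead_rest[of y] rest_less[of y] by (auto simp: L_def)
  qed
  have split: "restrict_id ?s ?B' = restrict_id ?s ?B \<circ> restrict_id ?s L"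
  proof (rule HOL.ext)
    fix y
    consider "y = 0 \<or> \<not> y < 3 ^ k" | "0 < y" "y < 3 ^ k" "lev y < i" | "0 < y" "y < 3 ^ k" "lev y = i"
      | "0 < y" "y < 3 ^ k" "i < lev y" by linarith
    then show "restrict_id ?s ?B' y = (restrict_id ?s ?B \<circ> restrict_id ?s L) y"
    proof cases
      case 1
      then have "y \<notin> ?B" "y \<notin> ?B'" "y \<notin> L" using memL by (auto simp: block_def)
      then show ?thesis by simp
    next
      case 2
      then show ?thesis using memL[of y] sbelow by (simp add: restrict_id_def)
    next
      case 3
      have "y \<in> ?B'" using 3 lead_cases[of y] D(2) by (auto simp: block_def)
      moreover have "?s y \<notin> ?B" using star_code[OF hn 3(2)] 3 D(1) by (simp add: block_def)
      ultimately show ?thesis using memL[of y] 3 by simp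
    next
      case 4
      have "lev y < k" using lev_less 4 by simp
      then have "y \<in> ?B \<longleftrightarrow> y \<in> ?B'" using above[OF 4(3)] by (simp add: block_def)
      then show ?thesis using memL[of y] 4 by (simp add: restrict_id_def)
    qed
  qed
  define sw where "sw = block_swap (3 ^ i) (2 * 3 ^ i) (3 ^ i)"
  have rL: "restrict_id ?s L = sw"
  proof (rule HOL.ext)
    fix y
    consider r where "r < 3 ^ i" "y = 1 * 3 ^ i + r" | r where "r < 3 ^ i" "y = 2 * 3 ^ i + r" | "y \<notin> L"
    proof (cases "y \<in> L")
      case True
      then show thesis unfolding L_def
      proof
        assume "y \<in> {3 ^ i..<3 ^ i + 3 ^ i}"
        then show thesis by (intro that(1)[of "y - 3 ^ i"]) auto
      next
        assume "y \<in> {2 * 3 ^ i..<2 * 3 ^ i + 3 ^ i}"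
        then show thesis by (intro that(2)[of "y - 2 * 3 ^ i"]) auto
      qed
    qed (rule that(3))
    then show "restrict_id ?s L y = sw y"
    proof cases
      case 1
      then have "y \<in> L" by (simp add: L_def)
      then show ?thesis using slev[of 1 r] 1 by (simp add: sw_def block_swap_def)
    next
      case 2
      then have "y \<in> L" by (simp add: L_def)
      then show ?thesis using slev[of 2 r] 2 by (simp add: sw_def block_swap_def)
    next
      case 3
      then show ?thesis by (auto simp: sw_def block_swap_def L_def)
    qed
  qed
  have sw: "sw permutes {..<2 * 3 ^ i + 3 ^ i}" "sign sw = (-1) ^ (3 ^ i)"
    using sign_block_swap[of "3 ^ i" "3 ^ i" "2 * 3 ^ i"] unfolding sw_def by auto
  have "permutation (restrict_id ?s ?B)"
    using N.stab_bij[OF \<open>h \<in> N.stab ?B\<close>] finite_subset[OF block_sub'] permutes_restrict_id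
    by (auto intro!: permutes_imp_permutation[of ?B])
  then have "sign (restrict_id ?s ?B') = sign (restrict_id ?s ?B) * sign sw"
    unfolding split rL using sw(1) permutes_imp_permutation[of "{..<2 * 3 ^ i + 3 ^ i}" sw]
    by (intro sign_compose) auto
  also have "sign sw = -1" using sw(2) by simp
  finally have sgn: "sign_on ?B' ?s = - sign_on ?B ?s" by (simp add: sign_on_def)
  have "(\<Prod>y\<in>C. cocycle h y) = 1" if "C \<subseteq> {..<3 ^ k}" for C
    using that co by (intro prod.neutral) auto
  then show "N.val h ?B' = - N.val h ?B"
    by (simp add: N.val_def sgn block_sub')
qed

text \<open>The leads on a level sum to 0, 1, 2 or 3, so rotations separate all choices except none
  from all. In that remaining case the inversion of the digit gives values of opposite sign.\<close>

lemma pairing_blocks: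
  assumes j: "j < 3 ^ k" "U \<subseteq> ones j" and j': "j' < 3 ^ k" "U' \<subseteq> ones j'"
    and ne: "block j U \<noteq> block j' U'"
  shows "N.pairing (block j U) (block j' U') = 0"
proof (cases "\<exists>i<k. (\<Sum>(leads j U i)) mod 3 \<noteq> (\<Sum>(leads j' U' i)) mod 3")
  case True
  then obtain i where i: "i < k" and ni: "(\<Sum>(leads j U i)) mod 3 \<noteq> (\<Sum>(leads j' U' i)) mod 3" by blast
  define h where "h = mk (\<lambda>_. 1) (\<lambda>l r. if l = i \<and> r = 0 then 1 else 0)"
  note v = val_rotation[OF j i, folded h_def] and v' = val_rotation[OF j' i, folded h_def]
  have hh: "h \<otimes>\<^bsub>norg\<^esub> h = h \<circ> h" by (simp add: norg_simps)
  show ?thesis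
  proof (rule N.pairing_zero[OF block_sub' block_sub'])
    show "h \<circ> h \<in> N.stab (block j U)" using N.stab_mult[OF v(1) v(1)] by (simp only: hh)
    show "h \<circ> h \<in> N.stab (block j' U')" using N.stab_mult[OF v'(1) v'(1)] by (simp only: hh)
    let ?S = "\<Sum>(leads j U i)" and ?S' = "\<Sum>(leads j' U' i)"
    have "(?S + 2 * ?S') mod 3 \<noteq> 0" using ni by presburger
    then show "N.val (h \<circ> h) (block j U) * cnj (N.val (h \<circ> h) (block j' U')) \<noteq> 1"
      unfolding v(2) v'(2) cnj_omega_power power_add[symmetric] omega_eq_1_iff .
  qed
next
  case False
  let ?E = "{i. i < k \<and> leads j U i \<noteq> leads j' U' i}"
  have "?E \<noteq> {}" using ne block_eqI[of j U j' U'] by blast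
  moreover have finE: "finite ?E" by simp
  \<comment> \<open>The highest differing level is taken because \<open>val_flip\<close> needs
    agreement above it; below it the sets may differ.\<close>
  ultimately have "Max ?E \<in> ?E" by (rule Max_in[rotated])
  then obtain i where i: "i = Max ?E" "i < k" "leads j U i \<noteq> leads j' U' i" by blast
  have above: "leads j U l = leads j' U' l" if "i < l" "l < k" for l
    using that Max_ge[OF finE, of l] i(1) by (metis (mono_tags, lifting) leD mem_Collect_eq)
  have poss: "leads j U i = {} \<or> leads j U i = {1} \<or> leads j U i = {2} \<or> leads j U i = {1, 2}" for j U i
    by (simp add: leads_def)
  have "(\<Sum>(leads j U i)) mod 3 = (\<Sum>(leads j' U' i)) mod 3" using False i by blast
  then have "leads j U i = {} \<and> leads j' U' i = {1, 2} \<or> leads j U i = {1, 2} \<and> leads j' U' i = {}"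
    using poss[of j U i] poss[of j' U' i] i(3) by (elim disjE) simp_all
  then show ?thesis
  proof
    assume D: "leads j U i = {} \<and> leads j' U' i = {1, 2}"
    define h where "h = mk (\<lambda>l. if l = i then 2 else 1) (\<lambda>_ _. 0)"
    note v = val_flip[OF j j' i(2) conjunct1[OF D] conjunct2[OF D] above, folded h_def]
    show ?thesis
    proof (rule N.pairing_zero[OF block_sub' block_sub' v(1,2)])
      show "N.val h (block j U) * cnj (N.val h (block j' U')) \<noteq> 1"
      proof -
        have "N.val h (block j' U') = - N.val h (block j U)" by (rule v(3))
        then have "N.val h (block j U) * cnj (N.val h (block j' U')) = - (N.val h (block j U) * cnj (N.val h (block j U)))"
          by simp
        then show ?thesis by (simp only: N.val_norm[OF v(1) block_sub']) simp
      qed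
    qed
  next
    assume D: "leads j U i = {1, 2} \<and> leads j' U' i = {}"
    define h where "h = mk (\<lambda>l. if l = i then 2 else 1) (\<lambda>_ _. 0)"
    note v = val_flip[OF j' j i(2) conjunct2[OF D] conjunct1[OF D] above[symmetric], folded h_def]
    show ?thesis
    proof (rule N.pairing_zero[OF block_sub' block_sub' v(2,1)])
      show "N.val h (block j U) * cnj (N.val h (block j' U')) \<noteq> 1"
      proof -
        have "N.val h (block j U) = - N.val h (block j' U')" by (rule v(3))
        then have "N.val h (block j U) * cnj (N.val h (block j' U')) = - (N.val h (block j' U') * cnj (N.val h (block j' U')))"
          by simp
        then show ?thesis by (simp only: N.val_norm[OF v(1) block_sub']) simp
      qed
    qed
  qed
qed

section \<open>Orthonormality of the orbit characters and their occurrence in the restricted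
  hooks\<close>

definition theta :: "nat \<Rightarrow> (nat \<Rightarrow> nat) \<Rightarrow> complex"
  where "theta j = N.echar (orbit_fam j)"

text \<open>For different indices the sets have different sizes, so all pairings vanish. For equal
  indices only the diagonal pairs count; they form a single orbit, whose stabilizers add up to the
  group order.\<close>

lemma theta_orthonormal:
  assumes j: "j < 3 ^ k" and j': "j' < 3 ^ k"
  shows "cinner norg (theta j) (theta j') = (if j = j' then 1 else 0)"
proof -
  have zero: "N.pairing B B' = 0" if "B \<in> orbit_fam j" "B' \<in> orbit_fam j'" "B \<noteq> B'" for B B'
    using that pairing_blocks[OF j _ j'] by (auto simp: orbit_fam_def)
  have eq: "cinner norg (theta j) (theta j') =
      (\<Sum>B\<in>orbit_fam j. \<Sum>B'\<in>orbit_fam j'. N.pairing B B') / of_nat (card (carrier norg))"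
    unfolding theta_def by (rule N.cinner_echar[OF orbit_fam_invariant[OF j] orbit_fam_invariant[OF j']])
  show ?thesis
  proof (cases "j = j'")
    case False
    have "B \<noteq> B'" if "B \<in> orbit_fam j" "B' \<in> orbit_fam j'" for B B'
      using that False card_block[OF j] card_block[OF j'] by (auto simp: orbit_fam_def) metis
    then have "(\<Sum>B\<in>orbit_fam j. \<Sum>B'\<in>orbit_fam j'. N.pairing B B') = 0"
      using zero by (intro sum.neutral ballI) blast
    then show ?thesis using False by (simp add: eq)
  next
    case True
    have finF: "finite (orbit_fam j)" by (rule N.invariant_finite[OF orbit_fam_invariant[OF j]])
    have sub: "B \<subseteq> {..<3 ^ k}" if "B \<in> orbit_fam j" for B
      using that block_sub' by (auto simp: orbit_fam_def)
    have "(\<Sum>B\<in>orbit_fam j. \<Sum>B'\<in>orbit_fam j'. N.pairing B B') =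
        (\<Sum>B\<in>orbit_fam j. \<Sum>B'\<in>orbit_fam j. if B' = B then N.pairing B B else 0)"
      using zero True by (intro sum.cong refl) auto
    also have "\<dots> = (\<Sum>B\<in>orbit_fam j. N.pairing B B)"
      using finF by (intro sum.cong) auto
    also have "\<dots> = of_nat (\<Sum>B\<in>orbit_fam j. card (N.stab B))"
      unfolding of_nat_sum by (intro sum.cong refl N.pairing_self sub)
    also have "(\<Sum>B\<in>orbit_fam j. card (N.stab B)) =
        (\<Sum>(B, B')\<in>(\<lambda>B. (B, B)) ` orbit_fam j. card (N.stab B \<inter> N.stab B'))"
      by (subst sum.reindex) (auto simp: inj_on_def)
    also have "\<dots> = card (carrier norg)"
    proof (rule N.sum_stab_transitive)
      show "finite ((\<lambda>B. (B, B)) ` orbit_fam j)" using finF by simp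
      show "(block j {}, block j {}) \<in> (\<lambda>B. (B, B)) ` orbit_fam j" by (auto simp: orbit_fam_def)
      show "(star g ` B, star g ` B') \<in> (\<lambda>B. (B, B)) ` orbit_fam j"
        if "g \<in> carrier norg" "(B, B') \<in> (\<lambda>B. (B, B)) ` orbit_fam j" for g B B'
        using that orbit_fam_invariant[OF j] by (auto simp: N.invariant_def)
    next
      fix B B' assume "(B, B') \<in> (\<lambda>B. (B, B)) ` orbit_fam j"
      then obtain U where U: "U \<subseteq> ones j" "B = block j U" "B' = B" by (auto simp: orbit_fam_def)
      \<comment> \<open>Linear part 2 exactly on the levels in \<open>U\<close> carries the base set
        \<open>block j {}\<close> to \<open>block j U\<close>.\<close>
      define h where "h = mk (\<lambda>l. if l \<in> U then 2 else 1) (\<lambda>_ _. 0)"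
      have t: "tri h (\<lambda>l. if l \<in> U then 2 else 1) (\<lambda>_ _. 0)"
        unfolding h_def by (rule mk_tri) simp
      have hn: "h \<in> nor" by (rule norI[OF t])
      have "flipped h j {} = U"
        using U(1) tri_eps[OF t] by (auto simp: flipped_def ones_def split: if_splits)
      then have "star h ` block j {} = B" using star_block[OF hn j, of "{}"] U by simp
      then show "\<exists>g\<in>carrier norg. star g ` block j {} = B \<and> star g ` block j {} = B'"
        using hn U(3) by (auto simp: norg_simps)
    qed
    finally have S: "(\<Sum>B\<in>orbit_fam j. \<Sum>B'\<in>orbit_fam j'. N.pairing B B') = of_nat (card (carrier norg))" .
    have "card (carrier norg) \<noteq> 0"
      using norg_finite N.one_closed by (metis card_eq_0_iff empty_iff)
    then show ?thesis unfolding eq S using True by simp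
  qed
qed

lemma theta_one: "j < 3 ^ k \<Longrightarrow> theta j id = of_nat (2 ^ card (ones j))"
  using N.echar_one[OF orbit_fam_invariant] by (simp add: theta_def norg_simps card_orbit_fam)

lemma theta_Irr:
  assumes j: "j < 3 ^ k"
  shows "theta j \<in> Irr norg"
proof -
  obtain M where M: "set_mset M \<subseteq> Irr norg" "\<forall>g\<in>carrier norg. theta j g = (\<Sum>\<phi>\<in>#M. \<phi> g)"
    using N.echar_rep[OF orbit_fam_invariant[OF j]] unfolding theta_def by blast
  show ?thesis
  proof (rule virtual_character_irreducible[OF norg_group norg_finite M(1), of "{#}"])
    show "theta j g = (\<Sum>\<phi>\<in>#M. \<phi> g) - (\<Sum>\<phi>\<in>#{#}. \<phi> g)" if "g \<in> carrier norg" for g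
      using M(2) that by simp
    show "cinner norg (theta j) (theta j) = 1" using theta_orthonormal[OF j j] by simp
    show "0 < Re (theta j \<one>\<^bsub>norg\<^esub>)" using theta_one[OF j] by (simp add: norg_simps)
    show "theta j g = undefined" if "g \<notin> carrier norg" for g
      using that by (simp add: theta_def N.echar_def)
  qed simp
qed

lemma theta_Irr_p':
  assumes "j < 3 ^ k"
  shows "theta j \<in> Irr_p' 3 norg"
proof -
  have "coprime (2::nat) 3" by (simp add: coprime_3_iff)
  then have "coprime ((2::nat) ^ card (ones j)) 3" by simp
  then show ?thesis
    using theta_Irr[OF assms] theta_one[OF assms] by (auto simp: Irr_p'_def norg_simps intro!: exI[of _ "2 ^ card (ones j)"])
qed

lemma theta_inj: "inj_on theta {..<3 ^ k}"
proof (rule inj_onI)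
  fix i j assume ij: "i \<in> {..<3 ^ k}" "j \<in> {..<3 ^ k}" "theta i = theta j"
  then have "cinner norg (theta i) (theta j) = 1"
    using theta_orthonormal[of i i] by simp
  then show "i = j" using theta_orthonormal[of i j] ij by (auto split: if_splits)
qed

text \<open>The complement of the orbit in \<open>family j\<close> is invariant as well, so its
  decomposition supplies the remaining constituents.\<close>

lemma theta_constituent:
  assumes j: "j < 3 ^ k"
  shows "irreducible_constituent norg (theta j) (restrict (hook (3 ^ k) j) nor)"
proof -
  define F where "F = family j - orbit_fam j"
  have inv: "N.invariant F"
    unfolding N.invariant_def
  proof (intro conjI ballI)
    fix B assume "B \<in> F"
    then show "B \<subseteq> {..<3 ^ k}" by (auto simp: F_def family_def)
  next
    fix g B assume g: "g \<in> carrier norg" and B: "B \<in> F"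
    have "star g ` B \<notin> orbit_fam j"
    proof
      assume "star g ` B \<in> orbit_fam j"
      then have "star (inv\<^bsub>norg\<^esub> g) ` star g ` B \<in> orbit_fam j"
        using orbit_fam_invariant[OF j] N.inv_closed[OF g] unfolding N.invariant_def by blast
      then show False using N.image_\<pi>_inv[OF g] B by (simp add: F_def)
    qed
    then show "star g ` B \<in> F"
      using g B family_invariant[of j] by (auto simp: F_def N.invariant_def)
  qed
  obtain M where M: "set_mset M \<subseteq> Irr norg" "\<forall>g\<in>carrier norg. N.echar F g = (\<Sum>\<phi>\<in>#M. \<phi> g)"
    using N.echar_rep[OF inv] by blast
  have fam: "family j = orbit_fam j \<union> F" using orbit_fam_sub[OF j] by (auto simp: F_def)
  have "restrict (hook (3 ^ k) j) nor g = (\<Sum>\<phi>\<in>#add_mset (theta j) M. \<phi> g)" if g: "g \<in> carrier norg" for g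
  proof -
    have gn: "g \<in> nor" using g by (simp add: norg_simps)
    have "hook (3 ^ k) j g = N.echar (orbit_fam j \<union> F) g" using hook_nor[OF gn] by (simp only: fam[symmetric])
    also have "\<dots> = theta j g + N.echar F g"
      unfolding theta_def by (rule N.echar_Un[OF orbit_fam_invariant[OF j] inv _ g]) (auto simp: F_def)
    finally show ?thesis using M(2) g gn by simp
  qed
  then show ?thesis
    unfolding irreducible_constituent_def
    using M(1) theta_Irr[OF j] by (intro exI[of _ "add_mset (theta j) M"]) auto
qed

end

section \<open>The normalizer of the Sylow subgroup\<close>

lemma normalizer_iff:
  fixes G (structure)
  assumes "H \<subseteq> carrier G"
  shows "g \<in> normalizer G H \<longleftrightarrow> g \<in> carrier G \<and> (\<lambda>x. g \<otimes> x \<otimes> inv g) ` H = H"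
proof -
  have "g <# H #> inv g = (\<lambda>x. g \<otimes> x \<otimes> inv g) ` H"
    unfolding l_coset_def r_coset_def by auto
  then show ?thesis using assms by (simp add: normalizer_def stabilizer_def)
qed

lemma periodic_sum:
  fixes f :: "nat \<Rightarrow> nat"
  assumes "\<And>x. f (x + m) = f x"
  shows "(\<Sum>t<m. f (x + t)) = (\<Sum>t<m. f t)"
proof (induction x)
  case (Suc x)
  have "(\<Sum>t<m. f (Suc x + t)) + f x = (\<Sum>t<Suc m. f (x + t))"
    unfolding sum.lessThan_Suc_shift by simp
  also have "\<dots> = (\<Sum>t<m. f (x + t)) + f x" using assms[of x] by simp
  finally show ?case using Suc by simp
qed simp

context ternary
begin

lemma cyc_nor: "cyc \<in> nor" "cyc \<in> syl"
  by (rule norI[OF cyc_tri], rule sylI[OF cyc_tri]) simp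

lemma cyc_pow_nor: "cyc ^^ m \<in> nor"
proof (induction m)
  case 0
  show ?case using norI[OF id_tri] by (simp only: funpow.simps)
next
  case (Suc m)
  show ?case unfolding funpow.simps by (rule norI[OF nor_compose_tri[OF cyc_nor(1) Suc]])
qed

text \<open>After 3^i steps the digits below \<open>i\<close> of the orbit point have returned and
  digit \<open>i\<close> has grown by a fixed amount \<open>S i\<close>. Hence digit
  \<open>i\<close> is affine in digit \<open>i\<close> of the time \<open>x\<close>, with linear
  part \<open>S i\<close> and a translation part depending on the lower digits of
  \<open>x\<close>.\<close>

lemma orbit_map_in_nor:
  assumes t: "t \<in> syl" and h: "h permutes {..<3 ^ k}"
    and orb: "\<And>x. x < 3 ^ k \<Longrightarrow> h x = (t ^^ x) 0"
  shows "h \<in> nor"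
proof -
  define u where "u x = (t ^^ x) 0" for x
  have tn: "t \<in> nor" and t1: "\<And>i. i < k \<Longrightarrow> eps t i = 1" using t by (auto simp: syl_def)
  have u_less: "u x < 3 ^ k" for x
    by (induction x) (simp_all add: u_def nor_less[OF tn])
  have step: "dg i (u (Suc x)) = (dg i (u x) + off t i (u x mod 3 ^ i)) mod 3" if "i < k" for i x
  proof -
    have "u (Suc x) = t (u x)" by (simp add: u_def)
    then show ?thesis using norD(3)[OF tn that u_less, of x] t1[OF that] by (simp only: mult_1)
  qed
  have steps: "dg i (u (x + m)) = (dg i (u x) + (\<Sum>s<m. off t i (u (x + s) mod 3 ^ i))) mod 3"
    if "i < k" for i x m
  proof (induction m)
    case (Suc m)
    have "dg i (u (x + Suc m)) = (dg i (u (x + m)) + off t i (u (x + m) mod 3 ^ i)) mod 3"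
      using step[OF that, of "x + m"] by simp
    then show ?case unfolding Suc by (simp add: mod_simps add.assoc)
  qed simp
  define S where "S i = (\<Sum>s<3 ^ i. off t i (u s mod 3 ^ i))" for i
  have per: "dg i (u (x + 3 ^ i)) = (dg i (u x) + S i) mod 3"
    if "i < k" and A: "\<And>x. u (x + 3 ^ i) mod 3 ^ i = u x mod 3 ^ i" for i x
    unfolding S_def steps[OF that(1)]
    by (subst periodic_sum[where f = "\<lambda>s. off t i (u s mod 3 ^ i)"]) (simp_all only: A)
  have iter: "u (x + q * 3 ^ i) mod 3 ^ i = u x mod 3 ^ i \<and>
      (i < k \<longrightarrow> dg i (u (x + q * 3 ^ i)) = (dg i (u x) + q * S i) mod 3)"
    if A: "\<And>x. u (x + 3 ^ i) mod 3 ^ i = u x mod 3 ^ i" for i x q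
  proof (induction q)
    case (Suc q)
    have e: "x + Suc q * 3 ^ i = (x + q * 3 ^ i) + 3 ^ i" by simp
    show ?case
      using Suc per[OF _ A, of "x + q * 3 ^ i"] A[of "x + q * 3 ^ i"]
      unfolding e by (auto simp: mod_simps algebra_simps)
  qed simp
  have A: "u (x + 3 ^ i) mod 3 ^ i = u x mod 3 ^ i" if "i \<le> k" for i x
    using that
  proof (induction i arbitrary: x)
    case (Suc i)
    then have i: "i < k" and B: "\<And>x. u (x + 3 ^ i) mod 3 ^ i = u x mod 3 ^ i" by auto
    have "u (x + 3 * 3 ^ i) mod 3 ^ i = u x mod 3 ^ i" "dg i (u (x + 3 * 3 ^ i)) = dg i (u x)"
      using iter[OF B, of x 3] i by simp_all
    then show ?case unfolding power_Suc[of 3 i] by (simp only: mod_3_Suc power_Suc[symmetric])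
  qed simp
  have dgu: "dg i (u x) = (S i * dg i x + dg i (u (x mod 3 ^ i))) mod 3" if "i < k" for i x
  proof -
    have "x mod 3 ^ i + (x div 3 ^ i) * 3 ^ i = x" by (rule mod_div_mult_eq)
    then have "dg i (u x) = (dg i (u (x mod 3 ^ i)) + (x div 3 ^ i) * S i) mod 3"
      using iter[OF A, of i "x mod 3 ^ i" "x div 3 ^ i"] that by simp
    also have "\<dots> = (S i * (x div 3 ^ i) + dg i (u (x mod 3 ^ i))) mod 3" by (simp only: mult.commute add.commute)
    finally show ?thesis unfolding dg_def[of i x] by (simp only: mod_3_affine)
  qed
  \<comment> \<open>If \<open>S i\<close> vanished modulo 3, the orbit would show at most 3^i
    residues modulo 3^(i + 1), while \<open>h\<close> is onto.\<close>
  have S: "S i mod 3 = 1 \<or> S i mod 3 = 2" if i: "i < k" for i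
  proof (rule ccontr)
    assume "\<not> ?thesis"
    then have "S i mod 3 = 0" by presburger
    then have D: "dg i (u x) = dg i (u (x mod 3 ^ i))" for x
      using dgu[OF i, of x] mod_3_affine(2)[of "S i" "dg i x"] by simp
    have low: "u x mod 3 ^ i = u (x mod 3 ^ i) mod 3 ^ i" for x
      using iter[OF A, of i "x mod 3 ^ i" "x div 3 ^ i"] i by (simp only: mod_div_mult_eq less_imp_le simp_thms)
    have "{..<3 ^ Suc i} \<subseteq> (\<lambda>r. u r mod 3 ^ Suc i) ` {..<3 ^ i}"
    proof
      fix y :: nat assume y: "y \<in> {..<3 ^ Suc i}"
      then have yk: "y \<in> {..<3 ^ k}" using less_pow[of y "Suc i"] i by simp
      then have "y \<in> h ` {..<3 ^ k}" using permutes_image[OF h] by simp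
      then obtain x where x: "y = u x" using orb by (auto simp: u_def)
      have "u x mod 3 ^ Suc i = u (x mod 3 ^ i) mod 3 ^ Suc i"
        unfolding mod_3_Suc using D[of x] low[of x] by simp
      then have "y = u (x mod 3 ^ i) mod 3 ^ Suc i" using x y by simp
      then show "y \<in> (\<lambda>r. u r mod 3 ^ Suc i) ` {..<3 ^ i}" by simp
    qed
    then have "card {..<(3::nat) ^ Suc i} \<le> card {..<(3::nat) ^ i}"
      by (meson card_image_le card_mono finite_imageI finite_lessThan le_trans)
    then show False by simp
  qed
  have "tri h (\<lambda>i. S i mod 3) (\<lambda>i r. dg i (u r))"
    unfolding tri_def
  proof (intro conjI allI impI h S)
    fix i x assume i: "i < k" and x: "x < (3::nat) ^ k"
    have "h x = u x" using orb[OF x] by (simp add: u_def)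
    then show "dg i (h x) = (S i mod 3 * dg i x + dg i (u (x mod 3 ^ i))) mod 3"
      using dgu[OF i, of x] by (simp only: mod_3_affine)
  qed
  then show ?thesis by (rule norI)
qed

text \<open>If \<open>g\<close> normalizes, then \<open>t = g cyc g\<inverse>\<close> is again a long cycle of the Sylow subgroup, and up to a
  power of \<open>cyc\<close> the map \<open>g\<close> enumerates the orbit of \<open>0\<close> under \<open>t\<close>.\<close>

lemma normalizes_imp_nor:
  assumes g: "g permutes {..<3 ^ k}" and t: "g \<circ> cyc \<circ> inv' g \<in> syl"
  shows "g \<in> nor"
proof -
  define a where "a = inv' g 0"
  have "inv' g permutes {..<3 ^ k}" using g by (rule permutes_inv)
  then have a: "a < 3 ^ k" using permutes_in_image[of "inv' g" "{..<3 ^ k}" 0] by (simp add: a_def)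
  have pow: "((g \<circ> cyc \<circ> inv' g) ^^ x) y = g ((cyc ^^ x) (inv' g y))" for x y
  proof (induction x)
    case 0
    show ?case using permutes_inverses(1)[OF g] by simp
  next
    case (Suc x)
    then show ?case using permutes_inverses(2)[OF g] by simp
  qed
  have "g \<circ> cyc ^^ a \<in> nor"
  proof (rule orbit_map_in_nor[OF t])
    show "g \<circ> cyc ^^ a permutes {..<3 ^ k}"
      using norD(1)[OF cyc_pow_nor] g by (rule permutes_compose)
    show "(g \<circ> cyc ^^ a) x = ((g \<circ> cyc \<circ> inv' g) ^^ x) 0" if "x < 3 ^ k" for x
      unfolding pow a_def[symmetric] using a that by (simp add: cyc_pow add.commute)
  qed
  then have "g \<circ> cyc ^^ a \<circ> cyc ^^ (3 ^ k - a) \<in> nor"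
    using norI[OF nor_compose_tri[OF _ cyc_pow_nor]] by blast
  moreover have "cyc ^^ a \<circ> cyc ^^ (3 ^ k - a) = id"
    using a by (simp only: funpow_add[symmetric] cyc_order le_add_diff_inverse less_imp_le)
  ultimately show ?thesis by (simp only: comp_assoc comp_id)
qed

text \<open>Linear parts are multiplicative and those of \<open>s\<close> are 1, so the conjugate
  has the linear parts of \<open>g\<close> composed with its inverse.\<close>

lemma conj_syl:
  assumes g: "g \<in> nor" and s: "s \<in> syl"
  shows "g \<circ> s \<circ> inv' g \<in> syl"
proof -
  note g' = inv_nor[OF g]
  have sn: "s \<in> nor" and s1: "\<And>i. i < k \<Longrightarrow> eps s i = 1" using s by (auto simp: syl_def)
  have gs: "g \<circ> s \<in> nor" by (rule norI[OF nor_compose_tri[OF g sn]])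
  have "eps (g \<circ> s \<circ> inv' g) i = 1" if i: "i < k" for i
  proof -
    have "eps (g \<circ> s) i = eps g i"
      using eps_compose[OF g sn i] s1[OF i] norD(2)[OF g i] by auto
    then have "eps (g \<circ> s \<circ> inv' g) i = eps (g \<circ> inv' g) i"
      unfolding eps_compose[OF gs g' i] eps_compose[OF g g' i] by simp
    also have "g \<circ> inv' g = id" by (rule permutes_inv_o(1)[OF norD(1)[OF g]])
    also have "eps id i = 1" using tri_eps[OF id_tri i] .
    finally show ?thesis .
  qed
  then show ?thesis using norI[OF nor_compose_tri[OF gs g']] by (simp add: syl_def)
qed

lemma normalizer_syl: "normalizer (symg (3 ^ k)) syl = nor"
proof -
  have sub: "syl \<subseteq> carrier (symg (3 ^ k))" by (rule subgroup.subset[OF syl_subgroup])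
  have fin: "finite syl" using sub symg_finite by (rule finite_subset)
  show ?thesis
  proof (rule Set.set_eqI)
    fix g
    have "(\<lambda>s. g \<circ> s \<circ> inv' g) ` syl = syl \<longleftrightarrow> g \<in> nor" if g: "g permutes {..<3 ^ k}"
    proof
      assume "(\<lambda>s. g \<circ> s \<circ> inv' g) ` syl = syl"
      then have "g \<circ> cyc \<circ> inv' g \<in> syl" using cyc_nor(2) by (metis imageI)
      then show "g \<in> nor" by (rule normalizes_imp_nor[OF g])
    next
      assume gn: "g \<in> nor"
      show "(\<lambda>s. g \<circ> s \<circ> inv' g) ` syl = syl"
      proof (rule endo_inj_surj[OF fin])
        show "(\<lambda>s. g \<circ> s \<circ> inv' g) ` syl \<subseteq> syl" using conj_syl[OF gn] by (rule image_subsetI)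
        show "inj_on (\<lambda>s. g \<circ> s \<circ> inv' g) syl"
        proof (rule inj_onI)
          fix s t assume eq: "g \<circ> s \<circ> inv' g = g \<circ> t \<circ> inv' g"
          have "inv' g \<circ> (g \<circ> s \<circ> inv' g) \<circ> g = (inv' g \<circ> g) \<circ> s \<circ> (inv' g \<circ> g)" for s
            by (simp only: comp_assoc)
          then have "inv' g \<circ> (g \<circ> s \<circ> inv' g) \<circ> g = s" for s
            by (simp only: permutes_inv_o(2)[OF g] comp_id id_comp)
          then show "s = t" using eq by metis
        qed
      qed
    qed
    moreover have "(\<lambda>s. g \<otimes>\<^bsub>symg (3 ^ k)\<^esub> s \<otimes>\<^bsub>symg (3 ^ k)\<^esub> inv\<^bsub>symg (3 ^ k)\<^esub> g) ` syl = (\<lambda>s. g \<circ> s \<circ> inv' g) ` syl"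
      if "g permutes {..<3 ^ k}"
      using symg_inv[OF that] by (simp only: symg_simps)
    ultimately show "g \<in> normalizer (symg (3 ^ k)) syl \<longleftrightarrow> g \<in> nor"
      unfolding normalizer_iff[OF sub] using norD(1)[of g] by (auto simp: symg_simps)
  qed
qed

section \<open>All characters of degree prime to 3\<close>

lemma Irr_p'_symg: "Irr_p' 3 (symg (3 ^ k)) = hook (3 ^ k) ` {..<3 ^ k}"
proof (rule Irr_p'_eqI[where \<sigma> = cyc and k = k])
  interpret group "symg (3 ^ k)" by (rule symg_group)
  show "group (symg (3 ^ k))" "finite (carrier (symg (3 ^ k)))" by (rule symg_group symg_finite)+
  show "cyc \<in> carrier (symg (3 ^ k))" using norD(1)[OF cyc_nor(1)] by (simp add: symg_simps)
  show "cyc [^]\<^bsub>symg (3 ^ k)\<^esub> ((3::nat) ^ k) = \<one>\<^bsub>symg (3 ^ k)\<^esub>"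
    unfolding symg_pow cyc_order by (simp add: symg_simps)
  show "\<exists>h\<in>carrier (symg (3 ^ k)). h \<otimes>\<^bsub>symg (3 ^ k)\<^esub> cyc \<otimes>\<^bsub>symg (3 ^ k)\<^esub> inv\<^bsub>symg (3 ^ k)\<^esub> h = cyc [^]\<^bsub>symg (3 ^ k)\<^esub> a"
    if a: "coprime a 3" for a :: nat
  proof (rule bexI[of _ "scl a"])
    have p: "scl a permutes {..<3 ^ k}" using scl_tri[OF a] by (simp add: tri_def)
    then show "scl a \<in> carrier (symg (3 ^ k))" by (simp add: symg_simps)
    show "scl a \<otimes>\<^bsub>symg (3 ^ k)\<^esub> cyc \<otimes>\<^bsub>symg (3 ^ k)\<^esub> inv\<^bsub>symg (3 ^ k)\<^esub> scl a = cyc [^]\<^bsub>symg (3 ^ k)\<^esub> a"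
      using scl_conj_cyc[OF a] symg_inv[OF p] by (simp only: symg_simps symg_pow)
  qed
  show "card {g \<in> carrier (symg (3 ^ k)). g \<otimes>\<^bsub>symg (3 ^ k)\<^esub> cyc = cyc \<otimes>\<^bsub>symg (3 ^ k)\<^esub> g} \<le> 3 ^ k"
    using centralizer_cyc[OF subset_refl] by (simp only: symg_simps mem_Collect_eq)
qed (simp_all add: hook_Irr_p' hook_inj)

lemma Irr_p'_norg: "Irr_p' 3 norg = theta ` {..<3 ^ k}"
proof (rule Irr_p'_eqI[where \<sigma> = cyc and k = k])
  interpret S: group "symg (3 ^ k)" by (rule symg_group)
  have pow: "g [^]\<^bsub>norg\<^esub> m = g ^^ m" for g :: "nat \<Rightarrow> nat" and m :: nat
    using symg_pow[where n = "3 ^ k" and g = g and m = m] by (simp add: norg_def nat_pow_def)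
  show "group norg" "finite (carrier norg)" by (rule norg_group norg_finite)+
  show "cyc \<in> carrier norg" using cyc_nor(1) by (simp add: norg_simps)
  show "cyc [^]\<^bsub>norg\<^esub> ((3::nat) ^ k) = \<one>\<^bsub>norg\<^esub>"
    unfolding pow cyc_order by (simp add: norg_simps)
  show "\<exists>h\<in>carrier norg. h \<otimes>\<^bsub>norg\<^esub> cyc \<otimes>\<^bsub>norg\<^esub> inv\<^bsub>norg\<^esub> h = cyc [^]\<^bsub>norg\<^esub> a"
    if a: "coprime a 3" for a :: nat
  proof (rule bexI[of _ "scl a"])
    have n: "scl a \<in> nor" by (rule norI[OF scl_tri[OF a]])
    then show "scl a \<in> carrier norg" by (simp add: norg_simps)
    have "inv\<^bsub>norg\<^esub> scl a = inv' (scl a)"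
      using S.m_inv_consistent[OF nor_subgroup n] symg_inv[OF norD(1)[OF n]] by (simp add: norg_def)
    then show "scl a \<otimes>\<^bsub>norg\<^esub> cyc \<otimes>\<^bsub>norg\<^esub> inv\<^bsub>norg\<^esub> scl a = cyc [^]\<^bsub>norg\<^esub> a"
      using scl_conj_cyc[OF a] by (simp only: norg_simps pow)
  qed
  have "nor \<subseteq> {g. g permutes {..<3 ^ k}}" using norD(1) by blast
  then show "card {g \<in> carrier norg. g \<otimes>\<^bsub>norg\<^esub> cyc = cyc \<otimes>\<^bsub>norg\<^esub> g} \<le> 3 ^ k"
    using centralizer_cyc by (simp only: norg_simps)
qed (simp_all add: theta_Irr_p' theta_inj)

text \<open>The explicit rule is \<open>hook j\<close> to \<open>theta j\<close> for each j <
  3^k.\<close>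

lemma ternary_bijection:
  "\<exists>\<Phi>. bij_betw \<Phi> (Irr_p' 3 (symg (3 ^ k))) (Irr_p' 3 (normalizer_group (symg (3 ^ k)) syl)) \<and>
    (\<forall>\<chi> \<in> Irr_p' 3 (symg (3 ^ k)). irreducible_constituent (normalizer_group (symg (3 ^ k)) syl) (\<Phi> \<chi>)
      (restrict \<chi> (normalizer (symg (3 ^ k)) syl)))"
proof (intro exI conjI ballI)
  let ?idx = "inv_into {..<3 ^ k} (hook (3 ^ k))"
  have eq: "normalizer_group (symg (3 ^ k)) syl = norg" by (simp only: normalizer_syl norg_def)
  have idx: "bij_betw ?idx (Irr_p' 3 (symg (3 ^ k))) {..<3 ^ k}"
    unfolding Irr_p'_symg by (rule bij_betw_inv_into[OF inj_on_imp_bij_betw[OF hook_inj]])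
  show "bij_betw (theta \<circ> ?idx) (Irr_p' 3 (symg (3 ^ k))) (Irr_p' 3 (normalizer_group (symg (3 ^ k)) syl))"
    unfolding eq Irr_p'_norg by (rule bij_betw_trans[OF idx inj_on_imp_bij_betw[OF theta_inj]])
  fix \<chi> assume \<chi>: "\<chi> \<in> Irr_p' 3 (symg (3 ^ k))"
  then obtain j where j: "j < 3 ^ k" "\<chi> = hook (3 ^ k) j" unfolding Irr_p'_symg by auto
  have "?idx \<chi> = j" using j hook_inj by (simp add: inv_into_f_f)
  then show "irreducible_constituent (normalizer_group (symg (3 ^ k)) syl) ((theta \<circ> ?idx) \<chi>)
      (restrict \<chi> (normalizer (symg (3 ^ k)) syl))"
    unfolding normalizer_syl norg_def[symmetric] j(2) using theta_constituent[OF j(1)] by (simp add: j(2))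
qed

end

section \<open>Sylow subgroups\<close>

text \<open>Orbit sizes divide a power of \<open>p\<close>; without a fixed point each would be
  divisible by \<open>p\<close>, and so would their sum.\<close>

lemma (in group_action) p_group_fixed_point:
  assumes fin: "finite E" and p: "Factorial_Ring.prime (p::nat)" and card: "Coset.order G = p ^ m"
    and ndvd: "\<not> p dvd card E"
  shows "\<exists>x\<in>E. \<forall>g\<in>carrier G. \<phi> g x = x"
proof (rule ccontr)
  assume nofix: "\<not> ?thesis"
  have "p dvd card B" if B: "B \<in> orbits G E \<phi>" for B
  proof -
    obtain x where x: "x \<in> E" "B = orbit G \<phi> x" using B by (auto simp: orbits_def)
    have "card B dvd p ^ m"
      using orbit_stabilizer_theorem[OF x(1)] unfolding card x(2) by (metis dvd_triv_left)
    then obtain i where i: "card B = p ^ i" using divides_primepow_nat[OF p] by blast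
    obtain g where g: "g \<in> carrier G" "\<phi> g x \<noteq> x" using nofix x(1) by blast
    have "{x, \<phi> g x} \<subseteq> B" using orbit_refl[OF x(1)] g(1) unfolding x(2) orbit_def by auto
    moreover have "finite B"
      using fin B orbits_coverture by (metis Union_upper finite_subset)
    ultimately have "card {x, \<phi> g x} \<le> card B" by (rule card_mono[rotated])
    then have "i \<noteq> 0" using g(2) i by (cases i) auto
    then show ?thesis unfolding i by simp
  qed
  then have "p dvd (\<Sum>B\<in>orbits G E \<phi>. card B)" by (rule dvd_sum)
  also have "(\<Sum>B\<in>orbits G E \<phi>. card B) = card E"
    using disjoint_sum[OF fin, of "\<lambda>_. 1::nat"] by simp
  finally show False using ndvd by simp
qed

text \<open>The cosets are right cosets, so \<open>Q\<close> multiplies them from the right, with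
  the inverse in order to give a homomorphism.\<close>

lemma (in group) subgroup_acts_on_rcosets:
  assumes P: "subgroup P G" and Q: "subgroup Q G"
  shows "group_action (G\<lparr>carrier := Q\<rparr>) (rcosets P) (\<lambda>q. \<lambda>C\<in>rcosets P. C #> inv q)"
proof -
  have Pc: "P \<subseteq> carrier G" and Qc: "\<And>q. q \<in> Q \<Longrightarrow> q \<in> carrier G"
    using P Q subgroup.subset by blast+
  have sub: "C \<subseteq> carrier G" if "C \<in> rcosets P" for C
    using rcosets_subset_PowG[OF P] that by auto
  have move: "C #> g \<in> rcosets P" if C: "C \<in> rcosets P" and g: "g \<in> carrier G" for C g
  proof -
    obtain a where a: "a \<in> carrier G" "C = P #> a" using C by (auto simp: RCOSETS_def)
    then have "C #> g = P #> (a \<otimes> g)" using coset_mult_assoc[OF Pc] g by simp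
    then show ?thesis using rcosetsI[OF Pc, of "a \<otimes> g"] a g by simp
  qed
  have bij: "bij_betw (\<lambda>C. C #> inv q) (rcosets P) (rcosets P)" if q: "q \<in> Q" for q
  proof (rule bij_betw_byWitness[where f' = "\<lambda>C. C #> q"])
    show "\<forall>C\<in>rcosets P. C #> inv q #> q = C" "\<forall>C\<in>rcosets P. C #> q #> inv q = C"
      using sub Qc[OF q] by (simp_all add: coset_mult_assoc)
    show "(\<lambda>C. C #> inv q) ` (rcosets P) \<subseteq> rcosets P" "(\<lambda>C. C #> q) ` (rcosets P) \<subseteq> rcosets P"
      using move Qc[OF q] by auto
  qed
  have "(\<lambda>q. \<lambda>C\<in>rcosets P. C #> inv q) \<in> hom (G\<lparr>carrier := Q\<rparr>) (BijGroup (rcosets P))"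
  proof (rule homI)
    fix q assume "q \<in> carrier (G\<lparr>carrier := Q\<rparr>)"
    then have "q \<in> Q" by simp
    then show "(\<lambda>C\<in>rcosets P. C #> inv q) \<in> carrier (BijGroup (rcosets P))"
      using bij by (simp add: BijGroup_def Bij_def)
  next
    fix q r assume "q \<in> carrier (G\<lparr>carrier := Q\<rparr>)" "r \<in> carrier (G\<lparr>carrier := Q\<rparr>)"
    then have q: "q \<in> Q" and r: "r \<in> Q" by simp_all
    have "(\<lambda>C\<in>rcosets P. C #> inv (q \<otimes> r)) = compose (rcosets P) (\<lambda>C\<in>rcosets P. C #> inv q) (\<lambda>C\<in>rcosets P. C #> inv r)"
    proof (rule HOL.ext)
      fix C
      show "(\<lambda>C\<in>rcosets P. C #> inv (q \<otimes> r)) C =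
          compose (rcosets P) (\<lambda>C\<in>rcosets P. C #> inv q) (\<lambda>C\<in>rcosets P. C #> inv r) C"
        using sub[of C] move[of C "inv r"] Qc[OF q] Qc[OF r]
        by (simp add: compose_def inv_mult_group coset_mult_assoc)
    qed
    then show "(\<lambda>C\<in>rcosets P. C #> inv (q \<otimes>\<^bsub>G\<lparr>carrier := Q\<rparr>\<^esub> r)) =
        (\<lambda>C\<in>rcosets P. C #> inv q) \<otimes>\<^bsub>BijGroup (rcosets P)\<^esub> (\<lambda>C\<in>rcosets P. C #> inv r)"
      using bij q r by (simp add: BijGroup_def Bij_def)
  qed
  moreover have "group (G\<lparr>carrier := Q\<rparr>)" using Q by (rule subgroup_imp_group)
  ultimately show ?thesis
    by (intro group_action.intro group_hom.intro group_hom_axioms.intro group_BijGroup)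
qed

text \<open>\<open>Q\<close> acts on the cosets of \<open>P\<close>, whose number is not divisible
  by \<open>p\<close>; a fixed coset \<open>P #> g\<close> yields the conjugating element
  \<open>g\<close>.\<close>

lemma (in group) sylow_conjugate:
  assumes fin: "finite (carrier G)" and p: "Factorial_Ring.prime p"
    and P: "P \<in> sylow_subgroups p G" and Q: "Q \<in> sylow_subgroups p G"
  shows "\<exists>g\<in>carrier G. (\<lambda>x. g \<otimes> x \<otimes> inv g) ` Q = P"
proof -
  define e where "e = multiplicity p (Coset.order G)"
  have sP: "subgroup P G" and sQ: "subgroup Q G" and cP: "card P = p ^ e" and cQ: "card Q = p ^ e"
    using P Q by (simp_all add: sylow_subgroups_def e_def)
  have Pc: "P \<subseteq> carrier G" and Qc: "Q \<subseteq> carrier G" using sP sQ subgroup.subset by blast+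
  have pos: "Coset.order G \<noteq> 0" using fin order_gt_0_iff_finite by simp
  interpret act: group_action "G\<lparr>carrier := Q\<rparr>" "rcosets P" "\<lambda>q. \<lambda>C\<in>rcosets P. C #> inv q"
    by (rule subgroup_acts_on_rcosets[OF sP sQ])
  have finE: "finite (rcosets P)"
    using rcosets_subset_PowG[OF sP] fin by (meson finite_Pow_iff finite_subset)
  have "\<not> p dvd card (rcosets P)"
  proof
    assume "p dvd card (rcosets P)"
    then have "p * p ^ e dvd Coset.order G"
      using lagrange_finite[OF fin sP] unfolding cP by (metis mult_dvd_mono dvd_refl)
    then have "p ^ Suc e dvd Coset.order G" by simp
    then have "Suc e \<le> e" unfolding e_def
      using pos p by (intro multiplicity_geI) (auto dest: prime_gt_1_nat)
    then show False by simp
  qed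
  moreover have "Coset.order (G\<lparr>carrier := Q\<rparr>) = p ^ e" using cQ by (simp add: Coset.order_def)
  ultimately obtain C where C: "C \<in> rcosets P" "\<And>q. q \<in> Q \<Longrightarrow> C #> inv q = C"
    using act.p_group_fixed_point[OF finE p, of e] by auto
  then obtain g where g: "g \<in> carrier G" "C = P #> g" by (auto simp: RCOSETS_def)
  have "g \<otimes> q \<otimes> inv g \<in> P" if q: "q \<in> Q" for q
  proof -
    have qc: "q \<in> carrier G" using q Qc by auto
    have "C #> inv (inv q) = C" using C(2) q subgroup.m_inv_closed[OF sQ] by blast
    then have "P #> (g \<otimes> q) = P #> g" using coset_mult_assoc[OF Pc g(1)] qc unfolding g(2) by simp
    moreover have "g \<otimes> q \<in> P #> (g \<otimes> q)" using rcos_self[OF _ sP] g(1) qc by simp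
    ultimately have "g \<otimes> q \<in> P #> g" by simp
    then obtain s where s: "s \<in> P" "g \<otimes> q = s \<otimes> g" by (auto simp: r_coset_def)
    then have "g \<otimes> q \<otimes> inv g = s" using g(1) Pc by (simp add: subsetD inv_solve_right')
    then show ?thesis using s by simp
  qed
  then have sub: "(\<lambda>x. g \<otimes> x \<otimes> inv g) ` Q \<subseteq> P" by auto
  have "inj_on (\<lambda>x. g \<otimes> x \<otimes> inv g) Q"
    using g(1) Qc by (intro inj_onI) (simp add: subsetD)
  then have "card ((\<lambda>x. g \<otimes> x \<otimes> inv g) ` Q) = card P" by (simp add: card_image cP cQ)
  moreover have "finite P" using Pc fin by (rule finite_subset)
  ultimately have "(\<lambda>x. g \<otimes> x \<otimes> inv g) ` Q = P" using sub by (intro card_subset_eq)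
  then show ?thesis using g(1) by blast
qed

text \<open>Among the three new factors only 3 (m + 1) is divisible by 3. Iteration gives the
  exponent of 3 in the factorial of 3^k, to be matched with \<open>card_syl\<close>.\<close>

lemma multiplicity_3_fact: "multiplicity 3 (fact (3 * m) :: nat) = m + multiplicity 3 (fact m :: nat)"
proof (induction m)
  case (Suc m)
  have pr: "prime_elem (3::nat)" by simp
  have m0: "multiplicity 3 (Suc (3 * m)) = 0" "multiplicity 3 (Suc (Suc (3 * m))) = 0"
    by (rule not_dvd_imp_multiplicity_0, presburger)+
  have m1: "multiplicity 3 (3 * Suc m) = Suc (multiplicity 3 (Suc m))"
    by (rule multiplicity_times_same) auto
  have "(fact (3 * Suc m) :: nat) = (3 * Suc m) * (Suc (Suc (3 * m)) * (Suc (3 * m) * fact (3 * m)))"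
  proof -
    have "3 * Suc m = Suc (Suc (Suc (3 * m)))" by simp
    then show ?thesis by (simp only: fact_Suc of_nat_id)
  qed
  then have "multiplicity 3 (fact (3 * Suc m) :: nat) = multiplicity 3 (3 * Suc m) +
      (multiplicity 3 (Suc (Suc (3 * m))) + (multiplicity 3 (Suc (3 * m)) + multiplicity 3 (fact (3 * m) :: nat)))"
    by (simp only:) (simp only: prime_elem_multiplicity_mult_distrib[OF pr] fact_nonzero mult_eq_0_iff nat.distinct
      zero_neq_numeral[symmetric] simp_thms)
  also have "\<dots> = Suc m + (multiplicity 3 (Suc m) + multiplicity 3 (fact m :: nat))"
    unfolding m0 m1 Suc by simp
  also have "multiplicity 3 (Suc m) + multiplicity 3 (fact m :: nat) = multiplicity 3 (fact (Suc m) :: nat)"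
    by (simp only: fact_Suc of_nat_id prime_elem_multiplicity_mult_distrib[OF pr] fact_nonzero nat.distinct not_False_eq_True)
  finally show ?case .
qed simp

lemma (in ternary) syl_sylow: "syl \<in> sylow_subgroups 3 (symg (3 ^ k))"
proof -
  have "multiplicity 3 (fact (3 ^ m) :: nat) = (\<Sum>i<m. 3 ^ i)" for m
    by (induction m) (simp_all add: multiplicity_3_fact)
  then have "card syl = 3 ^ multiplicity 3 (Coset.order (symg (3 ^ k)))"
    by (simp add: card_syl Coset.order_def card_symg)
  then show ?thesis using syl_subgroup by (simp add: sylow_subgroups_def)
qed

section \<open>Transport along isomorphisms\<close>

text \<open>Restricted to the carrier because members of \<open>Irr\<close> take the value
  \<open>undefined\<close> outside the group.\<close>

definition pullback :: "('a, 'c) monoid_scheme \<Rightarrow> ('a \<Rightarrow> 'b) \<Rightarrow> ('b \<Rightarrow> complex) \<Rightarrow> 'a \<Rightarrow> complex"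
  where "pullback G f \<chi> = restrict (\<chi> \<circ> f) (carrier G)"

lemma pullback_Irr:
  assumes f: "f \<in> iso G H" and \<chi>: "\<chi> \<in> Irr H"
  shows "pullback G f \<chi> \<in> Irr G"
proof -
  obtain n \<rho> where \<rho>: "irreducible_rep H n \<rho>" "\<chi> = rep_character H \<rho>" using \<chi> by (auto simp: Irr_def)
  have hom: "f \<in> hom G H" and surj: "f ` carrier G = carrier H"
    using f by (auto simp: iso_def bij_betw_def)
  have "matrix_rep G n (\<rho> \<circ> f)"
    using \<rho>(1) hom_compose[OF hom, of \<rho> "GL n"] by (simp add: irreducible_rep_def matrix_rep_def)
  moreover have "(\<forall>g\<in>carrier G. \<forall>w\<in>W. (\<rho> \<circ> f) g *\<^sub>v w \<in> W) \<longleftrightarrow> (\<forall>h\<in>carrier H. \<forall>w\<in>W. \<rho> h *\<^sub>v w \<in> W)" for W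
    unfolding surj[symmetric] by simp
  ultimately have "irreducible_rep G n (\<rho> \<circ> f)"
    using \<rho>(1) unfolding irreducible_rep_def by simp
  moreover have "pullback G f \<chi> = rep_character G (\<rho> \<circ> f)"
    unfolding \<rho>(2) pullback_def rep_character_def using surj by (intro restrict_ext) auto
  ultimately show ?thesis by (auto simp: Irr_def)
qed

lemma pullback_Irr_p':
  assumes "group G" "group H" "f \<in> iso G H" "\<chi> \<in> Irr_p' p H"
  shows "pullback G f \<chi> \<in> Irr_p' p G"
proof -
  have "f \<one>\<^bsub>G\<^esub> = \<one>\<^bsub>H\<^esub>" using hom_one[of f G H] assms by (simp add: iso_def)
  moreover have "\<one>\<^bsub>G\<^esub> \<in> carrier G" using assms(1) by (simp add: group.is_monoid monoid.one_closed)
  ultimately show ?thesis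
    using assms(4) pullback_Irr[OF assms(3)] by (simp add: Irr_p'_def pullback_def)
qed

lemma pullback_bij:
  assumes G: "group G" and H: "group H" and f: "f \<in> iso G H"
  shows "bij_betw (pullback G f) (Irr_p' p H) (Irr_p' p G)"
proof -
  let ?f' = "inv_into (carrier G) f"
  have f': "?f' \<in> iso H G" by (rule group.iso_set_sym[OF G f])
  have bij: "bij_betw f (carrier G) (carrier H)" using f by (simp add: iso_def)
  show ?thesis
  proof (rule bij_betw_byWitness[where f' = "pullback H ?f'"])
    show "\<forall>\<chi>\<in>Irr_p' p H. pullback H ?f' (pullback G f \<chi>) = \<chi>"
    proof (intro ballI HOL.ext)
      fix \<chi> h assume \<chi>: "\<chi> \<in> Irr_p' p H"
      show "pullback H ?f' (pullback G f \<chi>) h = \<chi> h"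
      proof (cases "h \<in> carrier H")
        case True
        then have "?f' h \<in> carrier G" "f (?f' h) = h"
          using bij bij_betw_apply[OF bij_betw_inv_into[OF bij]] bij_betw_inv_into_right by auto
        then show ?thesis using True by (simp add: pullback_def)
      next
        case False
        then show ?thesis using \<chi> Irr_undefined[of \<chi> H h] by (simp add: pullback_def Irr_p'_def)
      qed
    qed
    show "\<forall>\<chi>\<in>Irr_p' p G. pullback G f (pullback H ?f' \<chi>) = \<chi>"
    proof (intro ballI HOL.ext)
      fix \<chi> g assume \<chi>: "\<chi> \<in> Irr_p' p G"
      show "pullback G f (pullback H ?f' \<chi>) g = \<chi> g"
      proof (cases "g \<in> carrier G")
        case True
        then have "f g \<in> carrier H" "?f' (f g) = g"
          using bij bij_betw_apply[OF bij] bij_betw_inv_into_left by auto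
        then show ?thesis using True by (simp add: pullback_def)
      next
        case False
        then show ?thesis using \<chi> Irr_undefined[of \<chi> G g] by (simp add: pullback_def Irr_p'_def)
      qed
    qed
    show "pullback G f ` Irr_p' p H \<subseteq> Irr_p' p G" using pullback_Irr_p'[OF G H f] by auto
    show "pullback H ?f' ` Irr_p' p G \<subseteq> Irr_p' p H" using pullback_Irr_p'[OF H G f'] by auto
  qed
qed

lemma pullback_constituent:
  assumes f: "f \<in> iso G H" and c: "irreducible_constituent H \<theta> \<psi>"
    and \<psi>: "\<And>g. g \<in> carrier G \<Longrightarrow> \<psi>' g = \<psi> (f g)"
  shows "irreducible_constituent G (pullback G f \<theta>) \<psi>'"
proof -
  obtain M where M: "set_mset M \<subseteq> Irr H" "\<theta> \<in># M" "\<And>h. h \<in> carrier H \<Longrightarrow> \<psi> h = (\<Sum>\<phi>\<in>#M. \<phi> h)"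
    using c unfolding irreducible_constituent_def by blast
  show ?thesis unfolding irreducible_constituent_def
  proof (intro exI conjI ballI)
    show "set_mset (image_mset (pullback G f) M) \<subseteq> Irr G" using M(1) pullback_Irr[OF f] by auto
    show "pullback G f \<theta> \<in># image_mset (pullback G f) M" using M(2) by simp
    fix g assume g: "g \<in> carrier G"
    then have "f g \<in> carrier H" using f by (auto simp: iso_def hom_def)
    then show "\<psi>' g = (\<Sum>\<phi>\<in>#image_mset (pullback G f) M. \<phi> g)"
      using g \<psi>[OF g] M(3) by (simp add: pullback_def image_mset.compositionality comp_def)
  qed
qed

lemma iso_normalizer:
  assumes G: "group G" and H: "group H" and f: "f \<in> iso G H" and P: "P \<subseteq> carrier G"
  shows "f \<in> iso (normalizer_group G P) (normalizer_group H (f ` P))"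
proof -
  interpret G: group G by fact
  interpret H: group H by fact
  have hom: "f \<in> hom G H" and inj: "inj_on f (carrier G)" and surj: "f ` carrier G = carrier H"
    using f by (auto simp: iso_def bij_betw_def)
  interpret f: group_hom G H f by unfold_locales (rule hom)
  have Q: "f ` P \<subseteq> carrier H" using P surj by auto
  have conj: "(\<lambda>y. f g \<otimes>\<^bsub>H\<^esub> y \<otimes>\<^bsub>H\<^esub> inv\<^bsub>H\<^esub> f g) ` (f ` P) = f ` (\<lambda>x. g \<otimes>\<^bsub>G\<^esub> x \<otimes>\<^bsub>G\<^esub> inv\<^bsub>G\<^esub> g) ` P"
    if g: "g \<in> carrier G" for g
    unfolding image_image using g P by (intro image_cong) (auto simp: subsetD)
  have mem: "f g \<in> normalizer H (f ` P) \<longleftrightarrow> g \<in> normalizer G P" if g: "g \<in> carrier G" for g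
  proof -
    have sub: "(\<lambda>x. g \<otimes>\<^bsub>G\<^esub> x \<otimes>\<^bsub>G\<^esub> inv\<^bsub>G\<^esub> g) ` P \<subseteq> carrier G" using g P by auto
    show ?thesis
      unfolding normalizer_iff[OF P] normalizer_iff[OF Q] conj[OF g] inj_on_image_eq_iff[OF inj sub P]
      using g by simp
  qed
  have sub: "normalizer G P \<subseteq> carrier G" "normalizer H (f ` P) \<subseteq> carrier H"
    using normalizer_iff[OF P] normalizer_iff[OF Q] by auto
  have "f ` normalizer G P = normalizer H (f ` P)"
  proof
    show "f ` normalizer G P \<subseteq> normalizer H (f ` P)" using mem sub(1) by auto
    show "normalizer H (f ` P) \<subseteq> f ` normalizer G P"
    proof
      fix h assume h: "h \<in> normalizer H (f ` P)"
      then obtain g where g: "g \<in> carrier G" "h = f g" using sub(2) surj by auto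
      then show "h \<in> f ` normalizer G P" using h mem by auto
    qed
  qed
  then have "bij_betw f (normalizer G P) (normalizer H (f ` P))"
    using inj_on_subset[OF inj sub(1)] by (simp add: bij_betw_def)
  moreover have "f \<in> hom (normalizer_group G P) (normalizer_group H (f ` P))"
    using sub(1) mem by (intro homI) (auto simp: subsetD)
  ultimately show ?thesis by (simp add: iso_def)
qed

lemma (in group) conjugation_iso:
  assumes g: "g \<in> carrier G"
  shows "(\<lambda>x. g \<otimes> x \<otimes> inv g) \<in> iso G G"
proof -
  have "g \<otimes> (x \<otimes> y) \<otimes> inv g = (g \<otimes> x \<otimes> inv g) \<otimes> (g \<otimes> y \<otimes> inv g)" if "x \<in> carrier G" "y \<in> carrier G" for x y
  proof -
    have "(g \<otimes> x \<otimes> inv g) \<otimes> (g \<otimes> y \<otimes> inv g) = g \<otimes> x \<otimes> (inv g \<otimes> g) \<otimes> y \<otimes> inv g"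
      using g that by (simp only: m_assoc m_closed inv_closed)
    then show ?thesis using g that by (simp add: m_assoc)
  qed
  moreover have "bij_betw (\<lambda>x. g \<otimes> x \<otimes> inv g) (carrier G) (carrier G)"
  proof (rule bij_betw_byWitness[where f' = "\<lambda>x. inv g \<otimes> x \<otimes> g"])
    have "inv g \<otimes> (g \<otimes> x \<otimes> inv g) \<otimes> g = (inv g \<otimes> g) \<otimes> x \<otimes> (inv g \<otimes> g)"
      "g \<otimes> (inv g \<otimes> x \<otimes> g) \<otimes> inv g = (g \<otimes> inv g) \<otimes> x \<otimes> (g \<otimes> inv g)" if "x \<in> carrier G" for x
      using g that by (simp_all only: m_assoc m_closed inv_closed)
    then show "\<forall>x\<in>carrier G. inv g \<otimes> (g \<otimes> x \<otimes> inv g) \<otimes> g = x" "\<forall>x\<in>carrier G. g \<otimes> (inv g \<otimes> x \<otimes> g) \<otimes> inv g = x"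
      using g by simp_all
  qed (use g in auto)
  ultimately show ?thesis using g by (simp add: iso_def hom_def)
qed

lemma sym_group_iso:
  "map_permutation {1..n} (\<lambda>x. x - 1) \<in> iso (sym_group n) (symg n)"
proof -
  let ?F = "map_permutation {1..n} (\<lambda>x. x - 1)" and ?F' = "map_permutation {..<n} Suc"
  have b: "bij_betw (\<lambda>x. x - 1) {1..n} {..<n}" and b': "bij_betw Suc {..<n} {1..n}"
    by (rule bij_betw_byWitness[where f' = Suc]; force)
      (rule bij_betw_byWitness[where f' = "\<lambda>x. x - 1"]; force)
  have "bij_betw ?F {p. p permutes {1..n}} {p. p permutes {..<n}}"
  proof (rule bij_betw_byWitness[where f' = ?F'])
    show "\<forall>p\<in>{p. p permutes {1..n}}. ?F' (?F p) = p"
      using map_permutation_compose_inv[OF b] by auto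
    show "\<forall>p\<in>{p. p permutes {..<n}}. ?F (?F' p) = p"
      using map_permutation_compose_inv[OF b'] by auto
  qed (use map_permutation_permutes[OF b] map_permutation_permutes[OF b'] in auto)
  moreover have "?F (p \<circ> q) = ?F p \<circ> ?F q" if "q permutes {1..n}" for p q
    using map_permutation_compose' b that unfolding bij_betw_def by blast
  moreover have "carrier (symg n) = {p. p permutes {..<n}}" by (auto simp: symg_simps)
  ultimately show ?thesis
    using map_permutation_permutes[OF b]
    by (simp add: iso_def hom_def symg_simps sym_group_def)
qed

text \<open>The isomorphism restricts to the normalizers, and restriction of characters commutes
  with pullback, so both sides are pulled back along the same map.\<close>

lemma transport_bijection:
  assumes G: "group G" and H: "group H" and f: "f \<in> iso G H" and P: "P \<subseteq> carrier G"
    and \<Phi>: "bij_betw \<Phi> (Irr_p' p H) (Irr_p' p (normalizer_group H (f ` P)))"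
    and con: "\<And>\<chi>. \<chi> \<in> Irr_p' p H \<Longrightarrow>
      irreducible_constituent (normalizer_group H (f ` P)) (\<Phi> \<chi>) (restrict \<chi> (normalizer H (f ` P)))"
  shows "\<exists>\<Psi>. bij_betw \<Psi> (Irr_p' p G) (Irr_p' p (normalizer_group G P)) \<and>
    (\<forall>\<chi>\<in>Irr_p' p G. irreducible_constituent (normalizer_group G P) (\<Psi> \<chi>) (restrict \<chi> (normalizer G P)))"
proof -
  let ?N = "normalizer_group G P" and ?M = "normalizer_group H (f ` P)"
  define r where "r = inv_into (Irr_p' p H) (pullback G f)"
  have Q: "f ` P \<subseteq> carrier H" using f P by (auto simp: iso_def bij_betw_def)
  have N: "group ?N" and M: "group ?M"
    using group.subgroup_imp_group[OF G group.normalizer_imp_subgroup[OF G P]]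
      group.subgroup_imp_group[OF H group.normalizer_imp_subgroup[OF H Q]] by auto
  have fN: "f \<in> iso ?N ?M" by (rule iso_normalizer[OF G H f P])
  have b: "bij_betw (pullback G f) (Irr_p' p H) (Irr_p' p G)" by (rule pullback_bij[OF G H f])
  have br: "bij_betw r (Irr_p' p G) (Irr_p' p H)" unfolding r_def by (rule bij_betw_inv_into[OF b])
  have "bij_betw (pullback ?N f \<circ> (\<Phi> \<circ> r)) (Irr_p' p G) (Irr_p' p ?N)"
    by (rule bij_betw_trans[OF bij_betw_trans[OF br \<Phi>] pullback_bij[OF N M fN]])
  moreover have "irreducible_constituent ?N ((pullback ?N f \<circ> (\<Phi> \<circ> r)) \<chi>) (restrict \<chi> (normalizer G P))"
    if \<chi>: "\<chi> \<in> Irr_p' p G" for \<chi>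
  proof -
    have r\<chi>: "r \<chi> \<in> Irr_p' p H" using bij_betw_apply[OF br \<chi>] .
    have eq: "pullback G f (r \<chi>) = \<chi>" unfolding r_def by (rule bij_betw_inv_into_right[OF b \<chi>])
    have "irreducible_constituent ?N (pullback ?N f (\<Phi> (r \<chi>))) (restrict \<chi> (normalizer G P))"
    proof (rule pullback_constituent[OF fN con[OF r\<chi>]])
      fix g assume "g \<in> carrier ?N"
      then have g: "g \<in> normalizer G P" by simp
      then have "g \<in> carrier G" using normalizer_iff[OF P] by simp
      moreover have "f g \<in> normalizer H (f ` P)" using g bij_betw_apply[of f] fN by (auto simp: iso_def)
      ultimately show "restrict \<chi> (normalizer G P) g = restrict (r \<chi>) (normalizer H (f ` P)) (f g)"
        using g fun_cong[OF eq, of g] by (simp add: pullback_def)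
    qed
    then show ?thesis by simp
  qed
  ultimately show ?thesis by blast
qed

theorem theorem3p7:
  fixes k :: nat and P :: "(nat \<Rightarrow> nat) set"
  assumes "k \<ge> 1"
    and "P \<in> sylow_subgroups 3 (sym_group (3 ^ k))"
  shows "\<exists>\<Phi>. bij_betw \<Phi> (Irr_p' 3 (sym_group (3 ^ k)))
                (Irr_p' 3 (normalizer_group (sym_group (3 ^ k)) P)) \<and>
          (\<forall>\<chi> \<in> Irr_p' 3 (sym_group (3 ^ k)).
             irreducible_constituent (normalizer_group (sym_group (3 ^ k)) P) (\<Phi> \<chi>)
               (restrict \<chi> (normalizer (sym_group (3 ^ k)) P)))"
proof -
  interpret ternary k by unfold_locales (use assms(1) in simp)
  let ?G = "sym_group (3 ^ k)" and ?H = "symg (3 ^ k)"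
  interpret G: group ?G by (rule sym_group_is_group)
  interpret H: group ?H by (rule symg_group)
  define f where "f = map_permutation {1..3 ^ k :: nat} (\<lambda>x. x - 1)"
  have f: "f \<in> iso ?G ?H" unfolding f_def by (rule sym_group_iso)
  then have bij: "bij_betw f (carrier ?G) (carrier ?H)" and hom: "f \<in> hom ?G ?H" by (auto simp: iso_def)
  interpret f: group_hom ?G ?H f by unfold_locales (rule hom)
  have P: "subgroup P ?G" "card P = 3 ^ multiplicity 3 (Coset.order ?G)"
    using assms(2) by (auto simp: sylow_subgroups_def)
  have Pc: "P \<subseteq> carrier ?G" by (rule subgroup.subset[OF P(1)])
  have "Coset.order ?G = Coset.order ?H" using bij_betw_same_card[OF bij] by (simp add: Coset.order_def)
  moreover have "card (f ` P) = card P" using bij Pc by (meson bij_betw_def card_image inj_on_subset)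
  ultimately have "f ` P \<in> sylow_subgroups 3 ?H"
    using f.subgroup_img_is_subgroup[OF P(1)] P(2) by (simp add: sylow_subgroups_def)
  then have "\<exists>g\<in>carrier ?H. (\<lambda>x. g \<otimes>\<^bsub>?H\<^esub> x \<otimes>\<^bsub>?H\<^esub> inv\<^bsub>?H\<^esub> g) ` f ` P = syl"
    by (rule H.sylow_conjugate[OF symg_finite _ syl_sylow, rotated]) simp
  then obtain g where g: "g \<in> carrier ?H"
    "(\<lambda>x. g \<otimes>\<^bsub>?H\<^esub> x \<otimes>\<^bsub>?H\<^esub> inv\<^bsub>?H\<^esub> g) ` f ` P = syl"
    by blast
  \<comment> \<open>The shift \<open>f\<close> of the points is followed by a conjugation taking the
    image of \<open>P\<close> to \<open>syl\<close>, so that a single isomorphism reduces an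
    arbitrary Sylow subgroup to coordinates.\<close>
  define F where "F = (\<lambda>x. g \<otimes>\<^bsub>?H\<^esub> x \<otimes>\<^bsub>?H\<^esub> inv\<^bsub>?H\<^esub> g) \<circ> f"
  have F: "F \<in> iso ?G ?H" unfolding F_def by (rule iso_set_trans[OF f H.conjugation_iso[OF g(1)]])
  have FP: "F ` P = syl" unfolding F_def image_comp[symmetric] by (rule g(2))
  obtain \<Phi> where \<Phi>: "bij_betw \<Phi> (Irr_p' 3 ?H) (Irr_p' 3 (normalizer_group ?H (F ` P)))"
    "\<And>\<chi>. \<chi> \<in> Irr_p' 3 ?H \<Longrightarrow>
      irreducible_constituent (normalizer_group ?H (F ` P)) (\<Phi> \<chi>) (restrict \<chi> (normalizer ?H (F ` P)))"
    using ternary_bijection unfolding FP by blast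
  show ?thesis
    by (rule transport_bijection[OF sym_group_is_group symg_group F Pc \<Phi>])
qed

end
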